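(* Let $(M,\omega,F=(L,H))$ and $(M',\omega',F'=(L',H'))$ be semitoric integrable systems, and let $m\in M$ be a focus-focus point which is the only singular point in $F^{-1}(F(m))$. Let $\Phi:M\to M'$ be a symplectomorphism such that $\Phi^*(L',H')=(\varepsilon_1L,\varepsilon_2H)$ for some $\varepsilon_1,\varepsilon_2\in\{-1,+1\}$. Then $\Phi(m)$ is a focus-focus point, and $$S_m^\infty(l,j)=\varepsilon_2\,(S'_{\Phi(m)})^\infty(\varepsilon_1l,\varepsilon_2j)+\Bigl(\frac{1-\varepsilon_1}{2}\Bigr)\pi l\pmod{2\pi l},$$ where $S_m^\infty(l,j)$ denotes the Taylor series invariant of $(M,\omega,F)$ at $m$ and $(S'_{\Phi(m)})^\infty(l,j)$ denotes the Taylor series invariant of $(M',\omega',F')$ at $\Phi(m)$.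
   Context: A semitoric system is a $4$-dimensional completely integrable system $(M,\omega,F=(L,H))$ such that the Hamiltonian flow of $L$ is an effective $\mathbb{S}^1=\mathbb{R}/2\pi\mathbb{Z}$-action, $L$ is proper, and all singular points of $F$ are non-degenerate without hyperbolic components. Hamiltonian vector fields satisfy $\omega(\mathcal X_f,\cdot)=-df$. On $\mathbb{R}^4$ take $\omega_{\mathbb{R}^4}=dp_1\wedge dq_1+dp_2\wedge dq_2$ and $G=(q_1p_2-q_2p_1,\;q_1p_1+q_2p_2)$. A focus-focus point $m$ is a rank $0$ singular point for which there are a symplectomorphism $\varphi$ from a neighborhood $U$ of $m$ onto a neighborhood of $0\in\mathbb{R}^4$ and a local diffeomorphism $\varrho$ with $\varrho(F(m))=0$ and $\varrho\circ F=G\circ\varphi$. Taylor series invariant of a focus-focus point $m$ that is the only singular point in its fiber: choose $(\varphi,\varrho)$ with $\varrho(l,h)=(l-L(m),\varrho_2(l,h))$ and $\partial\varrho_2/\partial h>0$. Let $W=F^{-1}(F(U))$, let $\varrho\circ F:W\to\mathbb{R}^2\simeq\mathbb{C}$, let $z=l+ij$ be the coordinate on the image, and $\Lambda_z=(\varrho\circ F)^{-1}(z)$, a $2$-torus for $z\ne0$. Choose a vertical ray $b$ from $0$ (up or down), a determination of $\log$ with branch cut $b$, the cycle $\gamma_L^z$ given by the flow of $\mathcal X_L$ on $\Lambda_z$, and a cycle $\gamma_2^z$ varying smoothly with $z$ in the image of $W$ minus $b$ such that $\{\gamma_L^z,\gamma_2^z\}$ is a basis of $H_1(\Lambda_z)$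 and $I(z)=\frac1{2\pi}\oint_{\gamma_2^z}\varpi$ satisfies $\partial I/\partial j>0$, where $\varpi$ is a primitive of $\omega|_W$. Then $S(z)=2\pi I(z)-2\pi I(0)+\mathrm{Im}(z\log z-z)$ (with $I(0)=\lim_{z\to0}I(z)$) extends to a smooth function near $0$, and its Taylor series $S_m^\infty$ at $0$ in $(l,j)$ is well defined modulo integer multiples of $2\pi l$; this class in $\mathbb{R}_0[[l,j]]/(2\pi l\,\mathbb{Z})$ (power series without constant term) is the Taylor series invariant at $m$. *)

theory Defs
  imports
    "HOL-Analysis.Analysis"
    "HOL-Computational_Algebra.Formal_Power_Series"
    "HOL-Homology.Homology"
begin

section \<open>Smooth functions between normed spaces\<close>

definition dir_deriv ::
    "'a::real_normed_vector \<Rightarrow> ('a \<Rightarrow> 'b::real_normed_vector) \<Rightarrow> 'a \<Rightarrow> 'b" where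
  "dir_deriv v f = (\<lambda>x. frechet_derivative f (at x) v)"

primrec Ck_on ::
    "nat \<Rightarrow> 'a::real_normed_vector set \<Rightarrow> ('a \<Rightarrow> 'b::real_normed_vector) \<Rightarrow> bool" where
  "Ck_on 0 S f \<longleftrightarrow> continuous_on S f"
| "Ck_on (Suc k) S f \<longleftrightarrow> f differentiable_on S \<and> (\<forall>v. Ck_on k S (dir_deriv v f))"

definition smooth_on ::
    "'a::real_normed_vector set \<Rightarrow> ('a \<Rightarrow> 'b::real_normed_vector) \<Rightarrow> bool" where
  "smooth_on S f \<longleftrightarrow> open S \<and> (\<forall>k. Ck_on k S f)"

definition diffeo_on ::
    "'a::real_normed_vector set \<Rightarrow> ('a \<Rightarrow> 'b::real_normed_vector) \<Rightarrow> bool" where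
  "diffeo_on D f \<longleftrightarrow>
     smooth_on D f \<and> inj_on f D \<and> smooth_on (f ` D) (inv_into D f)"


section \<open>Four-dimensional manifolds\<close>

text \<open>The underlying set of a manifold is a whole type, Hausdorff and second countable by its
  sort. A chart is its open domain together with the coordinate map.\<close>

type_synonym 'a chart = "'a set \<times> ('a \<Rightarrow> real^4)"

definition coord_rep :: "'a chart \<Rightarrow> ('a \<Rightarrow> 'b) \<Rightarrow> real^4 \<Rightarrow> 'b" where
  "coord_rep c f = f \<circ> inv_into (fst c) (snd c)"

text \<open>The differential at \<open>p\<close>, on the tangent space identified with \<^typ>\<open>real^4\<close> by the chart
  \<open>c\<close>. In particular \<open>differential c (snd c') p\<close> is the Jacobian of the change of coordinates
  from \<open>c\<close> to \<open>c'\<close>.\<close>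

definition differential ::
    "'a chart \<Rightarrow> ('a \<Rightarrow> 'b::real_normed_vector) \<Rightarrow> 'a \<Rightarrow> real^4 \<Rightarrow> 'b" where
  "differential c f p = frechet_derivative (coord_rep c f) (at (snd c p))"

definition smooth_atlas :: "'a::topological_space chart set \<Rightarrow> bool" where
  "smooth_atlas A \<longleftrightarrow>
     (\<Union>c\<in>A. fst c) = UNIV \<and>
     (\<forall>c\<in>A. open (fst c) \<and> open (snd c ` fst c) \<and>
        homeomorphism (fst c) (snd c ` fst c) (snd c) (inv_into (fst c) (snd c))) \<and>
     (\<forall>c\<in>A. \<forall>c'\<in>A. smooth_on (snd c ` (fst c \<inter> fst c')) (coord_rep c (snd c')))"

definition smooth_function ::
    "'a chart set \<Rightarrow> 'a set \<Rightarrow> ('a \<Rightarrow> 'b::real_normed_vector) \<Rightarrow> bool" where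
  "smooth_function A U f \<longleftrightarrow>
     (\<forall>c\<in>A. smooth_on (snd c ` (U \<inter> fst c)) (coord_rep c f))"

definition smooth_map ::
    "'a::topological_space chart set \<Rightarrow> 'a set \<Rightarrow> 'b::topological_space chart set
      \<Rightarrow> ('a \<Rightarrow> 'b) \<Rightarrow> bool" where
  "smooth_map A U B f \<longleftrightarrow>
     continuous_on U f \<and>
     (\<forall>c\<in>A. \<forall>c'\<in>B.
        smooth_on (snd c ` (U \<inter> fst c \<inter> f -` fst c')) (coord_rep c (snd c' \<circ> f)))"

text \<open>Smooth maps from an open subset of a normed space into a manifold.\<close>

definition smooth_family ::
    "'e::real_normed_vector set \<Rightarrow> 'a::topological_space chart set \<Rightarrow> ('e \<Rightarrow> 'a) \<Rightarrow> bool" where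
  "smooth_family D A g \<longleftrightarrow>
     continuous_on D g \<and> (\<forall>c\<in>A. smooth_on (D \<inter> g -` fst c) (snd c \<circ> g))"


section \<open>Symplectic manifolds and Hamiltonian dynamics\<close>

text \<open>Differential forms are given by their coordinate expressions: \<open>form S c p v w\<close> is the value
  of the two-form at \<open>p\<close> on the tangent vectors with components \<open>v\<close>, \<open>w\<close> in the chart \<open>c\<close>. The
  expressions in different charts are required to agree under coordinate changes.\<close>

record 'a symplectic_data =
  charts :: "'a chart set"
  form :: "'a chart \<Rightarrow> 'a \<Rightarrow> real^4 \<Rightarrow> real^4 \<Rightarrow> real"

definition symplectic_manifold ::
    "('a::{t2_space,second_countable_topology}, 'x) symplectic_data_scheme \<Rightarrow> bool" where
  "symplectic_manifold S \<longleftrightarrow>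
     smooth_atlas (charts S) \<and>
     (\<forall>c\<in>charts S. \<forall>c'\<in>charts S. \<forall>p\<in>fst c \<inter> fst c'. \<forall>v w.
        form S c p v w
          = form S c' p (differential c (snd c') p v) (differential c (snd c') p w)) \<and>
     (\<forall>c\<in>charts S. \<forall>p\<in>fst c.
        bilinear (form S c p) \<and> (\<forall>v. form S c p v v = 0) \<and>
        (\<forall>v. (\<forall>w. form S c p v w = 0) \<longrightarrow> v = 0)) \<and>
     (\<forall>c\<in>charts S. \<forall>v w.
        smooth_on (snd c ` fst c) (coord_rep c (\<lambda>p. form S c p v w))) \<and>
     (\<forall>c\<in>charts S. \<forall>p\<in>fst c. \<forall>u v w.
        differential c (\<lambda>q. form S c q v w) p u
        + differential c (\<lambda>q. form S c q w u) p v
        + differential c (\<lambda>q. form S c q u v) p w = 0)"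

definition symplectomorphism_on ::
    "('a::topological_space, 'x) symplectic_data_scheme \<Rightarrow> 'a set
      \<Rightarrow> ('b::topological_space, 'y) symplectic_data_scheme \<Rightarrow> 'b set \<Rightarrow> ('a \<Rightarrow> 'b) \<Rightarrow> bool" where
  "symplectomorphism_on S U S' V f \<longleftrightarrow>
     open U \<and> open V \<and> bij_betw f U V \<and>
     smooth_map (charts S) U (charts S') f \<and>
     smooth_map (charts S') V (charts S) (inv_into U f) \<and>
     (\<forall>c\<in>charts S. \<forall>c'\<in>charts S'. \<forall>p\<in>U \<inter> fst c \<inter> f -` fst c'. \<forall>v w.
        form S' c' (f p) (differential c (snd c' \<circ> f) p v) (differential c (snd c' \<circ> f) p w)
          = form S c p v w)"

definition hamiltonian_vf ::
    "('a, 'x) symplectic_data_scheme \<Rightarrow> ('a \<Rightarrow> real) \<Rightarrow> 'a chart \<Rightarrow> 'a \<Rightarrow> real^4" where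
  "hamiltonian_vf S f c p = (THE X. \<forall>w. form S c p X w = - differential c f p w)"

definition integral_curve ::
    "('a::topological_space, 'x) symplectic_data_scheme \<Rightarrow> ('a \<Rightarrow> real) \<Rightarrow> (real \<Rightarrow> 'a) \<Rightarrow> bool"
    where
  "integral_curve S f \<gamma> \<longleftrightarrow>
     continuous_on UNIV \<gamma> \<and>
     (\<forall>t. \<forall>c\<in>charts S. \<gamma> t \<in> fst c \<longrightarrow>
        ((snd c \<circ> \<gamma>) has_vector_derivative hamiltonian_vf S f c (\<gamma> t)) (at t))"

text \<open>On the standard space the coordinates are ordered as \<open>(q\<^sub>1, q\<^sub>2, p\<^sub>1, p\<^sub>2)\<close>.\<close>

definition R4 :: "(real^4) symplectic_data" where
  "R4 = \<lparr>charts = {(UNIV, id)},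
         form = (\<lambda>_ _ v w. (v$3 * w$1 - v$1 * w$3) + (v$4 * w$2 - v$2 * w$4))\<rparr>"


section \<open>Integrable systems\<close>

text \<open>The plane of values \<open>(l, h)\<close>, or \<open>(l, j)\<close>, is identified with \<^typ>\<open>complex\<close> throughout;
  derivatives on it are real derivatives, \<open>\<partial>/\<partial>l\<close> and \<open>\<partial>/\<partial>h\<close> being the derivatives in the
  directions \<open>1\<close> and \<open>\<i>\<close>.\<close>

record 'a integrable_data = "'a symplectic_data" +
  ham_L :: "'a \<Rightarrow> real"
  ham_H :: "'a \<Rightarrow> real"

definition momentum :: "'a integrable_data \<Rightarrow> 'a \<Rightarrow> complex" where
  "momentum M p = Complex (ham_L M p) (ham_H M p)"

definition rank_at :: "'a integrable_data \<Rightarrow> 'a \<Rightarrow> nat" where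
  "rank_at M p =
     (let c = (SOME c. c \<in> charts M \<and> p \<in> fst c) in dim (range (differential c (momentum M) p)))"

definition singular_point :: "'a integrable_data \<Rightarrow> 'a \<Rightarrow> bool" where
  "singular_point M p \<longleftrightarrow> rank_at M p < 2"

definition integrable_system ::
    "'a::{t2_space,second_countable_topology} integrable_data \<Rightarrow> bool" where
  "integrable_system M \<longleftrightarrow>
     symplectic_manifold M \<and>
     smooth_function (charts M) UNIV (momentum M) \<and>
     (\<forall>c\<in>charts M. \<forall>p\<in>fst c.
        form M c p (hamiltonian_vf M (ham_L M) c p) (hamiltonian_vf M (ham_H M) c p) = 0) \<and>
     (\<forall>c\<in>charts M. negligible (snd c ` {p \<in> fst c. singular_point M p}))"

subsection \<open>Non-degenerate singular points and hyperbolic components\<close>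

text \<open>The linear part at \<open>p\<close> of the Hamiltonian vector field of \<open>f\<close>. At a critical point \<open>p\<close> of
  \<open>f\<close> it corresponds to the Hessian of \<open>f\<close> under the usual isomorphism of quadratic forms with
  the symplectic Lie algebra.\<close>

definition linear_part ::
    "('a, 'x) symplectic_data_scheme \<Rightarrow> ('a \<Rightarrow> real) \<Rightarrow> 'a chart \<Rightarrow> 'a \<Rightarrow> real^4^4" where
  "linear_part S f c p = matrix (differential c (hamiltonian_vf S f c) p)"

definition symplectic_algebra :: "(real^4 \<Rightarrow> real^4 \<Rightarrow> real) \<Rightarrow> (real^4^4) set" where
  "symplectic_algebra \<omega> = {A. \<forall>v w. \<omega> (A *v v) w + \<omega> v (A *v w) = 0}"

text \<open>A Cartan subalgebra is a self-normalizing nilpotent subalgebra; in a semisimple Lie algebra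
  such as this one these are the self-normalizing abelian ones.\<close>

definition cartan_subalgebra ::
    "(real^4 \<Rightarrow> real^4 \<Rightarrow> real) \<Rightarrow> (real^4^4) set \<Rightarrow> bool" where
  "cartan_subalgebra \<omega> \<hh> \<longleftrightarrow>
     subspace \<hh> \<and> \<hh> \<subseteq> symplectic_algebra \<omega> \<and>
     (\<forall>A\<in>\<hh>. \<forall>B\<in>\<hh>. A ** B = B ** A) \<and>
     {X \<in> symplectic_algebra \<omega>. \<forall>A\<in>\<hh>. X ** A - A ** X \<in> \<hh>} = \<hh>"

definition complex_eigenvalues :: "real^4^4 \<Rightarrow> complex set" where
  "complex_eigenvalues A =
     {\<mu>. det ((\<chi> i j. of_real (A$i$j) - (if i = j then \<mu> else 0)) :: complex^4^4) = 0}"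

definition rank0_algebra :: "'a integrable_data \<Rightarrow> 'a chart \<Rightarrow> 'a \<Rightarrow> (real^4^4) set" where
  "rank0_algebra M c p = span {linear_part M (ham_L M) c p, linear_part M (ham_H M) c p}"

text \<open>At a rank one point let \<open>f = a L + b H\<close> be a non-zero combination which is critical at \<open>p\<close>
  and let \<open>l\<close> be the line spanned by the Hamiltonian vector fields. The linear part of \<open>f\<close> induces
  an endomorphism of the symplectic plane \<open>l\<^sup>\<omega> / l\<close>; the following are its real eigenvalues.\<close>

definition transverse_real_eigenvalues ::
    "'a integrable_data \<Rightarrow> real \<Rightarrow> real \<Rightarrow> 'a chart \<Rightarrow> 'a \<Rightarrow> real set" where
  "transverse_real_eigenvalues M a b c p =
     (let A = linear_part M (\<lambda>q. a * ham_L M q + b * ham_H M q) c p;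
          l = span {hamiltonian_vf M (ham_L M) c p, hamiltonian_vf M (ham_H M) c p};
          l\<omega> = {v. \<forall>u\<in>l. form M c p u v = 0}
      in {\<mu>. \<exists>v\<in>l\<omega> - l. A *v v - \<mu> *\<^sub>R v \<in> l})"

definition critical_combination ::
    "'a integrable_data \<Rightarrow> real \<Rightarrow> real \<Rightarrow> 'a chart \<Rightarrow> 'a \<Rightarrow> bool" where
  "critical_combination M a b c p \<longleftrightarrow>
     (a, b) \<noteq> (0, 0) \<and>
     (\<forall>v. a * differential c (ham_L M) p v + b * differential c (ham_H M) p v = 0)"

definition nondegenerate_point :: "'a integrable_data \<Rightarrow> 'a \<Rightarrow> bool" where
  "nondegenerate_point M p \<longleftrightarrow>
     (\<forall>c\<in>charts M. p \<in> fst c \<longrightarrow>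
        (rank_at M p = 0 \<longrightarrow> cartan_subalgebra (form M c p) (rank0_algebra M c p)) \<and>
        (rank_at M p = 1 \<longrightarrow>
           (\<forall>a b. critical_combination M a b c p \<longrightarrow> 0 \<notin> transverse_real_eigenvalues M a b c p)))"

text \<open>Regular elements of a Cartan subalgebra are those with four distinct eigenvalues. The
  elliptic, hyperbolic and focus-focus components contribute eigenvalues of the form \<open>\<plusminus>\<i>\<alpha>\<close>,
  \<open>\<plusminus>\<alpha>\<close> and \<open>\<plusminus>\<alpha>\<plusminus>\<i>\<beta>\<close> respectively, with \<open>\<alpha>\<close> and \<open>\<beta>\<close> real and non-zero.\<close>

definition no_hyperbolic_component :: "'a integrable_data \<Rightarrow> 'a \<Rightarrow> bool" where
  "no_hyperbolic_component M p \<longleftrightarrow>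
     (\<forall>c\<in>charts M. p \<in> fst c \<longrightarrow>
        (rank_at M p = 0 \<longrightarrow>
           (\<forall>A\<in>rank0_algebra M c p. card (complex_eigenvalues A) = 4 \<longrightarrow>
              complex_eigenvalues A \<inter> \<real> = {})) \<and>
        (rank_at M p = 1 \<longrightarrow>
           (\<forall>a b. critical_combination M a b c p \<longrightarrow>
              transverse_real_eigenvalues M a b c p \<subseteq> {0})))"

subsection \<open>Semitoric systems\<close>

definition effective_circle_action ::
    "('a::topological_space, 'x) symplectic_data_scheme \<Rightarrow> ('a \<Rightarrow> real) \<Rightarrow> bool" where
  "effective_circle_action S f \<longleftrightarrow>
     (\<exists>\<theta> :: real \<Rightarrow> 'a \<Rightarrow> 'a.
        (\<forall>p. \<theta> 0 p = p \<and> integral_curve S f (\<lambda>t. \<theta> t p)) \<and>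
        (\<forall>t p. \<theta> (t + 2 * pi) p = \<theta> t p) \<and>
        (\<forall>t. (\<forall>p. \<theta> t p = p) \<longrightarrow> (\<exists>k::int. t = 2 * pi * of_int k)))"

definition semitoric_system ::
    "'a::{t2_space,second_countable_topology} integrable_data \<Rightarrow> bool" where
  "semitoric_system M \<longleftrightarrow>
     integrable_system M \<and>
     effective_circle_action M (ham_L M) \<and>
     proper_map euclidean euclidean (ham_L M) \<and>
     (\<forall>p. singular_point M p \<longrightarrow> nondegenerate_point M p \<and> no_hyperbolic_component M p)"

subsection \<open>Focus-focus points\<close>

definition ff_model :: "real^4 \<Rightarrow> complex" where
  "ff_model x = Complex (x$1 * x$4 - x$2 * x$3) (x$1 * x$3 + x$2 * x$4)"

definition ff_normal_form ::
    "'a::topological_space integrable_data \<Rightarrow> 'a \<Rightarrow> 'a set \<Rightarrow> ('a \<Rightarrow> real^4)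
      \<Rightarrow> (complex \<Rightarrow> complex) \<Rightarrow> bool" where
  "ff_normal_form M m U \<phi> \<rho> \<longleftrightarrow>
     m \<in> U \<and> \<phi> m = 0 \<and> symplectomorphism_on M U R4 (\<phi> ` U) \<phi> \<and>
     (\<exists>D. momentum M ` U \<subseteq> D \<and> diffeo_on D \<rho>) \<and>
     \<rho> (momentum M m) = 0 \<and>
     (\<forall>p\<in>U. \<rho> (momentum M p) = ff_model (\<phi> p))"

definition focus_focus_point :: "'a::topological_space integrable_data \<Rightarrow> 'a \<Rightarrow> bool" where
  "focus_focus_point M m \<longleftrightarrow> rank_at M m = 0 \<and> (\<exists>U \<phi> \<rho>. ff_normal_form M m U \<phi> \<rho>)"


section \<open>One-forms, loops and homology\<close>

type_synonym 'a one_form = "'a chart \<Rightarrow> 'a \<Rightarrow> real^4 \<Rightarrow> real"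

definition primitive_on ::
    "('a::topological_space, 'x) symplectic_data_scheme \<Rightarrow> 'a set \<Rightarrow> 'a one_form \<Rightarrow> bool" where
  "primitive_on S W \<alpha> \<longleftrightarrow>
     (\<forall>c\<in>charts S. \<forall>c'\<in>charts S. \<forall>p\<in>W \<inter> fst c \<inter> fst c'. \<forall>v.
        \<alpha> c p v = \<alpha> c' p (differential c (snd c') p v)) \<and>
     (\<forall>c\<in>charts S. \<forall>p\<in>W \<inter> fst c. linear (\<alpha> c p)) \<and>
     (\<forall>c\<in>charts S. \<forall>v. smooth_on (snd c ` (W \<inter> fst c)) (coord_rep c (\<lambda>p. \<alpha> c p v))) \<and>
     (\<forall>c\<in>charts S. \<forall>p\<in>W \<inter> fst c. \<forall>v w.
        differential c (\<lambda>q. \<alpha> c q w) p v - differential c (\<lambda>q. \<alpha> c q v) p w = form S c p v w)"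

text \<open>Loops are parametrized by the unit interval.\<close>

definition loop_integral ::
    "('a, 'x) symplectic_data_scheme \<Rightarrow> 'a one_form \<Rightarrow> (real \<Rightarrow> 'a) \<Rightarrow> real" where
  "loop_integral S \<alpha> \<gamma> =
     integral {0..1}
       (\<lambda>t. let c = (SOME c. c \<in> charts S \<and> \<gamma> t \<in> fst c)
            in \<alpha> c (\<gamma> t) (vector_derivative (snd c \<circ> \<gamma>) (at t)))"

definition loop_class :: "'a topology \<Rightarrow> (real \<Rightarrow> 'a) \<Rightarrow> 'a chain set" where
  "loop_class X \<gamma> =
     homologous_rel_set 1 X {} (frag_of (restrict (\<lambda>x. \<gamma> (x 1)) (standard_simplex 1)))"

definition homology_basis :: "'a topology \<Rightarrow> 'a chain set \<Rightarrow> 'a chain set \<Rightarrow> bool" where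
  "homology_basis X a b \<longleftrightarrow>
     (let G = homology_group 1 X in
        generate G {a, b} = carrier G \<and>
        (\<forall>(i::int) (j::int). a [^]\<^bsub>G\<^esub> i \<otimes>\<^bsub>G\<^esub> b [^]\<^bsub>G\<^esub> j = \<one>\<^bsub>G\<^esub> \<longrightarrow> i = 0 \<and> j = 0))"


section \<open>The Taylor series invariant\<close>

text \<open>Power series in \<open>(l, j)\<close> are elements of \<^typ>\<open>real fps fps\<close>: \<open>fps_nth (fps_nth T b) a\<close> is the
  coefficient of \<open>l\<^sup>a j\<^sup>b\<close>.\<close>

definition fps_l :: "real fps fps" where
  "fps_l = fps_const fps_X"

definition fps_real :: "real \<Rightarrow> real fps fps" where
  "fps_real r = fps_const (fps_const r)"

text \<open>The series \<open>T(\<epsilon>\<^sub>1 l, \<epsilon>\<^sub>2 j)\<close>.\<close>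

definition fps_scale_args :: "real \<Rightarrow> real \<Rightarrow> real fps fps \<Rightarrow> real fps fps" where
  "fps_scale_args \<epsilon>\<^sub>1 \<epsilon>\<^sub>2 T = Abs_fps (\<lambda>b. Abs_fps (\<lambda>a. \<epsilon>\<^sub>1 ^ a * \<epsilon>\<^sub>2 ^ b * fps_nth (fps_nth T b) a))"

definition taylor_series :: "(complex \<Rightarrow> real) \<Rightarrow> real fps fps" where
  "taylor_series f =
     Abs_fps (\<lambda>b. Abs_fps (\<lambda>a.
       (dir_deriv 1 ^^ a) ((dir_deriv \<i> ^^ b) f) 0 / (fact a * fact b)))"

definition saturation :: "'a integrable_data \<Rightarrow> 'a set \<Rightarrow> 'a set" where
  "saturation M U = momentum M -` (momentum M ` U)"

definition fiber :: "'a integrable_data \<Rightarrow> 'a set \<Rightarrow> (complex \<Rightarrow> complex) \<Rightarrow> complex \<Rightarrow> 'a set" where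
  "fiber M U \<rho> z = {p \<in> saturation M U. \<rho> (momentum M p) = z}"

text \<open>The upward (\<open>\<sigma> = 1\<close>) or downward (\<open>\<sigma> = -1\<close>) vertical ray from the origin.\<close>

definition vertical_ray :: "real \<Rightarrow> complex set" where
  "vertical_ray \<sigma> = {z. Re z = 0 \<and> \<sigma> * Im z \<ge> 0}"

definition log_determination :: "complex set \<Rightarrow> (complex \<Rightarrow> complex) \<Rightarrow> bool" where
  "log_determination b lg \<longleftrightarrow> continuous_on (- b) lg \<and> (\<forall>z\<in>-b. exp (lg z) = z)"

definition admissible_chart ::
    "'a::topological_space integrable_data \<Rightarrow> 'a \<Rightarrow> 'a set \<Rightarrow> ('a \<Rightarrow> real^4)
      \<Rightarrow> (complex \<Rightarrow> complex) \<Rightarrow> bool" where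
  "admissible_chart M m U \<phi> \<rho> \<longleftrightarrow>
     ff_normal_form M m U \<phi> \<rho> \<and>
     (\<forall>w\<in>momentum M ` U. Re (\<rho> w) = Re w - ham_L M m \<and> Im (dir_deriv \<i> \<rho> w) > 0) \<and>
     (\<forall>z\<in>\<rho> ` momentum M ` U - {0}.
        top_of_set (fiber M U \<rho> z) homeomorphic_space
        top_of_set (sphere (0::complex) 1 \<times> sphere (0::complex) 1))"

definition action ::
    "'a integrable_data \<Rightarrow> 'a one_form \<Rightarrow> (complex \<Rightarrow> real \<Rightarrow> 'a) \<Rightarrow> complex \<Rightarrow> real" where
  "action M \<alpha> \<gamma> z = 1 / (2 * pi) * loop_integral M \<alpha> (\<gamma> z)"

text \<open>Smooth families of cycles \<open>\<gamma>\<^sub>2\<^sup>z\<close> over the set \<open>B\<close>. The cycle \<open>\<gamma>\<^sub>L\<^sup>z\<close> is an orbit of the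
  flow of \<open>L\<close> over one period.\<close>

definition admissible_cycles ::
    "'a::topological_space integrable_data \<Rightarrow> 'a set \<Rightarrow> (complex \<Rightarrow> complex) \<Rightarrow> complex set
      \<Rightarrow> 'a one_form \<Rightarrow> (complex \<Rightarrow> real \<Rightarrow> 'a) \<Rightarrow> bool" where
  "admissible_cycles M U \<rho> B \<alpha> \<gamma>\<^sub>2 \<longleftrightarrow>
     smooth_family (B \<times> UNIV) (charts M) (\<lambda>(z, t). \<gamma>\<^sub>2 z t) \<and>
     (\<forall>z\<in>B. \<forall>t. \<gamma>\<^sub>2 z t \<in> fiber M U \<rho> z \<and> \<gamma>\<^sub>2 z (t + 1) = \<gamma>\<^sub>2 z t) \<and>
     (\<forall>z\<in>B. \<exists>\<gamma>\<^sub>L. integral_curve M (ham_L M) \<gamma>\<^sub>L \<and> (\<forall>t. \<gamma>\<^sub>L (t + 2 * pi) = \<gamma>\<^sub>L t) \<and>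
        range \<gamma>\<^sub>L \<subseteq> fiber M U \<rho> z \<and>
        homology_basis (top_of_set (fiber M U \<rho> z))
          (loop_class (top_of_set (fiber M U \<rho> z)) (\<lambda>t. \<gamma>\<^sub>L (2 * pi * t)))
          (loop_class (top_of_set (fiber M U \<rho> z)) (\<gamma>\<^sub>2 z))) \<and>
     (\<forall>z\<in>B. \<exists>d>0. ((\<lambda>s. action M \<alpha> \<gamma>\<^sub>2 (z + of_real s * \<i>)) has_real_derivative d) (at 0))"

text \<open>\<open>T\<close> is the Taylor series of \<open>S\<close> for some admissible choices in the construction.\<close>

definition taylor_representative ::
    "'a::topological_space integrable_data \<Rightarrow> 'a \<Rightarrow> real fps fps \<Rightarrow> bool" where
  "taylor_representative M m T \<longleftrightarrow>
     (\<exists>U \<phi> \<rho> \<alpha> \<sigma> lg \<gamma>\<^sub>2 I\<^sub>0 S V.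
        let B = \<rho> ` momentum M ` U - vertical_ray \<sigma> in
        admissible_chart M m U \<phi> \<rho> \<and>
        primitive_on M (saturation M U) \<alpha> \<and>
        \<sigma> \<in> {-1, 1} \<and> log_determination (vertical_ray \<sigma>) lg \<and>
        admissible_cycles M U \<rho> B \<alpha> \<gamma>\<^sub>2 \<and>
        (action M \<alpha> \<gamma>\<^sub>2 \<longlongrightarrow> I\<^sub>0) (at 0 within B) \<and>
        0 \<in> V \<and> V \<subseteq> \<rho> ` momentum M ` U \<and> smooth_on V S \<and>
        (\<forall>z\<in>V - vertical_ray \<sigma>.
           S z = 2 * pi * action M \<alpha> \<gamma>\<^sub>2 z - 2 * pi * I\<^sub>0 + Im (z * lg z - z)) \<and>
        T = taylor_series S)"

text \<open>An element of the quotient of the power series by \<open>2\<pi>l\<int>\<close> is represented by the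
  corresponding coset. Since the series is well defined modulo \<open>2\<pi>l\<int>\<close>, the union over all
  choices is a single coset.\<close>

definition coset_2pi_l :: "real fps fps \<Rightarrow> real fps fps set" where
  "coset_2pi_l T = {T + of_int k * fps_real (2 * pi) * fps_l | k::int. True}"

definition taylor_series_invariant ::
    "'a::topological_space integrable_data \<Rightarrow> 'a \<Rightarrow> real fps fps set" where
  "taylor_series_invariant M m = \<Union> (coset_2pi_l ` {T. taylor_representative M m T})"

end

theory Submission
  imports Defs
begin

text \<open>The invariant is built from choices, and every choice made for \<open>M\<close> at \<open>m\<close> is carried to a choice
  for \<open>M'\<close> at \<open>\<Phi>(m)\<close>. Let \<open>E(l, h) = (\<epsilon>\<^sub>1 l, \<epsilon>\<^sub>2 h)\<close> and let \<open>g\<close> be a linear symplectic map of the model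
  with \<open>G \<circ> g = E \<circ> G\<close>: exchange the indices 1 and 2 to change the sign of the first component, and
  map \<open>(q, p)\<close> to \<open>(-p, q)\<close> to change the sign of the second. The normal form \<open>(\<phi>, \<rho>)\<close> becomes
  \<open>(g \<circ> \<phi> \<circ> \<Phi>\<^sup>-\<^sup>1, E \<circ> \<rho> \<circ> E)\<close>, the primitive is pulled back by \<open>\<Phi>\<^sup>-\<^sup>1\<close>, and the cycle over \<open>E(z)\<close> is the
  image of the cycle over \<open>z\<close>, reversed when \<open>\<epsilon>\<^sub>2 = -1\<close> so that the action still increases with \<open>j\<close>.
  Hence the actions satisfy \<open>I'(E z) = \<epsilon>\<^sub>2 I(z)\<close>. A determination of the logarithm is adapted to the
  new ray, which costs \<open>\<pi> l\<close> exactly when \<open>\<epsilon>\<^sub>1 = -1\<close>. The transformation of the series is an involution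
  modulo \<open>2\<pi>l\<close>, so the reverse inclusion follows from the same construction for \<open>\<Phi>\<^sup>-\<^sup>1\<close>.\<close>

text \<open>The constant \<pi> has its origin in the relation between z and E(z): if
  \<open>\<epsilon>\<^sub>1 = \<epsilon>\<^sub>2\<close>, then z is
  \<open>\<epsilon>\<^sub>1\<close> times E(z), otherwise it is \<open>\<epsilon>\<^sub>1\<close>
  times the conjugate of E(z). For \<open>\<epsilon>\<^sub>1 = -1\<close> a logarithm of z is
  therefore a logarithm of E(z), or its conjugate, plus \<i>\<pi>, and Im(\<i>\<pi> z) = \<pi> l.
  With c the coefficient of l, applying the transformation twice adds (1 +
  \<open>\<epsilon>\<^sub>1 * \<epsilon>\<^sub>2\<close>) c l, which is 0 or 2\<pi> l. Forms are
  families of coordinate expressions and cycles are singular chains, so two familiar facts need real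
  work. That the pull-back of a primitive is again a primitive rests on the symmetry of second
  derivatives. That a reversed loop represents the inverse class needs an explicit 2-chain; it
  concerns both cycles, because the image of an orbit of L is an orbit of L' run backwards when
  \<open>\<epsilon>\<^sub>1 = -1\<close>.\<close>

section \<open>Calculus of smooth functions\<close>

lemma differentiable_on_openD:
  "f differentiable_on S \<Longrightarrow> open S \<Longrightarrow> x \<in> S \<Longrightarrow> f differentiable (at x)"
  by (simp add: differentiable_on_eq_differentiable_at)

lemma differentiable_on_of_has_derivative:
  "(\<And>x. x \<in> S \<Longrightarrow> (f has_derivative D x) (at x)) \<Longrightarrow> f differentiable_on S"
  by (meson differentiableI differentiable_at_withinI differentiable_on_def)

lemma dir_deriv_eq:
  "(f has_derivative f') (at x) \<Longrightarrow> dir_deriv v f x = f' v"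
  unfolding dir_deriv_def by (metis frechet_derivative_at)

lemma has_derivative_dir_deriv:
  "f differentiable (at x) \<Longrightarrow> (f has_derivative (\<lambda>v. dir_deriv v f x)) (at x)"
  unfolding dir_deriv_def using frechet_derivative_works by (metis (no_types, lifting) ext)

lemma linear_dir_deriv: "f differentiable (at x) \<Longrightarrow> linear (\<lambda>v. dir_deriv v f x)"
  using has_derivative_dir_deriv has_derivative_linear by blast

lemma dir_deriv_cong:
  assumes "open S" "x \<in> S" "\<And>y. y \<in> S \<Longrightarrow> f y = g y"
  shows "dir_deriv v f x = dir_deriv v g x"
proof -
  have "(f has_derivative D) (at x) \<longleftrightarrow> (g has_derivative D) (at x)" for D
    using assms has_derivative_transform_within_open by metis
  then show ?thesis unfolding dir_deriv_def frechet_derivative_def by simp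
qed

lemma Ck_on_cong:
  assumes "open S" "\<And>x. x \<in> S \<Longrightarrow> f x = g x" "Ck_on k S f"
  shows "Ck_on k S g"
  using assms(2,3)
proof (induction k arbitrary: f g)
  case 0
  then show ?case by (metis Ck_on.simps(1) continuous_on_cong)
next
  case (Suc k)
  have "dir_deriv v f x = dir_deriv v g x" if "x \<in> S" for v x
    using dir_deriv_cong[OF assms(1) that] Suc.prems(1) by blast
  then have "Ck_on k S (dir_deriv v g)" for v
    using Suc by (metis Ck_on.simps(2))
  moreover have "g differentiable_on S"
    using Suc.prems by (metis Ck_on.simps(2) differentiable_on_def differentiable_transform_within zero_less_one)
  ultimately show ?case by simp
qed

lemma Ck_on_subset:
  assumes "Ck_on k S f" "T \<subseteq> S" "open T"
  shows "Ck_on k T f"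
  using assms(1)
  by (induction k arbitrary: f)
     (use assms(2) in \<open>auto intro: continuous_on_subset differentiable_on_subset\<close>)

lemma Ck_on_local:
  assumes "\<And>x. x \<in> S \<Longrightarrow> \<exists>N. open N \<and> x \<in> N \<and> Ck_on k N f" "open S"
  shows "Ck_on k S f"
  using assms(1)
proof (induction k arbitrary: f)
  case 0
  then show ?case
    unfolding Ck_on.simps by (metis continuous_at_imp_continuous_on continuous_on_eq_continuous_at)
next
  case (Suc k)
  then show ?case
    unfolding Ck_on.simps
    by (metis assms(2) differentiable_on_eq_differentiable_at)
qed

lemma Ck_on_SucD: "Ck_on (Suc k) S f \<Longrightarrow> Ck_on k S f"
  by (induction k arbitrary: f) (auto simp: differentiable_imp_continuous_on)

lemma Ck_on_zero: "Ck_on k S (\<lambda>x. 0)"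
  by (induction k) (auto simp: dir_deriv_def)

lemma Ck_on_const: "Ck_on k S (\<lambda>x. a)"
  by (cases k) (auto simp: dir_deriv_def Ck_on_zero)

text \<open>The induction is the pattern for the closure lemmas below: the formula for the
  directional derivative is valid on S, and \<open>Ck_on_cong\<close> turns its regularity into that
  of the derivative itself.\<close>

lemma Ck_on_bounded_linear:
  assumes "bounded_linear L" "Ck_on k S f" "open S"
  shows "Ck_on k S (\<lambda>x. L (f x))"
  using assms(2)
proof (induction k arbitrary: f)
  case 0
  then show ?case using assms(1)
    by (simp add: bounded_linear.continuous_on)
next
  case (Suc k)
  have d: "((\<lambda>x. L (f x)) has_derivative (\<lambda>v. L (dir_deriv v f x))) (at x)" if "x \<in> S" for x
    using Suc.prems that assms
    by (intro bounded_linear.has_derivative[OF assms(1)] has_derivative_dir_deriv)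
       (auto intro: differentiable_on_openD)
  have "Ck_on k S (dir_deriv v (\<lambda>x. L (f x)))" for v
    by (rule Ck_on_cong[OF assms(3) _ Suc.IH[of "dir_deriv v f"]])
       (use Suc.prems dir_deriv_eq[OF d] in auto)
  moreover have "(\<lambda>x. L (f x)) differentiable_on S"
    using d by (rule differentiable_on_of_has_derivative)
  ultimately show ?case by simp
qed

lemma Ck_on_add:
  assumes "Ck_on k S f" "Ck_on k S g" "open S"
  shows "Ck_on k S (\<lambda>x. f x + g x)"
  using assms(1,2)
proof (induction k arbitrary: f g)
  case 0
  then show ?case by (simp add: continuous_on_add)
next
  case (Suc k)
  have d: "((\<lambda>x. f x + g x) has_derivative (\<lambda>v. dir_deriv v f x + dir_deriv v g x)) (at x)"
    if "x \<in> S" for x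
    using Suc.prems that assms(3)
    by (intro has_derivative_add has_derivative_dir_deriv) (auto intro: differentiable_on_openD)
  have "Ck_on k S (dir_deriv v (\<lambda>x. f x + g x))" for v
    by (rule Ck_on_cong[OF assms(3) _ Suc.IH[of "dir_deriv v f" "dir_deriv v g"]])
       (use Suc.prems dir_deriv_eq[OF d] in auto)
  moreover have "(\<lambda>x. f x + g x) differentiable_on S"
    using d by (rule differentiable_on_of_has_derivative)
  ultimately show ?case by simp
qed

lemma Ck_on_scaleR:
  assumes "Ck_on k S f" "Ck_on k S g" "open S"
  shows "Ck_on k S (\<lambda>x. f x *\<^sub>R g x)"
  using assms(1,2)
proof (induction k arbitrary: f g)
  case 0
  then show ?case by (simp add: continuous_on_scaleR)
next
  case (Suc k)
  have d: "((\<lambda>x. f x *\<^sub>R g x) has_derivative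
      (\<lambda>v. f x *\<^sub>R dir_deriv v g x + dir_deriv v f x *\<^sub>R g x)) (at x)"
    if "x \<in> S" for x
    using Suc.prems that assms(3)
    by (intro has_derivative_scaleR has_derivative_dir_deriv) (auto intro: differentiable_on_openD)
  \<comment> \<open>In the product rule one factor stays undifferentiated; its order is first
    lowered by \<open>Ck_on_SucD\<close>, so that the induction hypothesis applies to both
    products.\<close>
  have "Ck_on k S (\<lambda>x. f x *\<^sub>R dir_deriv v g x + dir_deriv v f x *\<^sub>R g x)" for v
    using Suc.prems Ck_on_SucD[OF Suc.prems(1)] Ck_on_SucD[OF Suc.prems(2)]
    by (intro Ck_on_add Suc.IH assms(3)) auto
  then have "Ck_on k S (dir_deriv v (\<lambda>x. f x *\<^sub>R g x))" for v
    by (rule Ck_on_cong[OF assms(3), rotated]) (use dir_deriv_eq[OF d] in auto)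
  moreover have "(\<lambda>x. f x *\<^sub>R g x) differentiable_on S"
    using d by (rule differentiable_on_of_has_derivative)
  ultimately show ?case by simp
qed

lemma Ck_on_sum:
  assumes "\<And>i. i \<in> I \<Longrightarrow> Ck_on k S (f i)" "open S"
  shows "Ck_on k S (\<lambda>x. \<Sum>i\<in>I. f i x)"
  using assms(1)
  by (induction I rule: infinite_finite_induct) (auto simp: Ck_on_const intro!: Ck_on_add assms(2))

text \<open>Replaces a derivative in a direction that moves with the point by a finite sum of
  derivatives in fixed directions, the ones that \<open>Ck_on\<close> controls.\<close>

lemma linear_euclidean_expansion:
  fixes L :: "'a::euclidean_space \<Rightarrow> 'b::real_vector"
  assumes "linear L"
  shows "L v = (\<Sum>e\<in>Basis. (v \<bullet> e) *\<^sub>R L e)"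
proof -
  have "L v = L (\<Sum>e\<in>Basis. (v \<bullet> e) *\<^sub>R e)" by (simp add: euclidean_representation)
  then show ?thesis using assms by (simp add: linear_sum linear_scale)
qed

text \<open>The chain rule differentiates g in the direction \<open>dir_deriv v f x\<close>, which
  varies with x. Expanding it in a basis gives products of components of the derivative of f with
  \<open>dir_deriv e g \<circ> f\<close>, to which the induction hypothesis applies; hence the
  Euclidean middle space.\<close>

lemma Ck_on_compose:
  fixes f :: "'a::real_normed_vector \<Rightarrow> 'b::euclidean_space" and g :: "'b \<Rightarrow> 'c::real_normed_vector"
  assumes "Ck_on k S f" "Ck_on k T g" "f ` S \<subseteq> T" "open S" "open T"
  shows "Ck_on k S (g \<circ> f)"
  using assms(1,2)
proof (induction k arbitrary: g)
  case 0
  then show ?case using assms(3) by (metis Ck_on.simps(1) continuous_on_compose continuous_on_subset)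
next
  case (Suc k)
  have d: "(g \<circ> f has_derivative (\<lambda>v. dir_deriv (dir_deriv v f x) g (f x))) (at x)"
    if "x \<in> S" for x
  proof -
    have "(g has_derivative (\<lambda>v. dir_deriv v g (f x))) (at (f x))"
      using Suc.prems that assms by (intro has_derivative_dir_deriv) (auto intro: differentiable_on_openD)
    moreover have "(f has_derivative (\<lambda>v. dir_deriv v f x)) (at x)"
      using Suc.prems that assms by (intro has_derivative_dir_deriv) (auto intro: differentiable_on_openD)
    ultimately show ?thesis using diff_chain_at by (fastforce simp: o_def)
  qed
  have e: "dir_deriv v (g \<circ> f) x = (\<Sum>e\<in>Basis. (dir_deriv v f x \<bullet> e) *\<^sub>R (dir_deriv e g \<circ> f) x)"
    if "x \<in> S" for v x
  proof -
    have "g differentiable (at (f x))"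
      using Suc.prems that assms by (auto intro: differentiable_on_openD)
    then have "linear (\<lambda>v. dir_deriv v g (f x))" by (rule linear_dir_deriv)
    note linear_euclidean_expansion[OF this, of "dir_deriv v f x"]
    then show ?thesis unfolding dir_deriv_eq[OF d[OF that]] o_apply .
  qed
  have "Ck_on k S (\<lambda>x. \<Sum>e\<in>Basis. (dir_deriv v f x \<bullet> e) *\<^sub>R (dir_deriv e g \<circ> f) x)" for v
    using Suc.prems Ck_on_SucD[OF Suc.prems(1)]
    by (intro Ck_on_sum Ck_on_scaleR Suc.IH Ck_on_bounded_linear[OF bounded_linear_inner_left] assms(4)) auto
  then have "Ck_on k S (dir_deriv v (g \<circ> f))" for v
    by (rule Ck_on_cong[OF assms(4), rotated]) (use e in auto)
  moreover have "(g \<circ> f) differentiable_on S"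
    using d by (rule differentiable_on_of_has_derivative)
  ultimately show ?case unfolding Ck_on.simps by blast
qed

lemma smooth_onD: "smooth_on S f \<Longrightarrow> x \<in> S \<Longrightarrow> f differentiable (at x)"
  unfolding smooth_on_def by (metis Ck_on.simps(2) differentiable_on_openD)

lemma smooth_on_dir_deriv: "smooth_on S f \<Longrightarrow> smooth_on S (dir_deriv v f)"
  unfolding smooth_on_def by (metis Ck_on.simps(2))

lemma smooth_on_open: "smooth_on S f \<Longrightarrow> open S"
  by (simp add: smooth_on_def)

lemma smooth_on_cong: "smooth_on S f \<Longrightarrow> (\<And>x. x \<in> S \<Longrightarrow> f x = g x) \<Longrightarrow> smooth_on S g"
  unfolding smooth_on_def using Ck_on_cong by metis

lemma smooth_on_subset: "smooth_on S f \<Longrightarrow> T \<subseteq> S \<Longrightarrow> open T \<Longrightarrow> smooth_on T f"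
  unfolding smooth_on_def using Ck_on_subset by metis

lemma smooth_on_local:
  assumes "\<And>x. x \<in> S \<Longrightarrow> \<exists>N. x \<in> N \<and> smooth_on N f" "open S"
  shows "smooth_on S f"
  using assms unfolding smooth_on_def by (metis Ck_on_local)

lemma smooth_on_compose:
  fixes f :: "'a::real_normed_vector \<Rightarrow> 'b::euclidean_space"
  shows "smooth_on S f \<Longrightarrow> smooth_on T g \<Longrightarrow> f ` S \<subseteq> T \<Longrightarrow> smooth_on S (g \<circ> f)"
  unfolding smooth_on_def using Ck_on_compose by metis

lemma smooth_on_linear_compose:
  "bounded_linear L \<Longrightarrow> smooth_on S f \<Longrightarrow> smooth_on S (\<lambda>x. L (f x))"
  unfolding smooth_on_def using Ck_on_bounded_linear by metis

lemma smooth_on_add: "smooth_on S f \<Longrightarrow> smooth_on S g \<Longrightarrow> smooth_on S (\<lambda>x. f x + g x)"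
  unfolding smooth_on_def using Ck_on_add by metis

lemma smooth_on_scaleR: "smooth_on S f \<Longrightarrow> smooth_on S g \<Longrightarrow> smooth_on S (\<lambda>x. f x *\<^sub>R g x)"
  unfolding smooth_on_def using Ck_on_scaleR by metis

lemma smooth_on_sum:
  "open S \<Longrightarrow> (\<And>i. i \<in> I \<Longrightarrow> smooth_on S (f i)) \<Longrightarrow> smooth_on S (\<lambda>x. \<Sum>i\<in>I. f i x)"
  unfolding smooth_on_def using Ck_on_sum by metis

lemma smooth_on_bounded_linear:
  assumes "bounded_linear L" "open S"
  shows "smooth_on S L"
proof -
  have d: "(L has_derivative L) (at x)" for x
    using assms(1) by (rule bounded_linear_imp_has_derivative)
  have "dir_deriv v L = (\<lambda>x. L v)" for v by (rule ext) (rule dir_deriv_eq[OF d])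
  moreover have "continuous_on S L" by (rule linear_continuous_on[OF assms(1)])
  moreover have "L differentiable_on S"
    using d by (meson differentiableI differentiable_at_withinI differentiable_on_def)
  ultimately have "Ck_on k S L" for k
    by (cases k) (auto simp: Ck_on_const)
  then show ?thesis using assms(2) by (simp add: smooth_on_def)
qed

section \<open>Chain rule and symmetry of second derivatives\<close>

lemma dir_deriv_chain:
  assumes "f differentiable (at x)" "g differentiable (at (f x))"
  shows "dir_deriv v (g \<circ> f) x = dir_deriv (dir_deriv v f x) g (f x)"
  by (rule dir_deriv_eq[OF diff_chain_at[OF has_derivative_dir_deriv[OF assms(1)]
        has_derivative_dir_deriv[OF assms(2)], unfolded o_def], folded o_def])

text \<open>The mean value theorem is applied twice: in s to the difference f(x + s v + h w) - f(x +
  s v), then in t to the derivative of f along v. The point of the formula is that its left side is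
  symmetric in v and w.\<close>

lemma second_difference_mvt:
  fixes f :: "'a::real_normed_vector \<Rightarrow> real"
  assumes "f differentiable_on S" "dir_deriv v f differentiable_on S" "open S" "0 < h"
    and "\<And>s t. 0 \<le> s \<Longrightarrow> s \<le> h \<Longrightarrow> 0 \<le> t \<Longrightarrow> t \<le> h \<Longrightarrow> x + s *\<^sub>R v + t *\<^sub>R w \<in> S"
  obtains \<xi> \<eta> where "0 < \<xi>" "\<xi> < h" "0 < \<eta>" "\<eta> < h"
    "f (x + h *\<^sub>R v + h *\<^sub>R w) - f (x + h *\<^sub>R v) - f (x + h *\<^sub>R w) + f x
      = h * h * dir_deriv w (dir_deriv v f) (x + \<xi> *\<^sub>R v + \<eta> *\<^sub>R w)"
proof -
  have der: "((\<lambda>s. g (y + s *\<^sub>R u)) has_real_derivative dir_deriv u g (y + s *\<^sub>R u)) (at s)"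
    if "g differentiable_on S" "y + s *\<^sub>R u \<in> S" for g :: "'a \<Rightarrow> real" and y u s
  proof -
    have "(g has_derivative (\<lambda>v. dir_deriv v g (y + s *\<^sub>R u))) (at (y + s *\<^sub>R u))"
      using that assms(3) by (intro has_derivative_dir_deriv) (auto intro: differentiable_on_openD)
    moreover have "((\<lambda>s. y + s *\<^sub>R u) has_derivative (\<lambda>r. r *\<^sub>R u)) (at s)"
      by (auto intro!: derivative_eq_intros)
    ultimately have "((\<lambda>s. g (y + s *\<^sub>R u)) has_derivative (\<lambda>r. dir_deriv (r *\<^sub>R u) g (y + s *\<^sub>R u))) (at s)"
      by (rule has_derivative_compose[rotated])
    moreover have "dir_deriv (r *\<^sub>R u) g (y + s *\<^sub>R u) = dir_deriv u g (y + s *\<^sub>R u) * r" for r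
      using linear_scale[OF linear_dir_deriv[OF differentiable_on_openD[OF that(1) assms(3) that(2)]]]
      by simp
    ultimately show ?thesis by (simp add: has_field_derivative_def)
  qed
  \<comment> \<open>The end points are kept as \<open>0 *\<^sub>R v\<close> so that the equation has
    literally the shape produced by \<open>MVT2\<close>.\<close>
  have "\<exists>\<xi>>0. \<xi> < h \<and>
    (f (x + h *\<^sub>R v + h *\<^sub>R w) - f (x + h *\<^sub>R v)) - (f (x + 0 *\<^sub>R v + h *\<^sub>R w) - f (x + 0 *\<^sub>R v))
      = (h - 0) * (dir_deriv v f (x + \<xi> *\<^sub>R v + h *\<^sub>R w) - dir_deriv v f (x + \<xi> *\<^sub>R v))"
  proof (rule MVT2[OF assms(4)])
    fix s :: real assume s: "0 \<le> s" "s \<le> h"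
    have "((\<lambda>s. f (x + h *\<^sub>R w + s *\<^sub>R v)) has_real_derivative dir_deriv v f (x + h *\<^sub>R w + s *\<^sub>R v)) (at s)"
      using assms(4) assms(5)[of s h] s by (intro der assms(1)) (auto simp: algebra_simps)
    moreover have "((\<lambda>s. f (x + s *\<^sub>R v)) has_real_derivative dir_deriv v f (x + s *\<^sub>R v)) (at s)"
      using assms(4) assms(5)[of s 0] s by (intro der assms(1)) (auto simp: algebra_simps)
    ultimately show "((\<lambda>s. f (x + s *\<^sub>R v + h *\<^sub>R w) - f (x + s *\<^sub>R v)) has_real_derivative
       dir_deriv v f (x + s *\<^sub>R v + h *\<^sub>R w) - dir_deriv v f (x + s *\<^sub>R v)) (at s)"
      by (auto dest: DERIV_diff simp: add_ac)
  qed
  then obtain \<xi> where \<xi>: "0 < \<xi>" "\<xi> < h"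
    "f (x + h *\<^sub>R v + h *\<^sub>R w) - f (x + h *\<^sub>R v) - f (x + h *\<^sub>R w) + f x
      = h * (dir_deriv v f (x + \<xi> *\<^sub>R v + h *\<^sub>R w) - dir_deriv v f (x + \<xi> *\<^sub>R v))" by auto
  have "\<exists>\<eta>>0. \<eta> < h \<and>
     dir_deriv v f (x + \<xi> *\<^sub>R v + h *\<^sub>R w) - dir_deriv v f (x + \<xi> *\<^sub>R v + 0 *\<^sub>R w)
      = (h - 0) * dir_deriv w (dir_deriv v f) (x + \<xi> *\<^sub>R v + \<eta> *\<^sub>R w)"
    using \<xi> assms(5)[of \<xi>] by (intro MVT2[OF assms(4)] der assms(2)) auto
  then obtain \<eta> where "0 < \<eta>" "\<eta> < h"
     "dir_deriv v f (x + \<xi> *\<^sub>R v + h *\<^sub>R w) - dir_deriv v f (x + \<xi> *\<^sub>R v)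
      = h * dir_deriv w (dir_deriv v f) (x + \<xi> *\<^sub>R v + \<eta> *\<^sub>R w)" by auto
  then show ?thesis using \<xi> that[of \<xi> \<eta>] by (simp add: mult.assoc)
qed

text \<open>Divided by h^2, the second difference equals a mixed derivative at a point near x, and
  this for either order of differentiation. Both mixed derivatives are continuous, so letting h tend
  to 0 identifies them at x.\<close>

lemma dir_deriv_commute_real:
  fixes f :: "'a::real_normed_vector \<Rightarrow> real"
  assumes "smooth_on S f" "x \<in> S"
  shows "dir_deriv v (dir_deriv w f) x = dir_deriv w (dir_deriv v f) x"
proof -
  have S: "open S" using assms by (simp add: smooth_on_def)
  then obtain r where r: "0 < r" "ball x r \<subseteq> S" using assms(2) open_contains_ball by blast
  \<comment> \<open>The summand 1 keeps K positive when v = w = 0 and makes the estimate in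
    \<open>in_ball\<close> strict; K is symmetric in v and w, so that \<open>in_ball\<close> serves
    both orders.\<close>
  define K where "K = norm v + norm w + 1"
  have K: "K > 0" by (simp add: K_def add_nonneg_pos)
  define h where "h n = r / (K * (real n + 1))" for n :: nat
  have h0: "h n > 0" for n using r K by (simp add: h_def)
  have hlim: "h \<longlonglongrightarrow> 0" unfolding h_def using K by real_asymp
  have hb: "h n * K \<le> r" for n
  proof -
    have "h n * K = r / (real n + 1)" using K by (simp add: h_def)
    also have "\<dots> \<le> r / 1" using r by (intro divide_left_mono) auto
    finally show ?thesis by simp
  qed
  have in_ball: "x + s *\<^sub>R v' + t *\<^sub>R w' \<in> S"
    if "0 \<le> s" "s \<le> h n" "0 \<le> t" "t \<le> h n" "norm v' + norm w' + 1 = K" for s t n v' w'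
  proof -
    have "norm (s *\<^sub>R v' + t *\<^sub>R w') \<le> s * norm v' + t * norm w'"
      using that norm_triangle_ineq[of "s *\<^sub>R v'" "t *\<^sub>R w'"] by simp
    also have "\<dots> \<le> h n * norm v' + h n * norm w'"
      using that by (intro add_mono mult_right_mono) auto
    also have "\<dots> < h n * K" using h0[of n] that(5)[symmetric] by (simp add: algebra_simps)
    finally have "norm (s *\<^sub>R v' + t *\<^sub>R w') < r" using hb[of n] by simp
    moreover have "dist x (x + (s *\<^sub>R v' + t *\<^sub>R w')) = norm (s *\<^sub>R v' + t *\<^sub>R w')"
      by (metis add_diff_cancel_left' dist_commute dist_norm)
    ultimately show ?thesis using r(2) by (auto simp: add.assoc subset_iff)
  qed
  have diff: "f differentiable_on S" "dir_deriv u f differentiable_on S"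
    and cont: "isCont (dir_deriv u (dir_deriv u' f)) x" for u u'
    using smooth_onD[OF assms(1)] smooth_onD[OF smooth_on_dir_deriv[OF assms(1)]]
      smooth_onD[OF smooth_on_dir_deriv[OF smooth_on_dir_deriv[OF assms(1)]] assms(2)] S
    by (simp_all add: differentiable_on_eq_differentiable_at differentiable_imp_continuous_within)
  define \<Delta> where "\<Delta> n = f (x + h n *\<^sub>R v + h n *\<^sub>R w) - f (x + h n *\<^sub>R v) - f (x + h n *\<^sub>R w) + f x" for n
  have quotient: "(\<lambda>n. \<Delta> n / (h n * h n)) \<longlonglongrightarrow> dir_deriv b (dir_deriv a f) x"
    if ab: "(a = v \<and> b = w) \<or> (a = w \<and> b = v)" for a b
  proof -
    have "\<exists>\<xi> \<eta>. 0 < \<xi> \<and> \<xi> < h n \<and> 0 < \<eta> \<and> \<eta> < h n \<and>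
        \<Delta> n = h n * h n * dir_deriv b (dir_deriv a f) (x + \<xi> *\<^sub>R a + \<eta> *\<^sub>R b)" for n
    proof (rule second_difference_mvt[OF diff S h0, of n x a b])
      show "x + s *\<^sub>R a + t *\<^sub>R b \<in> S" if "0 \<le> s" "s \<le> h n" "0 \<le> t" "t \<le> h n" for s t
        using that ab by (intro in_ball) (auto simp: K_def)
    next
      fix \<xi> \<eta>
      assume *: "0 < \<xi>" "\<xi> < h n" "0 < \<eta>" "\<eta> < h n"
        "f (x + h n *\<^sub>R a + h n *\<^sub>R b) - f (x + h n *\<^sub>R a) - f (x + h n *\<^sub>R b) + f x
          = h n * h n * dir_deriv b (dir_deriv a f) (x + \<xi> *\<^sub>R a + \<eta> *\<^sub>R b)"
      have "\<Delta> n = f (x + h n *\<^sub>R a + h n *\<^sub>R b) - f (x + h n *\<^sub>R a) - f (x + h n *\<^sub>R b) + f x"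
        using ab by (auto simp: \<Delta>_def add_ac)
      then show ?thesis using * by auto
    qed
    then obtain \<xi> \<eta> where *: "\<And>n. 0 < \<xi> n \<and> \<xi> n < h n \<and> 0 < \<eta> n \<and> \<eta> n < h n \<and>
        \<Delta> n = h n * h n * dir_deriv b (dir_deriv a f) (x + \<xi> n *\<^sub>R a + \<eta> n *\<^sub>R b)" by metis
    have "\<xi> \<longlonglongrightarrow> 0" "\<eta> \<longlonglongrightarrow> 0"
      using * by (auto intro!: tendsto_sandwich[OF _ _ tendsto_const hlim] always_eventually less_imp_le)
    then have "(\<lambda>n. x + \<xi> n *\<^sub>R a + \<eta> n *\<^sub>R b) \<longlonglongrightarrow> x + 0 *\<^sub>R a + 0 *\<^sub>R b"
      by (intro tendsto_intros)
    then have "(\<lambda>n. dir_deriv b (dir_deriv a f) (x + \<xi> n *\<^sub>R a + \<eta> n *\<^sub>R b)) \<longlonglongrightarrow> dir_deriv b (dir_deriv a f) x"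
      using cont isCont_tendsto_compose by fastforce
    moreover have "\<Delta> n / (h n * h n) = dir_deriv b (dir_deriv a f) (x + \<xi> n *\<^sub>R a + \<eta> n *\<^sub>R b)" for n
      using * h0[of n] by simp
    ultimately show ?thesis by simp
  qed
  show ?thesis using quotient[of v w] quotient[of w v] LIMSEQ_unique by blast
qed

lemma dir_deriv_bounded_linear:
  assumes "bounded_linear L" "f differentiable (at x)"
  shows "dir_deriv v (\<lambda>x. L (f x)) x = L (dir_deriv v f x)"
  by (rule dir_deriv_eq, rule bounded_linear.has_derivative[OF assms(1)])
     (rule has_derivative_dir_deriv[OF assms(2)])

lemma dir_deriv_commute:
  fixes f :: "'a::real_normed_vector \<Rightarrow> 'b::euclidean_space"
  assumes "smooth_on S f" "x \<in> S"
  shows "dir_deriv v (dir_deriv w f) x = dir_deriv w (dir_deriv v f) x"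
proof (rule euclidean_eqI)
  fix e :: 'b assume "e \<in> Basis"
  have bl: "bounded_linear (\<lambda>y::'b. y \<bullet> e)" by (rule bounded_linear_inner_left)
  have sm: "smooth_on S (\<lambda>x. f x \<bullet> e)" by (rule smooth_on_linear_compose[OF bl assms(1)])
  have 2: "dir_deriv a (dir_deriv b f) x \<bullet> e = dir_deriv a (dir_deriv b (\<lambda>x. f x \<bullet> e)) x" for a b
  proof -
    have "dir_deriv a (dir_deriv b f) x \<bullet> e = dir_deriv a (\<lambda>x. dir_deriv b f x \<bullet> e) x"
      by (rule dir_deriv_bounded_linear[OF bl, symmetric])
         (rule smooth_onD[OF smooth_on_dir_deriv[OF assms(1)] assms(2)])
    also have "\<dots> = dir_deriv a (dir_deriv b (\<lambda>x. f x \<bullet> e)) x"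
      using assms smooth_on_open[OF assms(1)]
      by (intro dir_deriv_cong[of S]) (auto intro!: dir_deriv_bounded_linear[OF bl, symmetric] smooth_onD)
    finally show ?thesis .
  qed
  show "dir_deriv v (dir_deriv w f) x \<bullet> e = dir_deriv w (dir_deriv v f) x \<bullet> e"
    unfolding 2 by (rule dir_deriv_commute_real[OF sm assms(2)])
qed

section \<open>Charts, differentials and smooth maps\<close>

lemma atlas_open: "smooth_atlas A \<Longrightarrow> c \<in> A \<Longrightarrow> open (fst c)"
  by (simp add: smooth_atlas_def)

lemma atlas_homeomorphism:
  "smooth_atlas A \<Longrightarrow> c \<in> A \<Longrightarrow>
     homeomorphism (fst c) (snd c ` fst c) (snd c) (inv_into (fst c) (snd c))"
  by (simp add: smooth_atlas_def)

lemma atlas_inj: "smooth_atlas A \<Longrightarrow> c \<in> A \<Longrightarrow> inj_on (snd c) (fst c)"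
  by (rule inj_on_inverseI) (rule homeomorphism_apply1[OF atlas_homeomorphism])

lemma atlas_cover: 
  assumes "smooth_atlas A"
  obtains c where "c \<in> A" "p \<in> fst c"
  using assms unfolding smooth_atlas_def by (metis UN_E UNIV_I)

lemma atlas_continuous: "smooth_atlas A \<Longrightarrow> c \<in> A \<Longrightarrow> continuous_on (fst c) (snd c)"
  by (meson atlas_homeomorphism homeomorphism_def)

lemma chart_inv:
  "smooth_atlas A \<Longrightarrow> c \<in> A \<Longrightarrow> p \<in> fst c \<Longrightarrow> inv_into (fst c) (snd c) (snd c p) = p"
  by (metis atlas_inj inv_into_f_f)

lemma coord_rep_chart:
  "smooth_atlas A \<Longrightarrow> c \<in> A \<Longrightarrow> p \<in> fst c \<Longrightarrow> coord_rep c f (snd c p) = f p"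
  by (simp add: coord_rep_def chart_inv)

lemma open_chart_image:
  assumes "smooth_atlas A" "c \<in> A" "open U"
  shows "open (snd c ` (U \<inter> fst c))"
proof -
  have "openin (top_of_set (snd c ` fst c)) (snd c ` (U \<inter> fst c))"
    by (rule homeomorphism_imp_open_map[OF atlas_homeomorphism[OF assms(1,2)]])
       (use assms(3) in \<open>auto simp: openin_open Int_commute\<close>)
  moreover have "open (snd c ` fst c)"
    using assms by (simp add: smooth_atlas_def)
  ultimately show ?thesis using openin_open_trans by blast
qed

lemma open_chart_domain:
  assumes "smooth_atlas A" "c \<in> A" "open (snd c ` (W \<inter> fst c))"
  shows "open (W \<inter> fst c)"
proof -
  have "W \<inter> fst c = snd c -` (snd c ` (W \<inter> fst c)) \<inter> fst c"
    using atlas_inj[OF assms(1,2)] by (auto simp: inj_on_def)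
  then show ?thesis
    using assms atlas_open atlas_continuous continuous_on_open_vimage by metis
qed

text \<open>\<open>smooth_on\<close> contains the openness of its domain, so smoothness in all
  charts, of a function or of a one-form on W, yields the openness of W in this way.\<close>

lemma open_of_chart_images:
  assumes "smooth_atlas A" "\<And>c. c \<in> A \<Longrightarrow> open (snd c ` (W \<inter> fst c))"
  shows "open W"
proof -
  have "W = (\<Union>c\<in>A. W \<inter> fst c)" using assms(1) by (auto simp: smooth_atlas_def)
  then show ?thesis using open_chart_domain[OF assms(1)] assms(2) by (metis (no_types, lifting) open_UN)
qed

lemma smooth_function_open: "smooth_atlas A \<Longrightarrow> smooth_function A W h \<Longrightarrow> open W"
  by (rule open_of_chart_images) (auto simp: smooth_function_def smooth_on_def)

lemma smooth_function_cong:
  assumes "smooth_atlas A" "smooth_function A W f" "\<And>p. p \<in> W \<Longrightarrow> f p = g p"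
  shows "smooth_function A W g"
  unfolding smooth_function_def
proof
  fix c assume "c \<in> A"
  with assms show "smooth_on (snd c ` (W \<inter> fst c)) (coord_rep c g)"
    by (elim smooth_function_def[THEN iffD1, THEN bspec, THEN smooth_on_cong])
       (auto simp: coord_rep_chart)
qed

lemma smooth_function_subset:
  assumes "smooth_atlas A" "smooth_function A W f" "T \<subseteq> W" "open T"
  shows "smooth_function A T f"
  unfolding smooth_function_def
proof
  fix c assume "c \<in> A"
  with assms show "smooth_on (snd c ` (T \<inter> fst c)) (coord_rep c f)"
    by (elim smooth_function_def[THEN iffD1, THEN bspec, THEN smooth_on_subset])
       (auto intro: open_chart_image)
qed

lemma smooth_function_differentiable:
  "smooth_function A W h \<Longrightarrow> c \<in> A \<Longrightarrow> p \<in> W \<Longrightarrow> p \<in> fst c \<Longrightarrow>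
     coord_rep c h differentiable (at (snd c p))"
  unfolding smooth_function_def by (rule smooth_onD) auto

lemma smooth_function_linear_compose:
  "bounded_linear L \<Longrightarrow> smooth_function A W h \<Longrightarrow> smooth_function A W (L \<circ> h)"
  unfolding smooth_function_def
  by (auto dest!: bspec smooth_on_linear_compose simp: coord_rep_def o_def)

section \<open>Differentials and smooth maps in charts\<close>

lemma differential_dir_deriv: "differential c f p v = dir_deriv v (coord_rep c f) (snd c p)"
  by (simp add: differential_def dir_deriv_def)

lemma differential_cong:
  assumes "smooth_atlas A" "c \<in> A" "open N" "p \<in> N" "p \<in> fst c" "\<And>q. q \<in> N \<Longrightarrow> f q = g q"
  shows "differential c f p = differential c g p"
proof
  fix v show "differential c f p v = differential c g p v"
    unfolding differential_dir_deriv
    by (rule dir_deriv_cong[OF open_chart_image[OF assms(1-3)]])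
       (use assms in \<open>auto simp: coord_rep_chart\<close>)
qed

lemma differential_linear:
  "coord_rep c f differentiable (at (snd c p)) \<Longrightarrow> linear (differential c f p)"
  using linear_dir_deriv by (simp add: differential_dir_deriv[abs_def])

lemma differential_linear_compose:
  assumes "bounded_linear L" "coord_rep c f differentiable (at (snd c p))"
  shows "differential c (L \<circ> f) p v = L (differential c f p v)"
  unfolding differential_dir_deriv
  using dir_deriv_bounded_linear[OF assms] by (simp add: coord_rep_def o_def)

lemma differential_chart:
  assumes "smooth_atlas A" "c \<in> A" "p \<in> fst c"
  shows "differential c (snd c) p v = v"
proof -
  have "dir_deriv v (coord_rep c (snd c)) (snd c p) = dir_deriv v (\<lambda>x. x) (snd c p)"
    by (rule dir_deriv_cong[OF open_chart_image[OF assms(1,2) open_UNIV]])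
       (use assms in \<open>auto simp: coord_rep_chart\<close>)
  also have "\<dots> = v" by (rule dir_deriv_eq) simp
  finally show ?thesis by (simp add: differential_dir_deriv)
qed

text \<open>Viewing a smooth map as a family of smooth functions, one for each chart of the target,
  reduces congruence, restriction and composition to the lemmas on smooth functions.\<close>

lemma smooth_map_alt:
  "smooth_map A U B f \<longleftrightarrow>
     continuous_on U f \<and> (\<forall>c'\<in>B. smooth_function A (U \<inter> f -` fst c') (snd c' \<circ> f))"
proof -
  have "U \<inter> fst c \<inter> f -` fst c' = U \<inter> f -` fst c' \<inter> fst c" for c :: "'a chart" and c' :: "'b chart"
    by blast
  then show ?thesis by (auto simp: smooth_map_def smooth_function_def)
qed

lemma smooth_map_differentiable:
  "smooth_map A U B f \<Longrightarrow> c \<in> A \<Longrightarrow> c' \<in> B \<Longrightarrow> p \<in> U \<Longrightarrow> p \<in> fst c \<Longrightarrow> f p \<in> fst c' \<Longrightarrow>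
     coord_rep c (snd c' \<circ> f) differentiable (at (snd c p))"
  unfolding smooth_map_alt by (auto intro!: smooth_function_differentiable)

text \<open>Smoothness is checked near each point p: on the part of U that f maps into one chart
  around f p, the coordinate expression of the composite factors through the two given ones.\<close>

lemma smooth_function_compose:
  assumes A: "smooth_atlas A" and B: "smooth_atlas B" and U: "open U"
    and f: "smooth_map A U B f" and h: "smooth_function B W h"
  shows "smooth_function A (U \<inter> f -` W) (h \<circ> f)"
  unfolding smooth_function_def
proof
  fix c assume c: "c \<in> A"
  have cont: "continuous_on U f" using f by (simp add: smooth_map_def)
  have W: "open W" using smooth_function_open[OF B h] .
  have op: "open (snd c ` (U \<inter> f -` V \<inter> fst c))" if "open V" for V
    using open_chart_image[OF A c] continuous_on_open_vimage[OF U] cont that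
    by (metis Int_commute)
  show "smooth_on (snd c ` (U \<inter> f -` W \<inter> fst c)) (coord_rep c (h \<circ> f))"
  proof (rule smooth_on_local[OF _ op[OF W]])
    fix x assume "x \<in> snd c ` (U \<inter> f -` W \<inter> fst c)"
    then obtain p where p: "p \<in> U" "f p \<in> W" "p \<in> fst c" "x = snd c p" by auto
    obtain c' where c': "c' \<in> B" "f p \<in> fst c'" using atlas_cover[OF B] by metis
    define N where "N = snd c ` (U \<inter> f -` (W \<inter> fst c') \<inter> fst c)"
    have "smooth_on (snd c ` (U \<inter> fst c \<inter> f -` fst c')) (coord_rep c (snd c' \<circ> f))"
      using f c c' by (simp add: smooth_map_def)
    then have "smooth_on N (coord_rep c (snd c' \<circ> f))"
      by (rule smooth_on_subset) (use op[of "W \<inter> fst c'"] W atlas_open[OF B c'(1)] in \<open>auto simp: N_def\<close>)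
    moreover have "smooth_on (snd c' ` (W \<inter> fst c')) (coord_rep c' h)"
      using h c' by (simp add: smooth_function_def)
    ultimately have "smooth_on N (coord_rep c' h \<circ> coord_rep c (snd c' \<circ> f))"
      by (rule smooth_on_compose) (auto simp: N_def coord_rep_chart[OF A c])
    then have "smooth_on N (coord_rep c (h \<circ> f))"
      by (rule smooth_on_cong) (auto simp: N_def coord_rep_chart[OF A c] coord_rep_chart[OF B c'(1)])
    moreover have "x \<in> N" using p c' by (auto simp: N_def)
    ultimately show "\<exists>N. x \<in> N \<and> smooth_on N (coord_rep c (h \<circ> f))" by blast
  qed
qed

lemma differential_compose:
  assumes A: "smooth_atlas A" and B: "smooth_atlas B" and U: "open U"
    and f: "smooth_map A U B f" and c: "c \<in> A" "c' \<in> B" and p: "p \<in> U" "p \<in> fst c" "f p \<in> fst c'"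
    and h: "coord_rep c' h differentiable (at (snd c' (f p)))"
  shows "differential c (h \<circ> f) p v = differential c' h (f p) (differential c (snd c' \<circ> f) p v)"
proof -
  define N where "N = snd c ` (U \<inter> fst c \<inter> f -` fst c')"
  have sm: "smooth_on N (coord_rep c (snd c' \<circ> f))"
    using f c by (simp add: smooth_map_def N_def)
  have "dir_deriv v (coord_rep c (h \<circ> f)) (snd c p)
      = dir_deriv v (coord_rep c' h \<circ> coord_rep c (snd c' \<circ> f)) (snd c p)"
    by (rule dir_deriv_cong[OF smooth_on_open[OF sm]])
       (use p in \<open>auto simp: N_def coord_rep_chart[OF A c(1)] coord_rep_chart[OF B c(2)]\<close>)
  also have "\<dots> = dir_deriv (dir_deriv v (coord_rep c (snd c' \<circ> f)) (snd c p)) (coord_rep c' h)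
      (coord_rep c (snd c' \<circ> f) (snd c p))"
    by (rule dir_deriv_chain[OF smooth_map_differentiable[OF f c p]])
       (use h p in \<open>simp add: coord_rep_chart[OF A c(1)]\<close>)
  finally show ?thesis using p by (simp add: differential_dir_deriv coord_rep_chart[OF A c(1)])
qed

lemma smooth_map_id:
  assumes "smooth_atlas A"
  shows "smooth_map A UNIV A id"
  using assms by (auto simp: smooth_map_def smooth_atlas_def)

text \<open>The chain rule for the identity map, read in two charts of one atlas.\<close>

lemma chart_transition_compose:
  assumes A: "smooth_atlas A" and c: "c \<in> A" "c' \<in> A" "p \<in> fst c" "p \<in> fst c'"
    and h: "coord_rep c' h differentiable (at (snd c' p))"
  shows "differential c h p v = differential c' h p (differential c (snd c') p v)"
  using differential_compose[OF A A open_UNIV smooth_map_id[OF A] c(1,2) UNIV_I c(3), of h] c h by simp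

lemma smooth_map_cong:
  assumes "smooth_atlas A" "smooth_map A U B f" "\<And>p. p \<in> U \<Longrightarrow> f p = g p"
  shows "smooth_map A U B g"
proof -
  have eq: "U \<inter> f -` X = U \<inter> g -` X" for X using assms(3) by auto
  have "smooth_function A (U \<inter> g -` fst c') (snd c' \<circ> g)" if "c' \<in> B" for c'
    by (rule smooth_function_cong[OF assms(1), of _ "snd c' \<circ> f"])
       (use assms(2,3) that eq in \<open>auto simp: smooth_map_alt\<close>)
  moreover have "continuous_on U g" using assms by (metis continuous_on_cong smooth_map_def)
  ultimately show ?thesis unfolding smooth_map_alt by blast
qed

lemma smooth_map_subset:
  assumes "smooth_atlas A" "smooth_atlas B" "smooth_map A U B f" "T \<subseteq> U" "open T"
  shows "smooth_map A T B f"
proof -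
  have cont: "continuous_on T f" using assms by (meson continuous_on_subset smooth_map_def)
  have "open (T \<inter> f -` fst c')" if "c' \<in> B" for c'
    using continuous_on_open_vimage[OF assms(5)] cont atlas_open[OF assms(2) that] by (metis Int_commute)
  then show ?thesis using assms cont unfolding smooth_map_alt
    by (auto intro: smooth_function_subset)
qed

lemma smooth_map_compose:
  assumes "smooth_atlas A" "smooth_atlas B" "open U" "smooth_map A U B f" "smooth_map B V C g" "f ` U \<subseteq> V"
  shows "smooth_map A U C (g \<circ> f)"
proof -
  have "smooth_function A (U \<inter> (g \<circ> f) -` fst c') (snd c' \<circ> (g \<circ> f))" if "c' \<in> C" for c'
  proof -
    have "smooth_function A (U \<inter> f -` (V \<inter> g -` fst c')) ((snd c' \<circ> g) \<circ> f)"
      by (rule smooth_function_compose[OF assms(1-4)]) (use assms(5) that in \<open>simp add: smooth_map_alt\<close>)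
    moreover have "U \<inter> f -` (V \<inter> g -` fst c') = U \<inter> (g \<circ> f) -` fst c'" using assms(6) by auto
    ultimately show ?thesis by (simp add: o_assoc)
  qed
  moreover have "continuous_on U (g \<circ> f)"
    using assms by (meson continuous_on_compose continuous_on_subset smooth_map_def)
  ultimately show ?thesis by (simp add: smooth_map_alt)
qed

text \<open>The parameter space is a normed space without an atlas, so the localization through an
  intermediate chart is repeated instead of using \<open>smooth_map_compose\<close>.\<close>

lemma smooth_family_compose:
  assumes B: "smooth_atlas B" and D: "open D" and C: "smooth_atlas C"
    and g: "smooth_family D B g" and f: "smooth_map B UNIV C f"
  shows "smooth_family D C (f \<circ> g)"
  unfolding smooth_family_def
proof (intro conjI ballI)
  have gc: "continuous_on D g" using g by (simp add: smooth_family_def)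
  have fc: "continuous_on UNIV f" using f by (simp add: smooth_map_def)
  show cont: "continuous_on D (f \<circ> g)"
    using continuous_on_compose[OF gc] fc continuous_on_subset by blast
  fix c assume c: "c \<in> C"
  have op: "open (D \<inter> g -` T)" if "open T" for T
    using gc D that continuous_on_open_vimage by (metis Int_commute)
  have h: "smooth_function B (f -` fst c) (snd c \<circ> f)"
    using f c unfolding smooth_map_alt by auto
  show "smooth_on (D \<inter> (f \<circ> g) -` fst c) (snd c \<circ> (f \<circ> g))"
  proof (rule smooth_on_local)
    show "open (D \<inter> (f \<circ> g) -` fst c)"
      using op[OF smooth_function_open[OF B h]] by (simp add: vimage_comp)
    fix x assume x: "x \<in> D \<inter> (f \<circ> g) -` fst c"
    obtain b where b: "b \<in> B" "g x \<in> fst b" using atlas_cover[OF B] by metis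
    define N where "N = D \<inter> g -` (f -` fst c \<inter> fst b)"
    have "open N" unfolding N_def
      using op smooth_function_open[OF B h] atlas_open[OF B b(1)] by blast
    then have "smooth_on N (snd b \<circ> g)"
      using g b smooth_on_subset[of "D \<inter> g -` fst b" "snd b \<circ> g" N] by (auto simp: smooth_family_def N_def)
    moreover have "smooth_on (snd b ` (f -` fst c \<inter> fst b)) (coord_rep b (snd c \<circ> f))"
      using h b by (simp add: smooth_function_def)
    ultimately have "smooth_on N (coord_rep b (snd c \<circ> f) \<circ> (snd b \<circ> g))"
      by (rule smooth_on_compose) (auto simp: N_def)
    then have "smooth_on N (snd c \<circ> (f \<circ> g))"
      by (rule smooth_on_cong) (auto simp: N_def coord_rep_chart[OF B b(1)])
    moreover have "x \<in> N" using x b by (auto simp: N_def)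
    ultimately show "\<exists>N. x \<in> N \<and> smooth_on N (snd c \<circ> (f \<circ> g))" by blast
  qed
qed

lemma smooth_family_linear_reparam:
  fixes L :: "'e::euclidean_space \<Rightarrow> 'f::euclidean_space"
  assumes "smooth_family D A g" "bounded_linear L"
  shows "smooth_family (L -` D) A (g \<circ> L)"
  unfolding smooth_family_def
proof (intro conjI ballI)
  have Lc: "continuous_on S L" for S by (rule linear_continuous_on[OF assms(2)])
  show "continuous_on (L -` D) (g \<circ> L)"
    using assms(1) by (intro continuous_on_compose Lc) (auto simp: smooth_family_def intro: continuous_on_subset)
  fix c assume c: "c \<in> A"
  have sm: "smooth_on (D \<inter> g -` fst c) (snd c \<circ> g)" using assms c by (simp add: smooth_family_def)
  have "open (L -` (D \<inter> g -` fst c))"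
    by (rule open_vimage[OF smooth_on_open[OF sm] Lc])
  then have "smooth_on (L -` (D \<inter> g -` fst c)) ((snd c \<circ> g) \<circ> L)"
    using sm by (intro smooth_on_compose[OF smooth_on_bounded_linear[OF assms(2)]]) auto
  then show "smooth_on (L -` D \<inter> (g \<circ> L) -` fst c) (snd c \<circ> (g \<circ> L))"
    by (simp add: o_assoc vimage_comp)
qed

section \<open>Symplectomorphisms\<close>

lemma symplectic_atlas: "symplectic_manifold S \<Longrightarrow> smooth_atlas (charts S)"
  by (simp add: symplectic_manifold_def)

lemma symplectomorphism_onD:
  assumes "symplectomorphism_on S U S' V f"
  shows "open U" "open V" "bij_betw f U V" "smooth_map (charts S) U (charts S') f"
    "smooth_map (charts S') V (charts S) (inv_into U f)"
  using assms by (auto simp: symplectomorphism_on_def)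

lemma symplectomorphism_on_form:
  "symplectomorphism_on S U S' V f \<Longrightarrow> c \<in> charts S \<Longrightarrow> c' \<in> charts S' \<Longrightarrow> p \<in> U \<Longrightarrow> p \<in> fst c \<Longrightarrow>
    f p \<in> fst c' \<Longrightarrow>
    form S' c' (f p) (differential c (snd c' \<circ> f) p v) (differential c (snd c' \<circ> f) p w) = form S c p v w"
  unfolding symplectomorphism_on_def by blast

lemma symplectomorphism_on_subset:
  assumes "smooth_atlas (charts S)" "smooth_atlas (charts S')"
    and f: "symplectomorphism_on S U S' V f" and T: "open T" "T \<subseteq> U"
  shows "symplectomorphism_on S T S' (f ` T) f"
proof -
  note D = symplectomorphism_onD[OF f]
  have bij: "bij_betw f T (f ` T)" using D(3) T by (meson bij_betw_def inj_on_subset)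
  have inv: "inv_into U f q = inv_into T f q" if "q \<in> f ` T" for q
    using that D(3) T bij by (metis bij_betw_def f_inv_into_f inv_into_f_eq inv_into_into subsetD)
  \<comment> \<open>The image is an inverse image under the continuous inverse map, hence
    open.\<close>
  have "f ` T = inv_into U f -` T \<inter> V"
    using D(3) T(2) by (auto simp: bij_betw_def inv_into_f_eq subset_eq f_inv_into_f intro: image_eqI)
  then have op: "open (f ` T)"
    using D(2,5) T(1) continuous_on_open_vimage by (metis smooth_map_def)
  have "smooth_map (charts S') (f ` T) (charts S) (inv_into T f)"
    by (rule smooth_map_cong[OF assms(2) smooth_map_subset[OF assms(2,1) D(5)] inv])
       (use op D(3) T in \<open>auto simp: bij_betw_def\<close>)
  then show ?thesis
    using f op T bij smooth_map_subset[OF assms(1,2) D(4) T(2,1)]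
    unfolding symplectomorphism_on_def by blast
qed

text \<open>The Jacobian of f undoes that of the inverse, by the chain rule for f composed with its
  inverse, which is the identity on the open set V. Inserting pushed forward vectors into the
  invariance of the form under f then gives the invariance under the inverse.\<close>

lemma symplectomorphism_on_inverse:
  assumes A: "smooth_atlas (charts S)" and B: "smooth_atlas (charts S')"
    and f: "symplectomorphism_on S U S' V f"
  shows "symplectomorphism_on S' V S U (inv_into U f)"
proof -
  note D = symplectomorphism_onD[OF f]
  let ?g = "inv_into U f"
  have bij: "bij_betw ?g V U" using D(3) by (rule bij_betw_inv_into)
  have fg: "f (?g q) = q" if "q \<in> V" for q using D(3) that by (simp add: bij_betw_def f_inv_into_f)
  have sm: "smooth_map (charts S) U (charts S') (inv_into V ?g)"
    by (rule smooth_map_cong[OF A D(4)]) (use D(3) inv_into_inv_into_eq in metis)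
  have "form S c (?g q) (differential c' (snd c \<circ> ?g) q v) (differential c' (snd c \<circ> ?g) q w) = form S' c' q v w"
    if c: "c \<in> charts S" "c' \<in> charts S'" and q: "q \<in> V" "q \<in> fst c'" "?g q \<in> fst c" for c c' q v w
  proof -
    have gq: "?g q \<in> U" using bij q by (auto simp: bij_betw_def)
    have id: "differential c (snd c' \<circ> f) (?g q) (differential c' (snd c \<circ> ?g) q v) = v" for v
    proof -
      have "differential c (snd c' \<circ> f) (?g q) (differential c' (snd c \<circ> ?g) q v)
        = differential c' ((snd c' \<circ> f) \<circ> ?g) q v"
        by (rule differential_compose[OF B A D(2) D(5) c(2,1) q, symmetric])
           (rule smooth_map_differentiable[OF D(4) c gq], use q fg in auto)
      also have "\<dots> = differential c' (snd c') q v"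
        by (rule fun_cong[OF differential_cong[OF B c(2) D(2) q(1,2)]]) (simp add: fg)
      finally show ?thesis using differential_chart[OF B c(2) q(2)] by simp
    qed
    show ?thesis
      using symplectomorphism_on_form[OF f c gq q(3), of "differential c' (snd c \<circ> ?g) q v" "differential c' (snd c \<circ> ?g) q w"]
        fg[OF q(1)] q id by simp
  qed
  then show ?thesis using D bij sm unfolding symplectomorphism_on_def by blast
qed

lemma symplectomorphism_on_compose:
  assumes A: "smooth_atlas (charts S)" and B: "smooth_atlas (charts S')" and C: "smooth_atlas (charts S'')"
    and f: "symplectomorphism_on S U S' V f" and g: "symplectomorphism_on S' V S'' W g"
  shows "symplectomorphism_on S U S'' W (g \<circ> f)"
proof -
  note F = symplectomorphism_onD[OF f] and G = symplectomorphism_onD[OF g]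
  have bij: "bij_betw (g \<circ> f) U W" by (rule bij_betw_trans[OF F(3) G(3)])
  have sub: "f ` U \<subseteq> V" "inv_into V g ` W \<subseteq> V"
    using F(3) G(3) bij_betw_inv_into[OF G(3)] by (auto simp: bij_betw_def)
  have sm: "smooth_map (charts S) U (charts S'') (g \<circ> f)"
    by (rule smooth_map_compose[OF A B F(1) F(4) G(4) sub(1)])
  have "inv_into U (g \<circ> f) q = (inv_into U f \<circ> inv_into V g) q" if "q \<in> W" for q
  proof -
    from that obtain p where p: "p \<in> U" "q = g (f p)" using bij unfolding bij_betw_def by fastforce
    then show ?thesis using bij F(3) G(3) sub by (auto simp: bij_betw_def inv_into_f_eq)
  qed
  then have sm': "smooth_map (charts S'') W (charts S) (inv_into U (g \<circ> f))"
    by (intro smooth_map_cong[OF C smooth_map_compose[OF C B G(2) G(5) F(5) sub(2)]]) simp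
  have "form S'' c'' ((g \<circ> f) p) (differential c (snd c'' \<circ> (g \<circ> f)) p v) (differential c (snd c'' \<circ> (g \<circ> f)) p w)
      = form S c p v w"
    if c: "c \<in> charts S" "c'' \<in> charts S''" and p: "p \<in> U" "p \<in> fst c" "g (f p) \<in> fst c''" for c c'' p v w
  proof -
    obtain c' where c': "c' \<in> charts S'" "f p \<in> fst c'" using atlas_cover[OF B] by metis
    have fp: "f p \<in> V" using sub p by auto
    have "differential c (snd c'' \<circ> (g \<circ> f)) p v
        = differential c' (snd c'' \<circ> g) (f p) (differential c (snd c' \<circ> f) p v)" for v
      unfolding o_assoc
      by (rule differential_compose[OF A B F(1) F(4) c(1) c'(1) p(1,2) c'(2)])
         (rule smooth_map_differentiable[OF G(4) c'(1) c(2) fp c'(2) p(3)])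
    then show ?thesis
      using symplectomorphism_on_form[OF g c'(1) c(2) fp c'(2) p(3)]
        symplectomorphism_on_form[OF f c(1) c'(1) p(1,2) c'(2)] by simp
  qed
  then show ?thesis using F G bij sm sm' unfolding symplectomorphism_on_def by auto
qed

section \<open>Pull-back of primitives\<close>

lemma chart_transition_differentiable:
  "smooth_atlas A \<Longrightarrow> c \<in> A \<Longrightarrow> c' \<in> A \<Longrightarrow> p \<in> fst c \<Longrightarrow> p \<in> fst c' \<Longrightarrow>
    coord_rep c (snd c') differentiable (at (snd c p))"
  using smooth_map_differentiable[OF smooth_map_id, of A c c' p] by simp

lemma primitive_onD:
  assumes "primitive_on S W \<alpha>"
  shows "c \<in> charts S \<Longrightarrow> c' \<in> charts S \<Longrightarrow> p \<in> W \<Longrightarrow> p \<in> fst c \<Longrightarrow> p \<in> fst c' \<Longrightarrow>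
      \<alpha> c p v = \<alpha> c' p (differential c (snd c') p v)"
    "c \<in> charts S \<Longrightarrow> p \<in> W \<Longrightarrow> p \<in> fst c \<Longrightarrow> linear (\<alpha> c p)"
    "c \<in> charts S \<Longrightarrow> smooth_on (snd c ` (W \<inter> fst c)) (coord_rep c (\<lambda>p. \<alpha> c p v))"
    "c \<in> charts S \<Longrightarrow> p \<in> W \<Longrightarrow> p \<in> fst c \<Longrightarrow>
      differential c (\<lambda>q. \<alpha> c q w) p v - differential c (\<lambda>q. \<alpha> c q v) p w = form S c p v w"
  using assms unfolding primitive_on_def by blast+

text \<open>The chosen chart may jump from point to point. For a compatible family \<alpha> every
  chart around f p gives the same value, as \<open>pullback_form_eq\<close> shows, so that a
  convenient one may be fixed in computations.\<close>

definition pullback_form ::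
    "('b, 'y) symplectic_data_scheme \<Rightarrow> ('a \<Rightarrow> 'b) \<Rightarrow> 'b one_form \<Rightarrow> 'a one_form" where
  "pullback_form S' f \<alpha> c p v =
     (let c' = (SOME c'. c' \<in> charts S' \<and> f p \<in> fst c') in
      \<alpha> c' (f p) (differential c (snd c' \<circ> f) p v))"

lemma linear_functional_expansion:
  fixes A :: "'e::euclidean_space \<Rightarrow> real"
  shows "linear A \<Longrightarrow> A v = (\<Sum>e\<in>Basis. (v \<bullet> e) * A e)"
  using linear_euclidean_expansion[of A v] by simp

locale symplectic_iso =
  fixes S :: "('a::{t2_space,second_countable_topology}, 'x) symplectic_data_scheme"
    and S' :: "('b::{t2_space,second_countable_topology}, 'y) symplectic_data_scheme"
    and f :: "'a \<Rightarrow> 'b"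
  assumes S: "symplectic_manifold S" and S': "symplectic_manifold S'"
    and f: "symplectomorphism_on S UNIV S' UNIV f"
begin

lemmas A = symplectic_atlas[OF S] and A' = symplectic_atlas[OF S']
  and smooth = symplectomorphism_onD(4)[OF f]

lemma bij: "bij f"
  using symplectomorphism_onD(3)[OF f] .

lemma continuous: "continuous_on T f"
  using smooth continuous_on_subset by (auto simp: smooth_map_def)

lemma differential_compose_iso:
  "c \<in> charts S \<Longrightarrow> c' \<in> charts S' \<Longrightarrow> p \<in> fst c \<Longrightarrow> f p \<in> fst c' \<Longrightarrow>
    coord_rep c' h differentiable (at (snd c' (f p))) \<Longrightarrow>
    differential c (h \<circ> f) p v = differential c' h (f p) (differential c (snd c' \<circ> f) p v)"
  using differential_compose[OF A A' open_UNIV smooth] by simp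

lemma jacobian_differentiable:
  "c \<in> charts S \<Longrightarrow> c' \<in> charts S' \<Longrightarrow> p \<in> fst c \<Longrightarrow> f p \<in> fst c' \<Longrightarrow>
    coord_rep c (snd c' \<circ> f) differentiable (at (snd c p))"
  using smooth_map_differentiable[OF smooth] by simp

lemma jacobian_linear:
  "c \<in> charts S \<Longrightarrow> c' \<in> charts S' \<Longrightarrow> p \<in> fst c \<Longrightarrow> f p \<in> fst c' \<Longrightarrow>
    linear (differential c (snd c' \<circ> f) p)"
  by (rule differential_linear) (rule jacobian_differentiable)

lemma pullback_form_eq:
  assumes \<alpha>: "primitive_on S' W \<alpha>" and c: "c \<in> charts S" "c' \<in> charts S'"
    and p: "p \<in> fst c" "f p \<in> fst c'" "f p \<in> W"
  shows "pullback_form S' f \<alpha> c p v = \<alpha> c' (f p) (differential c (snd c' \<circ> f) p v)"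
proof -
  define b where "b = (SOME c'. c' \<in> charts S' \<and> f p \<in> fst c')"
  have b: "b \<in> charts S' \<and> f p \<in> fst b"
    unfolding b_def by (rule someI[of _ c']) (use c p in blast)
  have "differential c (snd b \<circ> f) p v
      = differential c' (snd b) (f p) (differential c (snd c' \<circ> f) p v)"
    using c p b by (intro differential_compose_iso chart_transition_differentiable[OF A']) auto
  then show ?thesis
    using primitive_onD(1)[OF \<alpha> c(2), of b] b p by (simp add: pullback_form_def flip: b_def)
qed

text \<open>This is the naturality of the exterior derivative, in coordinates. Differentiating the
  pulled back coefficients produces second derivatives of f; these are symmetric in v and w and
  cancel on antisymmetrization. What remains is the derivative of \<alpha>, that is the form of S',
  on the pushed forward vectors.\<close>

lemma primitive_on_pullback:
  assumes \<alpha>: "primitive_on S' W \<alpha>"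
  shows "primitive_on S (f -` W) (pullback_form S' f \<alpha>)"
proof -
  let ?\<beta> = "pullback_form S' f \<alpha>"
  have W: "open W"
    by (rule open_of_chart_images[OF A']) (rule smooth_on_open[OF primitive_onD(3)[OF \<alpha>]])
  then have W': "open (f -` W)" using continuous by (rule open_vimage)
  define H where "H c c' = coord_rep c (snd c' \<circ> f)" for c :: "'a chart" and c' :: "'b chart"
  define a where "a c' e = coord_rep c' (\<lambda>q. \<alpha> c' q e)" for c' :: "'b chart" and e
  define N where "N c c' = snd c ` (f -` (W \<inter> fst c') \<inter> fst c)" for c :: "'a chart" and c' :: "'b chart"
  have smH: "smooth_on (N c c') (H c c')" if "c \<in> charts S" "c' \<in> charts S'" for c c'
  proof -
    have "smooth_on (snd c ` (UNIV \<inter> fst c \<inter> f -` fst c')) (H c c')"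
      using smooth that by (simp add: smooth_map_def H_def)
    moreover have "open (N c c')"
      unfolding N_def using W atlas_open[OF A' that(2)] continuous
      by (intro open_chart_image[OF A that(1)] open_vimage) auto
    ultimately show ?thesis by (elim smooth_on_subset) (auto simp: N_def)
  qed
  have smB: "smooth_on (snd c' ` (W \<inter> fst c')) (a c' e)" if "c' \<in> charts S'" for c' e
    using primitive_onD(3)[OF \<alpha> that] by (simp add: a_def)
  have HN: "H c c' ` N c c' \<subseteq> snd c' ` (W \<inter> fst c')" if "c \<in> charts S" "c' \<in> charts S'" for c c'
    using that by (auto simp: N_def H_def coord_rep_chart[OF A])
  \<comment> \<open>With \<open>c'\<close> fixed on \<open>N c c'\<close> the chart choice in
    \<open>pullback_form\<close> disappears. The coefficient becomes a finite sum of products of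
    smooth functions, fit for proving smoothness as well as for differentiating.\<close>
  have local_expr: "coord_rep c (\<lambda>p. ?\<beta> c p v) x
      = (\<Sum>e\<in>Basis. (dir_deriv v (H c c') x \<bullet> e) *\<^sub>R (a c' e \<circ> H c c') x)"
    if c: "c \<in> charts S" "c' \<in> charts S'" and x: "x \<in> N c c'" for c c' v x
  proof -
    obtain p where p: "p \<in> fst c" "f p \<in> fst c'" "f p \<in> W" "x = snd c p" using x by (auto simp: N_def)
    have "?\<beta> c p v = \<alpha> c' (f p) (dir_deriv v (H c c') x)"
      using pullback_form_eq[OF \<alpha> c p(1-3)] p(4) by (simp add: H_def differential_dir_deriv)
    also have "\<dots> = (\<Sum>e\<in>Basis. (dir_deriv v (H c c') x \<bullet> e) * \<alpha> c' (f p) e)"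
      by (rule linear_functional_expansion[OF primitive_onD(2)[OF \<alpha> c(2) p(3,2)]])
    finally show ?thesis
      using p c by (simp add: coord_rep_chart[OF A c(1)] a_def H_def coord_rep_chart[OF A' c(2)])
  qed
  have compat: "?\<beta> c p v = ?\<beta> c' p (differential c (snd c') p v)"
    if c: "c \<in> charts S" "c' \<in> charts S" and p: "f p \<in> W" "p \<in> fst c" "p \<in> fst c'" for c c' p v
  proof -
    obtain b where b: "b \<in> charts S'" "f p \<in> fst b" using atlas_cover[OF A'] by metis
    have "differential c (snd b \<circ> f) p v = differential c' (snd b \<circ> f) p (differential c (snd c') p v)"
      by (rule chart_transition_compose[OF A c p(2,3)])
         (rule jacobian_differentiable[OF c(2) b(1) p(3) b(2)])
    then show ?thesis
      using pullback_form_eq[OF \<alpha> c(1) b(1) p(2) b(2) p(1)]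
        pullback_form_eq[OF \<alpha> c(2) b(1) p(3) b(2) p(1)] by simp
  qed
  have lin: "linear (?\<beta> c p)" if c: "c \<in> charts S" and p: "f p \<in> W" "p \<in> fst c" for c p
  proof -
    obtain b where b: "b \<in> charts S'" "f p \<in> fst b" using atlas_cover[OF A'] by metis
    have "?\<beta> c p = \<alpha> b (f p) \<circ> differential c (snd b \<circ> f) p"
      using pullback_form_eq[OF \<alpha> c b(1) p(2) b(2) p(1)] by auto
    moreover have "linear \<dots>"
      by (rule linear_compose[OF jacobian_linear[OF c b(1) p(2) b(2)] primitive_onD(2)[OF \<alpha> b(1) p(1) b(2)]])
    ultimately show ?thesis by simp
  qed
  have N: "\<exists>c'\<in>charts S'. f p \<in> fst c' \<and> snd c p \<in> N c c'" if "f p \<in> W" "p \<in> fst c" for c p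
  proof -
    obtain c' where "c' \<in> charts S'" "f p \<in> fst c'" using atlas_cover[OF A'] by metis
    then show ?thesis using that by (auto simp: N_def)
  qed
  have sm: "smooth_on (snd c ` (f -` W \<inter> fst c)) (coord_rep c (\<lambda>p. ?\<beta> c p v))"
    if c: "c \<in> charts S" for c v
  proof (rule smooth_on_local[OF _ open_chart_image[OF A c W']])
    fix x assume "x \<in> snd c ` (f -` W \<inter> fst c)"
    then obtain c' where c': "c' \<in> charts S'" "x \<in> N c c'" using N by blast
    have "smooth_on (N c c') (\<lambda>x. dir_deriv v (H c c') x \<bullet> e)" for e
      by (rule smooth_on_linear_compose[OF bounded_linear_inner_left])
         (rule smooth_on_dir_deriv[OF smH[OF c c'(1)]])
    moreover have "smooth_on (N c c') (a c' e \<circ> H c c')" for e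
      by (rule smooth_on_compose[OF smH[OF c c'(1)] smB[OF c'(1)] HN[OF c c'(1)]])
    ultimately have "smooth_on (N c c')
        (\<lambda>x. (dir_deriv v (H c c') x \<bullet> e) *\<^sub>R (a c' e \<circ> H c c') x)" for e
      by (rule smooth_on_scaleR)
    then have "smooth_on (N c c') (\<lambda>x. \<Sum>e\<in>Basis. (dir_deriv v (H c c') x \<bullet> e) *\<^sub>R (a c' e \<circ> H c c') x)"
      by (rule smooth_on_sum[OF smooth_on_open[OF smH[OF c c'(1)]]])
    then have "smooth_on (N c c') (coord_rep c (\<lambda>p. ?\<beta> c p v))"
      by (rule smooth_on_cong) (simp add: local_expr[OF c c'(1)])
    then show "\<exists>N. x \<in> N \<and> smooth_on N (coord_rep c (\<lambda>p. ?\<beta> c p v))" using c' by blast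
  qed
  have "differential c (\<lambda>q. ?\<beta> c q w) p v - differential c (\<lambda>q. ?\<beta> c q v) p w = form S c p v w"
    if c: "c \<in> charts S" and p: "f p \<in> W" "p \<in> fst c" for c p v w
  proof -
    obtain c' where c': "c' \<in> charts S'" "f p \<in> fst c'" "snd c p \<in> N c c'" using N[OF p] by blast
    define x where "x = snd c p"
    define h where "h = H c c'"
    have x: "x \<in> N c c'" "h x = snd c' (f p)"
      using c' p by (simp_all add: x_def h_def H_def coord_rep_chart[OF A c])
    have hd: "h differentiable (at x)" and hdd: "dir_deriv v h differentiable (at x)" for v
      using smooth_onD[OF _ x(1)] smH[OF c c'(1)] smooth_on_dir_deriv by (auto simp: h_def)
    have ad: "a c' e differentiable (at (h x))" for e
      using smooth_onD[OF smB[OF c'(1)]] HN[OF c c'(1)] x(1) by (auto simp: h_def)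
    \<comment> \<open>The product rule. The sum carries the second derivatives of h; the other term
      differentiates \<alpha> with its argument frozen at \<open>dir_deriv w h x\<close>.\<close>
    have *: "differential c (\<lambda>q. ?\<beta> c q w) p v =
        (\<Sum>e\<in>Basis. (dir_deriv v (dir_deriv w h) x \<bullet> e) * a c' e (h x))
        + differential c' (\<lambda>q. \<alpha> c' q (dir_deriv w h x)) (f p) (dir_deriv v h x)" for v w
    proof -
      let ?Dw = "dir_deriv w h x" and ?Dv = "dir_deriv v h x"
      have "((\<lambda>y. (dir_deriv w h y \<bullet> e) *\<^sub>R (a c' e \<circ> h) y) has_derivative
          (\<lambda>v. (?Dw \<bullet> e) *\<^sub>R dir_deriv (dir_deriv v h x) (a c' e) (h x)
             + (dir_deriv v (dir_deriv w h) x \<bullet> e) *\<^sub>R a c' e (h x))) (at x)" for e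
        using has_derivative_scaleR[OF
            bounded_linear.has_derivative[OF bounded_linear_inner_left has_derivative_dir_deriv[OF hdd]]
            has_derivative_compose[OF has_derivative_dir_deriv[OF hd] has_derivative_dir_deriv[OF ad]]]
        by simp
      then have "((\<lambda>y. \<Sum>e\<in>Basis. (dir_deriv w h y \<bullet> e) *\<^sub>R (a c' e \<circ> h) y) has_derivative
          (\<lambda>v. \<Sum>e\<in>Basis. (?Dw \<bullet> e) *\<^sub>R dir_deriv (dir_deriv v h x) (a c' e) (h x)
             + (dir_deriv v (dir_deriv w h) x \<bullet> e) *\<^sub>R a c' e (h x))) (at x)"
        by (rule has_derivative_sum)
      then have "dir_deriv v (\<lambda>y. \<Sum>e\<in>Basis. (dir_deriv w h y \<bullet> e) *\<^sub>R (a c' e \<circ> h) y) x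
          = (\<Sum>e\<in>Basis. (?Dw \<bullet> e) *\<^sub>R dir_deriv ?Dv (a c' e) (h x)
             + (dir_deriv v (dir_deriv w h) x \<bullet> e) *\<^sub>R a c' e (h x))"
        by (rule dir_deriv_eq)
      moreover have "dir_deriv v (coord_rep c (\<lambda>q. ?\<beta> c q w)) x
          = dir_deriv v (\<lambda>y. \<Sum>e\<in>Basis. (dir_deriv w h y \<bullet> e) *\<^sub>R (a c' e \<circ> h) y) x"
        by (rule dir_deriv_cong[OF smooth_on_open[OF smH[OF c c'(1)]] x(1)])
           (simp add: local_expr[OF c c'(1)] h_def)
      \<comment> \<open>Once frozen, \<open>?Dw\<close> is a constant vector, so the expansion of
        \<alpha> in the basis may be differentiated term by term.\<close>
      moreover have "differential c' (\<lambda>q. \<alpha> c' q ?Dw) (f p) ?Dv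
          = (\<Sum>e\<in>Basis. (?Dw \<bullet> e) *\<^sub>R dir_deriv ?Dv (a c' e) (h x))"
      proof -
        have "((\<lambda>y. \<Sum>e\<in>Basis. (?Dw \<bullet> e) *\<^sub>R a c' e y) has_derivative
            (\<lambda>v. \<Sum>e\<in>Basis. (?Dw \<bullet> e) *\<^sub>R dir_deriv v (a c' e) (h x))) (at (h x))"
          by (intro has_derivative_sum has_derivative_scaleR_right has_derivative_dir_deriv ad)
        then have "dir_deriv ?Dv (\<lambda>y. \<Sum>e\<in>Basis. (?Dw \<bullet> e) *\<^sub>R a c' e y) (h x)
            = (\<Sum>e\<in>Basis. (?Dw \<bullet> e) *\<^sub>R dir_deriv ?Dv (a c' e) (h x))" by (rule dir_deriv_eq)
        moreover have "dir_deriv ?Dv (coord_rep c' (\<lambda>q. \<alpha> c' q ?Dw)) (h x)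
            = dir_deriv ?Dv (\<lambda>y. \<Sum>e\<in>Basis. (?Dw \<bullet> e) *\<^sub>R a c' e y) (h x)"
        proof (rule dir_deriv_cong[OF smooth_on_open[OF smB[OF c'(1)]]])
          show "h x \<in> snd c' ` (W \<inter> fst c')" using x(2) p c' by auto
          fix y assume "y \<in> snd c' ` (W \<inter> fst c')"
          then obtain q where q: "q \<in> W" "q \<in> fst c'" "y = snd c' q" by auto
          show "coord_rep c' (\<lambda>q. \<alpha> c' q ?Dw) y = (\<Sum>e\<in>Basis. (?Dw \<bullet> e) *\<^sub>R a c' e y)"
            using linear_functional_expansion[OF primitive_onD(2)[OF \<alpha> c'(1) q(1,2)], of ?Dw] q
            by (simp add: a_def coord_rep_chart[OF A' c'(1)])
        qed
        ultimately show ?thesis using x(2) by (simp add: differential_dir_deriv)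
      qed
      ultimately show ?thesis by (simp add: differential_dir_deriv sum.distrib flip: x_def)
    qed
    have "dir_deriv v (dir_deriv w h) x = dir_deriv w (dir_deriv v h) x"
      unfolding h_def by (rule dir_deriv_commute[OF smH[OF c c'(1)] x(1)])
    then have "differential c (\<lambda>q. ?\<beta> c q w) p v - differential c (\<lambda>q. ?\<beta> c q v) p w
       = form S' c' (f p) (dir_deriv v h x) (dir_deriv w h x)"
      unfolding * using primitive_onD(4)[OF \<alpha> c'(1) p(1) c'(2), of "dir_deriv w h x" "dir_deriv v h x"]
      by simp
    also have "\<dots> = form S c p v w"
      using symplectomorphism_on_form[OF f c c'(1) UNIV_I p(2) c'(2)]
      by (simp add: h_def H_def x_def differential_dir_deriv)
    finally show ?thesis .
  qed
  then show ?thesis using compat lin sm unfolding primitive_on_def by blast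
qed

section \<open>Transport of curves\<close>

lemma curve_compose:
  assumes c: "c \<in> charts S" "c' \<in> charts S'" and t: "\<gamma> t \<in> fst c" "f (\<gamma> t) \<in> fst c'"
    and \<gamma>: "continuous_on UNIV \<gamma>" "((snd c \<circ> \<gamma>) has_vector_derivative X) (at t)"
  shows "((snd c' \<circ> (f \<circ> \<gamma>)) has_vector_derivative differential c (snd c' \<circ> f) (\<gamma> t) X) (at t)"
proof -
  have "(coord_rep c (snd c' \<circ> f) has_derivative differential c (snd c' \<circ> f) (\<gamma> t)) (at ((snd c \<circ> \<gamma>) t))"
    using has_derivative_dir_deriv[OF jacobian_differentiable[OF c t]]
    by (simp add: differential_dir_deriv[abs_def])
  then have "((coord_rep c (snd c' \<circ> f) \<circ> (snd c \<circ> \<gamma>)) has_vector_derivative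
      differential c (snd c' \<circ> f) (\<gamma> t) X) (at t)"
    using \<gamma>(2) by (metis vector_derivative_diff_chain_within has_derivative_at_withinI)
  \<comment> \<open>The composite agrees with the coordinate curve only while the curve stays in the
    domain of c, which holds on an open set of times around t.\<close>
  moreover have "open (\<gamma> -` fst c)" by (rule open_vimage[OF atlas_open[OF A c(1)] \<gamma>(1)])
  ultimately show ?thesis
    by (rule has_vector_derivative_transform_within_open)
       (use t in \<open>auto simp: coord_rep_chart[OF A c(1)]\<close>)
qed

text \<open>The integrands agree at every t, whatever charts the two choice operators select: the
  velocity is pushed forward by the Jacobian, and \<open>pullback_form_eq\<close> absorbs the change
  of chart.\<close>

lemma loop_integral_pullback:
  assumes \<alpha>: "primitive_on S' W \<alpha>" and \<gamma>: "continuous_on UNIV \<gamma>" "\<And>t. f (\<gamma> t) \<in> W"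
    and d: "\<And>c t. c \<in> charts S \<Longrightarrow> \<gamma> t \<in> fst c \<Longrightarrow> (snd c \<circ> \<gamma>) differentiable (at t)"
  shows "loop_integral S (pullback_form S' f \<alpha>) \<gamma> = loop_integral S' \<alpha> (f \<circ> \<gamma>)"
proof -
  have "(let c = (SOME c. c \<in> charts S \<and> \<gamma> t \<in> fst c)
      in pullback_form S' f \<alpha> c (\<gamma> t) (vector_derivative (snd c \<circ> \<gamma>) (at t)))
    = (let c' = (SOME c'. c' \<in> charts S' \<and> (f \<circ> \<gamma>) t \<in> fst c')
      in \<alpha> c' ((f \<circ> \<gamma>) t) (vector_derivative (snd c' \<circ> (f \<circ> \<gamma>)) (at t)))" for t
  proof -
    define c where "c = (SOME c. c \<in> charts S \<and> \<gamma> t \<in> fst c)"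
    define c' where "c' = (SOME c'. c' \<in> charts S' \<and> f (\<gamma> t) \<in> fst c')"
    have c: "c \<in> charts S \<and> \<gamma> t \<in> fst c"
      unfolding c_def by (rule someI_ex) (metis atlas_cover[OF A])
    have c': "c' \<in> charts S' \<and> f (\<gamma> t) \<in> fst c'"
      unfolding c'_def by (rule someI_ex) (metis atlas_cover[OF A'])
    have "((snd c' \<circ> (f \<circ> \<gamma>)) has_vector_derivative
        differential c (snd c' \<circ> f) (\<gamma> t) (vector_derivative (snd c \<circ> \<gamma>) (at t))) (at t)"
      by (rule curve_compose) (use c c' \<gamma>(1) d in \<open>auto simp: vector_derivative_works[symmetric]\<close>)
    then have "vector_derivative (snd c' \<circ> (f \<circ> \<gamma>)) (at t)
        = differential c (snd c' \<circ> f) (\<gamma> t) (vector_derivative (snd c \<circ> \<gamma>) (at t))"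
      by (rule vector_derivative_at)
    then show ?thesis
      using pullback_form_eq[OF \<alpha>, of c c' "\<gamma> t"] c c' \<gamma>(2) by (simp flip: c_def c'_def)
  qed
  then show ?thesis unfolding loop_integral_def by simp
qed

end

text \<open>The chart selected in the integrand depends only on the point of the loop. Hence
  reversal turns the integrand g(t) into -g(-t), and g inherits the period 1. Reflection moves the
  integral to [-1, 0], and the period moves it back to [0, 1].\<close>

lemma loop_integral_reverse:
  assumes lin: "\<And>c t. c \<in> charts S \<Longrightarrow> \<gamma> t \<in> fst c \<Longrightarrow> linear (\<alpha> c (\<gamma> t))"
    and atlas: "smooth_atlas (charts S)"
    and d: "\<And>c t. c \<in> charts S \<Longrightarrow> \<gamma> t \<in> fst c \<Longrightarrow> (snd c \<circ> \<gamma>) differentiable (at t)"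
    and per: "\<And>t. \<gamma> (t + 1) = \<gamma> t"
  shows "loop_integral S \<alpha> (\<lambda>t. \<gamma> (- t)) = - loop_integral S \<alpha> \<gamma>"
proof -
  define k where "k t = (SOME c. c \<in> charts S \<and> \<gamma> t \<in> fst c)" for t
  have k: "k t \<in> charts S" "\<gamma> t \<in> fst (k t)" for t
    using someI_ex[of "\<lambda>c. c \<in> charts S \<and> \<gamma> t \<in> fst c"] atlas_cover[OF atlas] unfolding k_def by metis+
  define g where "g t = \<alpha> (k t) (\<gamma> t) (vector_derivative (snd (k t) \<circ> \<gamma>) (at t))" for t
  have vd: "((snd (k t) \<circ> \<gamma>) has_vector_derivative vector_derivative (snd (k t) \<circ> \<gamma>) (at t)) (at t)" for t
    using d[OF k] vector_derivative_works by blast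
  have rev: "(let c = k (- t) in \<alpha> c (\<gamma> (- t)) (vector_derivative (snd c \<circ> (\<lambda>t. \<gamma> (- t))) (at t))) = - g (- t)" for t
  proof -
    have "((\<lambda>t. - t) has_vector_derivative -1) (at t)" by (auto intro!: derivative_eq_intros)
    from vector_diff_chain_at[OF this vd]
    have "((\<lambda>s. (snd (k (- t)) \<circ> \<gamma>) (- s)) has_vector_derivative
        - vector_derivative (snd (k (- t)) \<circ> \<gamma>) (at (- t))) (at t)" by (simp add: o_def)
    then have "vector_derivative (snd (k (- t)) \<circ> (\<lambda>t. \<gamma> (- t))) (at t)
        = - vector_derivative (snd (k (- t)) \<circ> \<gamma>) (at (- t))"
      by (intro vector_derivative_at) (simp add: o_def)
    then show ?thesis using lin[OF k] by (simp add: g_def linear_neg Let_def)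
  qed
  have gper: "g (t + 1) = g t" for t
  proof -
    have "((\<lambda>t. t + 1) has_vector_derivative 1) (at t)" by (auto intro!: derivative_eq_intros)
    from vector_diff_chain_at[OF this vd]
    have "(snd (k (t + 1)) \<circ> \<gamma> has_vector_derivative vector_derivative (snd (k (t + 1)) \<circ> \<gamma>) (at (t + 1))) (at t)"
      by (simp add: o_def per)
    moreover have "k (t + 1) = k t" by (simp add: k_def per)
    ultimately show ?thesis by (simp add: g_def per vector_derivative_at)
  qed
  have "integral {0..1} (\<lambda>t. - g (- t)) = - integral {0..1} (\<lambda>t. g (- t))" by (rule integral_neg)
  also have "integral {0..1} (\<lambda>t. g (- t)) = integral {-1..0} g"
    using Henstock_Kurzweil_Integration.integral_reflect_real[of 0 "-1" g] by simp
  also have "\<dots> = integral {0..1} g"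
  proof -
    \<comment> \<open>Equivalence for every value i also covers the default value of
      \<open>integral\<close> on a function that is not integrable.\<close>
    have "(g has_integral i) {-1..0} \<longleftrightarrow> (g has_integral i) {0..1}" for i
      using has_integral_shift_Icc_real[of g 1 i "-1" 0] gper by (simp add: o_def add.commute)
    then show ?thesis by (simp add: integral_def integrable_on_def)
  qed
  finally show ?thesis
    unfolding loop_integral_def k_def[symmetric] rev by (simp add: g_def[abs_def] Let_def)
qed

section \<open>Loops in homology\<close>

text \<open>The general p and k allow for the 1-simplex of a loop as well as for the 2-simplices
  that bound a loop together with its reverse, one of them coming from a constant path.\<close>

lemma singular_simplex_path_coordinate:
  assumes "continuous_map euclideanreal X \<gamma>"
  shows "singular_simplex p X (restrict (\<lambda>x. \<gamma> (x k)) (standard_simplex p))"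
proof -
  have "continuous_map (subtopology (powertop_real UNIV) (standard_simplex p)) euclideanreal (\<lambda>x. x k)"
    by (intro continuous_map_from_subtopology continuous_map_product_projection) simp
  from continuous_map_compose[OF this assms]
  have "continuous_map (subtopology (powertop_real UNIV) (standard_simplex p)) X
      (restrict (\<lambda>x. \<gamma> (x k)) (standard_simplex p))"
    by (rule continuous_map_eq) (simp add: topspace_standard_simplex)
  then show ?thesis by (simp add: singular_simplex_def)
qed

lemma loop_cycle:
  assumes "continuous_map euclideanreal X \<gamma>" "\<gamma> 1 = \<gamma> 0"
  shows "singular_relcycle 1 X {} (frag_of (restrict (\<lambda>x. \<gamma> (x 1)) (standard_simplex 1)))"
proof -
  let ?\<sigma> = "restrict (\<lambda>x. \<gamma> (x 1)) (standard_simplex 1)"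
  have face: "?\<sigma> (simplical_face k x) = \<gamma> (simplical_face k x 1)"
    if "x \<in> standard_simplex 0" "k \<le> 1" for x :: "nat \<Rightarrow> real" and k
    using simplical_face_in_standard_simplex[of 1 k x] that by simp
  \<comment> \<open>Face 0 inserts a zero in front of the single coordinate 1 and so evaluates the
    path at 1; face 1 puts the zero behind it and evaluates the path at 0.\<close>
  have "singular_face 1 0 ?\<sigma> = singular_face 1 1 ?\<sigma>"
    unfolding singular_face_def
  proof (rule restrict_ext)
    fix x :: "nat \<Rightarrow> real" assume "x \<in> standard_simplex (1 - Suc 0)"
    then have x: "x \<in> standard_simplex 0" by simp
    then have "x 0 = 1" by (simp add: standard_simplex_0)
    then show "(?\<sigma> \<circ> simplical_face 0) x = (?\<sigma> \<circ> simplical_face 1) x"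
      unfolding o_apply using face[OF x, of 0] face[OF x, of 1] assms(2) by (simp add: simplical_face_def)
  qed
  moreover have "{..1} = {0, 1::nat}" by auto
  ultimately have "chain_boundary 1 (frag_of ?\<sigma>) = 0" by (simp add: chain_boundary_of)
  then show ?thesis
    using singular_simplex_path_coordinate[OF assms(1), of 1 1] by (simp add: singular_cycle singular_chain_of)
qed

lemma loop_class_carrier:
  assumes "continuous_map euclideanreal X \<gamma>" "\<gamma> 1 = \<gamma> 0"
  shows "loop_class X \<gamma> \<in> carrier (homology_group 1 X)"
  using loop_cycle[OF assms] carrier_relative_homology_group[of 1 X "{}"]
  unfolding loop_class_def by (auto intro!: imageI)

text \<open>With \<open>\<kappa>\<close> the constant 2-simplex and \<open>\<tau>(x) = \<gamma>(x\<^sub>1)\<close>, the boundary of \<open>\<tau> + \<kappa>\<close> is the sum of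
  the loop and its reverse.\<close>

lemma loop_class_reverse:
  assumes cont: "continuous_map euclideanreal X \<gamma>" and per: "\<And>t. \<gamma> (t + 1) = \<gamma> t"
  shows "loop_class X (\<lambda>t. \<gamma> (- t)) = inv\<^bsub>homology_group 1 X\<^esub> (loop_class X \<gamma>)"
proof -
  define \<sigma> where "\<sigma> = restrict (\<lambda>x. \<gamma> (x 1)) (standard_simplex 1)"
  define \<rho> where "\<rho> = restrict (\<lambda>x. \<gamma> (- (x 1))) (standard_simplex 1)"
  define \<tau> where "\<tau> = restrict (\<lambda>x. \<gamma> (x 1)) (standard_simplex 2)"
  define \<kappa> where "\<kappa> = restrict (\<lambda>x::nat\<Rightarrow>real. \<gamma> 0) (standard_simplex 2)"
  define \<kappa>1 where "\<kappa>1 = restrict (\<lambda>x::nat\<Rightarrow>real. \<gamma> 0) (standard_simplex 1)"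
  have per0: "\<gamma> 1 = \<gamma> 0" using per[of 0] by simp
  have sum1: "x 0 + x 1 = 1" if "x \<in> standard_simplex 1" for x :: "nat \<Rightarrow> real"
    using that by (simp add: standard_simplex_def)
  \<comment> \<open>On the 1-simplex the coordinates add up to 1, so by periodicity the reversed
    loop is the loop read in the coordinate \<open>x 0\<close>.\<close>
  have rev: "\<gamma> (- (x 1)) = \<gamma> (x 0)" if "x \<in> standard_simplex 1" for x :: "nat \<Rightarrow> real"
    using per[of "- (x 1)"] sum1[OF that] by (metis add.commute add_diff_cancel_right' minus_add_cancel uminus_add_conv_diff)
  have face: "simplical_face k x \<in> standard_simplex 2" if "x \<in> standard_simplex 1" "k \<le> 2"
    for x :: "nat \<Rightarrow> real" and k
    using simplical_face_in_standard_simplex[of 2 k x] that by simp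
  have sf: "singular_face 2 k (restrict g (standard_simplex 2))
      = restrict (\<lambda>x. g (simplical_face k x)) (standard_simplex 1)" if "k \<le> 2"
    for k and g :: "(nat \<Rightarrow> real) \<Rightarrow> 'a"
  proof -
    have "2 - Suc 0 = (1::nat)" by simp
    then show ?thesis
      unfolding singular_face_def by (auto intro!: restrict_ext simp: face that simp del: One_nat_def)
  qed
  have faces: "singular_face 2 0 \<tau> = \<rho>" "singular_face 2 1 \<tau> = \<kappa>1" "singular_face 2 2 \<tau> = \<sigma>"
    unfolding \<tau>_def \<rho>_def \<sigma>_def \<kappa>1_def
    by (simp_all only: sf order_refl zero_le one_le_numeral)
       (auto intro!: restrict_ext simp: simplical_face_def rev[unfolded One_nat_def])
  have faces': "singular_face 2 k \<kappa> = \<kappa>1" if "k \<le> 2" for k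
    unfolding \<kappa>_def \<kappa>1_def by (rule sf[OF that])
  \<comment> \<open>The boundary of \<tau> is \<rho> - \<open>\<kappa>1\<close> + \<sigma> and that
    of \<kappa> is \<open>\<kappa>1\<close>, so adding \<kappa> removes the constant edge.\<close>
  have "{..2} = {0, 1, 2::nat}" by auto
  then have "chain_boundary 2 (frag_of \<tau> + frag_of \<kappa>) = frag_of \<rho> + frag_of \<sigma>"
    using faces faces'[of 0] faces'[of 1] faces'[of 2] by (simp add: chain_boundary_add chain_boundary_of)
  moreover have "singular_chain 2 X (frag_of \<tau> + frag_of \<kappa>)"
    using singular_simplex_path_coordinate[OF cont, of 2 1]
      singular_simplex_path_coordinate[of X "\<lambda>_. \<gamma> 0" 2 1] cont
    by (intro singular_chain_add) (auto simp: singular_chain_of \<tau>_def \<kappa>_def continuous_map_def)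
  ultimately have "singular_relboundary 1 X {} (frag_of \<rho> + frag_of \<sigma>)"
    unfolding singular_boundary by (metis numeral_2_eq_2 One_nat_def)
  then have "homologous_rel 1 X {} (frag_of \<rho>) (- frag_of \<sigma>)" by (simp add: homologous_rel_def)
  then have eq: "homologous_rel_set 1 X {} (frag_of \<rho>) = homologous_rel_set 1 X {} (- frag_of \<sigma>)"
    by (simp add: homologous_rel_set_eq)
  \<comment> \<open>Inversion in the homology group is the image of a coset under negation, so the
    coset of the negated chain is brought into that form.\<close>
  also have "\<dots> = uminus ` homologous_rel_set 1 X {} (frag_of \<sigma>)"
  proof -
    have "homologous_rel 1 X {} (- c) x \<longleftrightarrow> homologous_rel 1 X {} c (- x)" for c x
      using singular_relboundary_minus[of 1 X "{}" "c + x"] by (simp add: homologous_rel_def)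
    then have "x \<in> homologous_rel_set 1 X {} (- c) \<longleftrightarrow> x \<in> uminus ` homologous_rel_set 1 X {} c" for c x
      unfolding image_iff by (metis (no_types) add.inverse_inverse mem_Collect_eq)
    then show ?thesis by blast
  qed
  finally show ?thesis
    using inv_relative_homology_group[of "loop_class X \<gamma>" 1 X "{}"] loop_class_carrier[OF cont per0]
    by (simp add: loop_class_def \<sigma>_def \<rho>_def)
qed

text \<open>Serves the reversal of either cycle: inverting a generator leaves the generated subgroup
  unchanged and changes only the sign of its exponent in a relation.\<close>

lemma homology_basis_inv:
  assumes "homology_basis X a b" "a \<in> carrier (homology_group 1 X)" "b \<in> carrier (homology_group 1 X)"
    and "a' = a \<or> a' = inv\<^bsub>homology_group 1 X\<^esub> a" "b' = b \<or> b' = inv\<^bsub>homology_group 1 X\<^esub> b"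
  shows "homology_basis X a' b'"
proof -
  define G where "G = homology_group 1 X"
  interpret comm_group G by (simp add: G_def)
  note [simp] = assms(2,3)[folded G_def]
  have ab': "a' = a \<or> a' = inv\<^bsub>G\<^esub> a" "b' = b \<or> b' = inv\<^bsub>G\<^esub> b" using assms(4,5) by (simp_all add: G_def)
  then have [simp]: "a' \<in> carrier G" "b' \<in> carrier G" by auto
  have "c \<in> generate G {a', b'}" if "c = a \<or> c = b" for c
  proof -
    have "c \<in> {a', b'} \<or> inv\<^bsub>G\<^esub> c \<in> {a', b'}" "c \<in> carrier G" using ab' that by auto
    then show ?thesis using generate.incl[of c "{a', b'}"] generate.inv[of "inv\<^bsub>G\<^esub> c" "{a', b'}" G] by auto
  qed
  then have "generate G {a, b} \<subseteq> generate G {a', b'}"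
    by (intro generate_subgroup_incl generate_is_subgroup) auto
  moreover have "generate G {a', b'} \<subseteq> carrier G" by (rule generate_incl) auto
  moreover have "generate G {a, b} = carrier G"
    using assms(1) unfolding homology_basis_def Let_def G_def by (rule conjunct1)
  ultimately have "generate G {a', b'} = carrier G" by simp
  moreover have "i = 0 \<and> j = 0" if one: "a' [^]\<^bsub>G\<^esub> i \<otimes>\<^bsub>G\<^esub> b' [^]\<^bsub>G\<^esub> j = \<one>\<^bsub>G\<^esub>" for i j :: int
  proof -
    have "\<exists>i'::int. a' [^]\<^bsub>G\<^esub> i = a [^]\<^bsub>G\<^esub> i' \<and> (i' = 0 \<longrightarrow> i = 0)"
      using ab'(1)
    proof
      assume "a' = inv\<^bsub>G\<^esub> a"
      then have "a' [^]\<^bsub>G\<^esub> i = a [^]\<^bsub>G\<^esub> (- i)" by (simp add: int_pow_inv int_pow_neg)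
      then show ?thesis by force
    qed auto
    moreover have "\<exists>j'::int. b' [^]\<^bsub>G\<^esub> j = b [^]\<^bsub>G\<^esub> j' \<and> (j' = 0 \<longrightarrow> j = 0)"
      using ab'(2)
    proof
      assume "b' = inv\<^bsub>G\<^esub> b"
      then have "b' [^]\<^bsub>G\<^esub> j = b [^]\<^bsub>G\<^esub> (- j)" by (simp add: int_pow_inv int_pow_neg)
      then show ?thesis by force
    qed auto
    ultimately obtain i' j' :: int where ij: "a [^]\<^bsub>G\<^esub> i' \<otimes>\<^bsub>G\<^esub> b [^]\<^bsub>G\<^esub> j' = \<one>\<^bsub>G\<^esub>"
        "i' = 0 \<longrightarrow> i = 0" "j' = 0 \<longrightarrow> j = 0"
      using one by metis
    then have "i' = 0 \<and> j' = 0"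
      using assms(1) unfolding homology_basis_def Let_def G_def by (elim conjE) (drule spec, drule spec, erule mp)
    then show ?thesis using ij by blast
  qed
  ultimately show ?thesis by (simp add: homology_basis_def G_def)
qed

text \<open>The map induced on the first homology is an isomorphism, and on the level of chains it
  sends the simplex of a loop to the simplex of its image.\<close>

lemma homology_basis_homeomorphic_image:
  assumes h: "homeomorphic_map X Y h" and b: "homology_basis X (loop_class X \<gamma>) (loop_class X \<delta>)"
    and \<gamma>: "continuous_map euclideanreal X \<gamma>" "\<gamma> 1 = \<gamma> 0"
    and \<delta>: "continuous_map euclideanreal X \<delta>" "\<delta> 1 = \<delta> 0"
  shows "homology_basis Y (loop_class Y (h \<circ> \<gamma>)) (loop_class Y (h \<circ> \<delta>))"
proof -
  define G where "G = homology_group 1 X"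
  define K where "K = homology_group 1 Y"
  define \<phi> where "\<phi> = hom_induced 1 X {} Y {} h"
  have cont: "continuous_map X Y h" using h by (rule homeomorphic_imp_continuous_map)
  have iso: "\<phi> \<in> iso G K"
    unfolding \<phi>_def G_def K_def by (rule homeomorphic_map_homology_iso[OF h])
  interpret G: group G by (simp add: G_def)
  interpret K: group K by (simp add: K_def)
  interpret group_hom G K \<phi> using iso by unfold_locales (simp add: iso_def)
  have inj: "inj_on \<phi> (carrier G)" and surj: "\<phi> ` carrier G = carrier K"
    using iso by (auto simp: iso_def bij_betw_def)
  have img: "\<phi> (loop_class X \<gamma>) = loop_class Y (h \<circ> \<gamma>)"
    if "continuous_map euclideanreal X \<gamma>" "\<gamma> 1 = \<gamma> 0" for \<gamma>
  proof -
    have "\<phi> (loop_class X \<gamma>) = homologous_rel_set 1 Y {}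
        (chain_map 1 h (frag_of (restrict (\<lambda>x. \<gamma> (x 1)) (standard_simplex 1))))"
      unfolding \<phi>_def loop_class_def
      using hom_induced_chain_map[OF cont _ loop_cycle[OF that]] by simp
    moreover have "simplex_map 1 h (restrict (\<lambda>x. \<gamma> (x 1)) (standard_simplex 1))
        = restrict (\<lambda>x. (h \<circ> \<gamma>) (x 1)) (standard_simplex 1)"
      unfolding simplex_map_def by (rule restrict_ext) simp
    ultimately show ?thesis by (simp only: loop_class_def chain_map_of)
  qed
  have mem: "loop_class X \<gamma> \<in> carrier G" "loop_class X \<delta> \<in> carrier G"
    unfolding G_def using loop_class_carrier \<gamma> \<delta> by auto
  have "generate K (\<phi> ` {loop_class X \<gamma>, loop_class X \<delta>}) = carrier K"
  proof -
    have "generate G {loop_class X \<gamma>, loop_class X \<delta>} = carrier G"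
      using b unfolding homology_basis_def Let_def G_def by blast
    moreover have "generate K (\<phi> ` {loop_class X \<gamma>, loop_class X \<delta>})
        = \<phi> ` generate G {loop_class X \<gamma>, loop_class X \<delta>}" by (rule generate_img) (simp add: mem)
    ultimately show ?thesis by (simp only: surj)
  qed
  moreover have "i = 0 \<and> j = 0"
    if "\<phi> (loop_class X \<gamma>) [^]\<^bsub>K\<^esub> i \<otimes>\<^bsub>K\<^esub> \<phi> (loop_class X \<delta>) [^]\<^bsub>K\<^esub> j = \<one>\<^bsub>K\<^esub>" for i j :: int
  proof -
    have "\<phi> (loop_class X \<gamma> [^]\<^bsub>G\<^esub> i \<otimes>\<^bsub>G\<^esub> loop_class X \<delta> [^]\<^bsub>G\<^esub> j) = \<phi> \<one>\<^bsub>G\<^esub>"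
      unfolding hom_mult[OF G.int_pow_closed[OF mem(1)] G.int_pow_closed[OF mem(2)]]
        hom_int_pow[OF mem(1)] hom_int_pow[OF mem(2)] hom_one by (rule that)
    then have "loop_class X \<gamma> [^]\<^bsub>G\<^esub> i \<otimes>\<^bsub>G\<^esub> loop_class X \<delta> [^]\<^bsub>G\<^esub> j = \<one>\<^bsub>G\<^esub>"
      by (rule inj_onD[OF inj]) (intro G.m_closed G.int_pow_closed mem G.one_closed)+
    then show ?thesis using b unfolding homology_basis_def Let_def G_def by blast
  qed
  ultimately show ?thesis
    unfolding homology_basis_def Let_def K_def[symmetric] img[OF \<gamma>, symmetric] img[OF \<delta>, symmetric]
    by simp
qed

section \<open>Hamiltonian flows\<close>

lemma symplectic_formD:
  assumes "symplectic_manifold S" "c \<in> charts S" "p \<in> fst c"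
  shows "bilinear (form S c p)" "(\<And>w. form S c p v w = 0) \<Longrightarrow> v = 0"
proof -
  have "bilinear (form S c p) \<and> (\<forall>v. form S c p v v = 0) \<and>
      (\<forall>v. (\<forall>w. form S c p v w = 0) \<longrightarrow> v = 0)"
    using assms unfolding symplectic_manifold_def by (elim conjE) (drule (1) bspec, drule (1) bspec, assumption)
  then show "bilinear (form S c p)" "(\<And>w. form S c p v w = 0) \<Longrightarrow> v = 0" by auto
qed

text \<open>\<open>hamiltonian_vf\<close> is a definite description; non-degeneracy of the form
  gives the uniqueness it requires.\<close>

lemma hamiltonian_vf_eqI:
  assumes S: "symplectic_manifold S" "c \<in> charts S" "p \<in> fst c"
    and X: "\<And>w. form S c p X w = - differential c h p w"
  shows "hamiltonian_vf S h c p = X"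
  unfolding hamiltonian_vf_def
proof (rule the_equality)
  fix Y assume Y: "\<forall>w. form S c p Y w = - differential c h p w"
  have "form S c p (Y - X) w = 0" for w
    using bilinear_lsub[OF symplectic_formD(1)[OF S]] X Y by simp
  then show "Y = X" using symplectic_formD(2)[OF S] by force
qed (use X in blast)

text \<open>Existence of the vector: pairing v with the basis vectors is a linear map T of the
  tangent space to itself in coordinates, injective by non-degeneracy and hence surjective.\<close>

lemma hamiltonian_vf_char:
  assumes S: "symplectic_manifold S" "c \<in> charts S" "p \<in> fst c"
    and h: "coord_rep c h differentiable (at (snd c p))"
  shows "form S c p (hamiltonian_vf S h c p) w = - differential c h p w"
proof -
  note bl = symplectic_formD(1)[OF S]
  define T where "T v = (\<chi> i. form S c p v (axis i 1))" for v
  have lin: "linear (form S c p v)" for v using bl by (simp add: bilinear_def)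
  have "linear T"
    using bilinear_ladd[OF bl] bilinear_lmul[OF bl]
    by (intro linearI) (simp_all add: T_def vec_eq_iff)
  moreover have "v = 0" if "T v = 0" for v
  proof (rule symplectic_formD(2)[OF S])
    have "form S c p v b = 0" if "b \<in> Basis" for b
      using that \<open>T v = 0\<close> by (auto simp: T_def vec_eq_iff[of "vec_lambda _"] Basis_vec_def)
    then show "form S c p v w = 0" for w
      using linear_eq_stdbasis[OF lin linear_zero] by metis
  qed
  ultimately have "surj T"
    by (intro linear_injective_imp_surjective) (auto simp: linear_injective_0)
  then obtain X where X: "T X = (\<chi> i. - differential c h p (axis i 1))" by (metis surjD)
  have "form S c p X = (\<lambda>w. - differential c h p w)"
  proof (rule linear_eq_stdbasis[OF lin])
    show "linear (\<lambda>w. - differential c h p w)"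
      using differential_linear[OF h] by (rule linear_compose_neg)
    fix b :: "real^4" assume "b \<in> Basis"
    then show "form S c p X b = - differential c h p b"
      using X by (auto simp: T_def vec_eq_iff[of "vec_lambda _"] Basis_vec_def)
  qed
  then have "form S c p X w = - differential c h p w" for w by (rule fun_cong)
  with hamiltonian_vf_eqI[OF S this] show ?thesis by simp
qed

context symplectic_iso
begin

text \<open>A linear map that preserves a non-degenerate form is injective, and both tangent spaces
  have dimension 4.\<close>

lemma jacobian_surj:
  assumes c: "c \<in> charts S" "c' \<in> charts S'" and p: "p \<in> fst c" "f p \<in> fst c'"
  shows "surj (differential c (snd c' \<circ> f) p)"
proof (rule linear_injective_imp_surjective[OF jacobian_linear[OF c p]])
  note bl = symplectic_formD(1)[OF S' c(2) p(2)]
  have "v = 0" if "differential c (snd c' \<circ> f) p v = 0" for v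
    using symplectomorphism_on_form[OF f c UNIV_I p, of v] that bilinear_lzero[OF bl]
      symplectic_formD(2)[OF S c(1) p(1)] by simp
  then show "inj (differential c (snd c' \<circ> f) p)"
    using linear_injective_0[OF jacobian_linear[OF c p]] by blast
qed simp

text \<open>By \<open>jacobian_surj\<close> every test vector is J w, with J the Jacobian. Writing X
  for the field of h, \<omega>'(\<epsilon> J X, J w) = \<epsilon> \<omega>(X, w) = -\<epsilon> dh(w)
  = -dh'(J w).\<close>

lemma hamiltonian_vf_transport:
  assumes c: "c \<in> charts S" "c' \<in> charts S'" and p: "p \<in> fst c" "f p \<in> fst c'"
    and h: "coord_rep c h differentiable (at (snd c p))"
    and h': "coord_rep c' h' differentiable (at (snd c' (f p)))"
    and eq: "\<And>q. h' (f q) = \<epsilon> * h q"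
  shows "hamiltonian_vf S' h' c' (f p) = \<epsilon> *\<^sub>R differential c (snd c' \<circ> f) p (hamiltonian_vf S h c p)"
proof (rule hamiltonian_vf_eqI[OF S' c(2) p(2)])
  let ?J = "differential c (snd c' \<circ> f) p"
  fix w'
  obtain w where w: "w' = ?J w" using jacobian_surj[OF c p] by (metis surjD)
  have "h' \<circ> f = (\<lambda>x. \<epsilon> * x) \<circ> h" using eq by auto
  then have d: "differential c' h' (f p) (?J w) = \<epsilon> * differential c h p w"
    using differential_compose_iso[OF c p h', of w] differential_linear_compose[OF bounded_linear_mult_right h]
    by metis
  have "form S' c' (f p) (\<epsilon> *\<^sub>R ?J (hamiltonian_vf S h c p)) w'
      = \<epsilon> * form S c p (hamiltonian_vf S h c p) w"
    using bilinear_lmul[OF symplectic_formD(1)[OF S' c(2) p(2)]]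
      symplectomorphism_on_form[OF f c UNIV_I p] w by simp
  also have "\<dots> = - differential c' h' (f p) w'"
    using hamiltonian_vf_char[OF S c(1) p(1) h] d w by simp
  finally show "form S' c' (f p) (\<epsilon> *\<^sub>R ?J (hamiltonian_vf S h c p)) w' = - differential c' h' (f p) w'" .
qed

text \<open>Running the curve at speed \<epsilon> multiplies its velocity by \<epsilon>, which is
  the factor in \<open>hamiltonian_vf_transport\<close>.\<close>

lemma integral_curve_transport:
  assumes \<gamma>: "integral_curve S h \<gamma>" and h: "smooth_function (charts S) UNIV h"
    and h': "smooth_function (charts S') UNIV h'" and eq: "\<And>q. h' (f q) = \<epsilon> * h q"
  shows "integral_curve S' h' (\<lambda>t. f (\<gamma> (\<epsilon> * t)))"
  unfolding integral_curve_def
proof (intro conjI allI ballI impI)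
  have \<gamma>c: "continuous_on UNIV \<gamma>" using \<gamma> by (simp add: integral_curve_def)
  have \<gamma>\<epsilon>: "continuous_on UNIV (\<lambda>t. \<gamma> (\<epsilon> * t))"
    by (rule continuous_on_compose2[OF \<gamma>c]) (auto intro!: continuous_intros)
  show "continuous_on UNIV (\<lambda>t. f (\<gamma> (\<epsilon> * t)))"
    by (rule continuous_on_compose2[OF continuous \<gamma>\<epsilon>]) auto
  fix t c' assume c': "c' \<in> charts S'" "f (\<gamma> (\<epsilon> * t)) \<in> fst c'"
  obtain c where c: "c \<in> charts S" "\<gamma> (\<epsilon> * t) \<in> fst c" using atlas_cover[OF A] by metis
  let ?X = "hamiltonian_vf S h c (\<gamma> (\<epsilon> * t))"
  have "((snd c \<circ> \<gamma>) has_vector_derivative ?X) (at (\<epsilon> * t))"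
    using \<gamma> c by (simp add: integral_curve_def)
  moreover have "((\<lambda>t. \<epsilon> * t) has_vector_derivative \<epsilon>) (at t)"
    by (auto intro!: derivative_eq_intros simp: has_vector_derivative_def)
  ultimately have "((snd c \<circ> (\<lambda>t. \<gamma> (\<epsilon> * t))) has_vector_derivative \<epsilon> *\<^sub>R ?X) (at t)"
    using vector_diff_chain_at[of "\<lambda>t. \<epsilon> * t" \<epsilon> t "snd c \<circ> \<gamma>" ?X] by (simp add: o_def)
  from curve_compose[OF c(1) c'(1) c(2) c'(2) \<gamma>\<epsilon> this]
  have "((snd c' \<circ> (\<lambda>t. f (\<gamma> (\<epsilon> * t)))) has_vector_derivative
      differential c (snd c' \<circ> f) (\<gamma> (\<epsilon> * t)) (\<epsilon> *\<^sub>R ?X)) (at t)" by (simp add: o_def)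
  moreover have "differential c (snd c' \<circ> f) (\<gamma> (\<epsilon> * t)) (\<epsilon> *\<^sub>R ?X)
      = hamiltonian_vf S' h' c' (f (\<gamma> (\<epsilon> * t)))"
    unfolding hamiltonian_vf_transport[OF c(1) c'(1) c(2) c'(2)
        smooth_function_differentiable[OF h c(1) UNIV_I c(2)]
        smooth_function_differentiable[OF h' c'(1) UNIV_I c'(2)] eq]
    by (rule linear_scale[OF jacobian_linear[OF c(1) c'(1) c(2) c'(2)]])
  ultimately show "((snd c' \<circ> (\<lambda>t. f (\<gamma> (\<epsilon> * t)))) has_vector_derivative
      hamiltonian_vf S' h' c' (f (\<gamma> (\<epsilon> * t)))) (at t)" by simp
qed

end

section \<open>Sign changes on the plane\<close>

definition plane_reflection :: "real \<Rightarrow> real \<Rightarrow> complex \<Rightarrow> complex" where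
  "plane_reflection \<epsilon>\<^sub>1 \<epsilon>\<^sub>2 z = Complex (\<epsilon>\<^sub>1 * Re z) (\<epsilon>\<^sub>2 * Im z)"

lemma plane_reflection_simps [simp]:
  "Re (plane_reflection \<epsilon>\<^sub>1 \<epsilon>\<^sub>2 z) = \<epsilon>\<^sub>1 * Re z" "Im (plane_reflection \<epsilon>\<^sub>1 \<epsilon>\<^sub>2 z) = \<epsilon>\<^sub>2 * Im z"
  "plane_reflection \<epsilon>\<^sub>1 \<epsilon>\<^sub>2 0 = 0"
  by (simp_all add: plane_reflection_def complex_eq_iff)

lemma bounded_linear_plane_reflection: "bounded_linear (plane_reflection \<epsilon>\<^sub>1 \<epsilon>\<^sub>2)"
  unfolding linear_conv_bounded_linear[symmetric]
  by (rule linearI) (simp_all add: complex_eq_iff algebra_simps)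

locale plane_signs =
  fixes \<epsilon>\<^sub>1 \<epsilon>\<^sub>2 :: real
  assumes signs: "\<epsilon>\<^sub>1 \<in> {-1, 1}" "\<epsilon>\<^sub>2 \<in> {-1, 1}"
begin

abbreviation E :: "complex \<Rightarrow> complex" where "E \<equiv> plane_reflection \<epsilon>\<^sub>1 \<epsilon>\<^sub>2"

lemma sign_squares [simp]: "\<epsilon>\<^sub>1 * \<epsilon>\<^sub>1 = 1" "\<epsilon>\<^sub>2 * \<epsilon>\<^sub>2 = 1" "\<epsilon>\<^sub>1 * (\<epsilon>\<^sub>1 * x) = x" "\<epsilon>\<^sub>2 * (\<epsilon>\<^sub>2 * x) = x"
  using signs by auto

lemma E_E [simp]: "E (E z) = z"
  by (simp add: complex_eq_iff)

lemma E_eq_iff [simp]: "E z = E w \<longleftrightarrow> z = w"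
  by (metis E_E)

lemma E_eq_0_iff [simp]: "E z = 0 \<longleftrightarrow> z = 0"
  by (metis E_E plane_reflection_simps(3))

text \<open>E is an involution. Images occur in the definitions, whereas openness and smoothness are
  handled through inverse images.\<close>

lemma image_E: "E ` X = E -` X"
  by (force simp: image_iff)

lemma continuous_on_E: "continuous_on X E"
  by (rule linear_continuous_on[OF bounded_linear_plane_reflection])

lemma open_vimage_E: "open X \<Longrightarrow> open (E -` X)"
  by (rule open_vimage[OF _ continuous_on_E])

lemma vertical_ray_E: "E z \<in> vertical_ray \<sigma> \<longleftrightarrow> z \<in> vertical_ray (\<epsilon>\<^sub>2 * \<sigma>)"
  using signs by (auto simp: vertical_ray_def)

lemma smooth_on_compose_E: "smooth_on V f \<Longrightarrow> smooth_on (E -` V) (f \<circ> E)"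
  by (rule smooth_on_compose[OF smooth_on_bounded_linear[OF bounded_linear_plane_reflection
        open_vimage_E[OF smooth_on_open]]]) auto

text \<open>Conjugating the inverse of \<rho> by E inverts the conjugate of \<rho>, so both
  smoothness conditions come from the single fact \<open>conj\<close>.\<close>

lemma diffeo_on_conjugate:
  assumes "diffeo_on D \<rho>"
  shows "diffeo_on (E ` D) (E \<circ> \<rho> \<circ> E)"
proof -
  have sm: "smooth_on D \<rho>" and inj: "inj_on \<rho> D" and inv: "smooth_on (\<rho> ` D) (inv_into D \<rho>)"
    using assms by (auto simp: diffeo_on_def)
  have conj: "smooth_on (E -` V) (E \<circ> f \<circ> E)" if "smooth_on V f" for V f
    using smooth_on_linear_compose[OF bounded_linear_plane_reflection smooth_on_compose_E[OF that]]
    by (simp add: o_def)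
  have inj': "inj_on (E \<circ> \<rho> \<circ> E) (E ` D)" using inj by (auto simp: inj_on_def)
  have "(E \<circ> \<rho> \<circ> E) ` E ` D = E -` \<rho> ` D" by (simp add: image_image flip: image_E)
  moreover have "smooth_on (E -` \<rho> ` D) (inv_into (E ` D) (E \<circ> \<rho> \<circ> E))"
  proof (rule smooth_on_cong[OF conj[OF inv]])
    fix x assume "x \<in> E -` \<rho> ` D"
    then obtain y where y: "y \<in> D" "x = E (\<rho> y)" by (metis E_E imageE vimageE)
    then have "inv_into (E ` D) (E \<circ> \<rho> \<circ> E) x = E y" using inj' by (intro inv_into_f_eq) auto
    then show "(E \<circ> inv_into D \<rho> \<circ> E) x = inv_into (E ` D) (E \<circ> \<rho> \<circ> E) x"
      using y inj by simp
  qed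
  ultimately show ?thesis
    using conj[OF sm] inj' by (simp add: diffeo_on_def image_E)
qed

text \<open>Each occurrence of E contributes a factor \<open>\<epsilon>\<^sub>2\<close>: the inner
  one through the direction \<i>, the outer one through the imaginary part. They cancel, so the
  positivity of the derivative in h survives.\<close>

lemma dir_deriv_conjugate:
  assumes "\<rho> differentiable (at w)"
  shows "Im (dir_deriv \<i> (E \<circ> \<rho> \<circ> E) (E w)) = Im (dir_deriv \<i> \<rho> w)"
proof -
  have "(E has_derivative E) (at (E w))"
    by (rule bounded_linear_imp_has_derivative[OF bounded_linear_plane_reflection])
  moreover have "(\<rho> has_derivative (\<lambda>v. dir_deriv v \<rho> w)) (at (E (E w)))"
    using has_derivative_dir_deriv[OF assms] by simp
  ultimately have "((\<lambda>x. \<rho> (E x)) has_derivative (\<lambda>v. dir_deriv (E v) \<rho> w)) (at (E w))"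
    by (rule has_derivative_compose)
  then have "((\<lambda>x. E (\<rho> (E x))) has_derivative (\<lambda>v. E (dir_deriv (E v) \<rho> w))) (at (E w))"
    by (rule bounded_linear.has_derivative[OF bounded_linear_plane_reflection])
  then have "dir_deriv \<i> (E \<circ> \<rho> \<circ> E) (E w) = E (dir_deriv (E \<i>) \<rho> w)"
    unfolding o_def by (rule dir_deriv_eq)
  also have "E \<i> = \<epsilon>\<^sub>2 *\<^sub>R \<i>" by (simp add: complex_eq_iff)
  also have "dir_deriv (\<epsilon>\<^sub>2 *\<^sub>R \<i>) \<rho> w = \<epsilon>\<^sub>2 *\<^sub>R dir_deriv \<i> \<rho> w"
    by (rule linear_scale[OF linear_dir_deriv[OF assms]])
  finally show ?thesis by (simp del: o_apply)
qed

text \<open>A determination of the logarithm is conjugated when the orientation of the plane is reversed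
  and shifted by \<open>\<i>\<pi>\<close> when \<open>l\<close> changes sign; the shift produces the term \<open>\<pi> l\<close>.\<close>

lemma log_determination_reflect:
  assumes "log_determination (vertical_ray \<sigma>) lg"
  obtains lg' where "log_determination (vertical_ray (\<epsilon>\<^sub>2 * \<sigma>)) lg'"
    "\<And>z. Im (z * lg' z - z) = \<epsilon>\<^sub>2 * Im (E z * lg (E z) - E z) + (1 - \<epsilon>\<^sub>1) / 2 * pi * Re z"
proof -
  have cont: "continuous_on (- vertical_ray \<sigma>) lg" and ex: "\<And>z. z \<notin> vertical_ray \<sigma> \<Longrightarrow> exp (lg z) = z"
    using assms by (auto simp: log_determination_def)
  have contE: "continuous_on (- vertical_ray (\<epsilon>\<^sub>2 * \<sigma>)) (\<lambda>z. lg (E z))"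
    by (rule continuous_on_compose2[OF cont continuous_on_E]) (auto simp: vertical_ray_E)
  define lg' where "lg' z = (if \<epsilon>\<^sub>1 = \<epsilon>\<^sub>2 then lg (E z) else cnj (lg (E z))) + (if \<epsilon>\<^sub>1 = 1 then 0 else \<i> * pi)" for z
  have "continuous_on (- vertical_ray (\<epsilon>\<^sub>2 * \<sigma>)) lg'"
  proof -
    have "continuous_on (- vertical_ray (\<epsilon>\<^sub>2 * \<sigma>)) (\<lambda>z. if \<epsilon>\<^sub>1 = \<epsilon>\<^sub>2 then lg (E z) else cnj (lg (E z)))"
      using contE continuous_on_cnj[OF contE] by (cases "\<epsilon>\<^sub>1 = \<epsilon>\<^sub>2") (simp_all only: if_True if_False refl)
    then show ?thesis unfolding lg'_def by (rule continuous_on_add) (rule continuous_on_const)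
  qed
  moreover have "exp (lg' z) = z" if "z \<notin> vertical_ray (\<epsilon>\<^sub>2 * \<sigma>)" for z
  proof -
    have "exp (lg (E z)) = E z" using ex that by (simp add: vertical_ray_E)
    then have "exp (lg' z) = (if \<epsilon>\<^sub>1 = \<epsilon>\<^sub>2 then E z else cnj (E z)) * (if \<epsilon>\<^sub>1 = 1 then 1 else -1)"
      by (auto simp: lg'_def exp_add exp_cnj[symmetric] mult.commute)
    then show ?thesis using signs by (auto simp: complex_eq_iff)
  qed
  \<comment> \<open>Apart from the shift, z times the new logarithm is E(z) times the old one up to
    the factor \<open>\<epsilon>\<^sub>1\<close> and, for unequal signs, a conjugation; in either
    case the imaginary part acquires the factor \<open>\<epsilon>\<^sub>2\<close>.\<close>
  moreover have "Im (z * lg' z - z) = \<epsilon>\<^sub>2 * Im (E z * lg (E z) - E z) + (1 - \<epsilon>\<^sub>1) / 2 * pi * Re z" for z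
    using signs by (auto simp: lg'_def algebra_simps)
  ultimately show ?thesis using that by (auto simp: log_determination_def)
qed

subsection \<open>Taylor series\<close>

lemma smooth_on_dir_deriv_iterate: "smooth_on V F \<Longrightarrow> smooth_on V ((dir_deriv v ^^ n) F)"
  by (induction n) (auto intro: smooth_on_dir_deriv)

text \<open>One differentiation step for \<open>taylor_series_reflect\<close>: an eigenvector v of E
  contributes its eigenvalue \<epsilon>, and L is what is left of the linear term. The formula is
  obtained on the whole inverse image of V, so that it can be iterated.\<close>

lemma dir_deriv_reflect:
  fixes F :: "complex \<Rightarrow> real"
  assumes F: "smooth_on V F" and v: "E v = \<epsilon> *\<^sub>R v" and z: "z \<in> E -` V"
    and f: "\<And>z. z \<in> E -` V \<Longrightarrow> f z = k * F (E z) + c * L z"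
    and L: "(L has_derivative L') (at z)"
  shows "dir_deriv v f z = k * \<epsilon> * dir_deriv v F (E z) + c * L' v"
proof -
  have Fd: "F differentiable (at (E z))" using z by (intro smooth_onD[OF F]) auto
  have "(E has_derivative E) (at z)"
    by (rule bounded_linear_imp_has_derivative[OF bounded_linear_plane_reflection])
  from has_derivative_compose[OF this has_derivative_dir_deriv[OF Fd]]
  have "((\<lambda>z. k * F (E z) + c * L z) has_derivative (\<lambda>v. k * dir_deriv (E v) F (E z) + c * L' v)) (at z)"
    using L by (auto intro!: derivative_eq_intros)
  then have "dir_deriv v (\<lambda>z. k * F (E z) + c * L z) z = k * dir_deriv (E v) F (E z) + c * L' v"
    by (rule dir_deriv_eq)
  moreover have "dir_deriv (E v) F (E z) = \<epsilon> * dir_deriv v F (E z)"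
    unfolding v using linear_scale[OF linear_dir_deriv[OF Fd]] by simp
  moreover have "dir_deriv v f z = dir_deriv v (\<lambda>z. k * F (E z) + c * L z) z"
    by (rule dir_deriv_cong[OF open_vimage_E[OF smooth_on_open[OF F]] z f])
  ultimately show ?thesis by simp
qed

lemma taylor_series_reflect:
  assumes S: "smooth_on V S" "0 \<in> V"
  shows "taylor_series (\<lambda>z. \<epsilon>\<^sub>2 * S (E z) + c * Re z)
    = fps_real \<epsilon>\<^sub>2 * fps_scale_args \<epsilon>\<^sub>1 \<epsilon>\<^sub>2 (taylor_series S) + fps_real c * fps_l"
proof -
  define f where "f z = \<epsilon>\<^sub>2 * S (E z) + c * Re z" for z
  have E1: "E 1 = \<epsilon>\<^sub>1 *\<^sub>R 1" and Ei: "E \<i> = \<epsilon>\<^sub>2 *\<^sub>R \<i>" by (simp_all add: complex_eq_iff)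
  have Re': "(Re has_derivative Re) (at z)" for z
    by (rule bounded_linear_imp_has_derivative[OF bounded_linear_Re])
  have b: "(dir_deriv \<i> ^^ b) f z = \<epsilon>\<^sub>2 * \<epsilon>\<^sub>2 ^ b * (dir_deriv \<i> ^^ b) S (E z) + c * (if b = 0 then Re z else 0)"
    if "z \<in> E -` V" for b z
    using that
  proof (induction b arbitrary: z)
    case 0
    then show ?case by (simp add: f_def)
  next
    case (Suc b)
    have "((\<lambda>z. if b = 0 then Re z else 0) has_derivative (\<lambda>v. if b = 0 then Re v else 0)) (at z)"
      by (cases "b = 0") (simp_all add: Re')
    from dir_deriv_reflect[OF smooth_on_dir_deriv_iterate[OF S(1)] Ei Suc.prems Suc.IH this]
    show ?case by simp
  qed
  \<comment> \<open>The correction is c l, then c, then 0 as a grows, and it is already 0 after one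
    derivative in j.\<close>
  have ab: "(dir_deriv 1 ^^ a) ((dir_deriv \<i> ^^ b) f) z
      = \<epsilon>\<^sub>2 * \<epsilon>\<^sub>2 ^ b * \<epsilon>\<^sub>1 ^ a * (dir_deriv 1 ^^ a) ((dir_deriv \<i> ^^ b) S) (E z)
        + c * (if b = 0 then (if a = 0 then Re z else if a = 1 then 1 else 0) else 0)"
    if "z \<in> E -` V" for a b z
    using that
  proof (induction a arbitrary: z)
    case 0
    then show ?case by (simp add: b)
  next
    case (Suc a)
    have "((\<lambda>z. if b = 0 then (if a = 0 then Re z else if a = 1 then 1 else 0) else 0)
        has_derivative (\<lambda>v. if b = 0 \<and> a = 0 then Re v else 0)) (at z)"
      by (cases "b = 0"; cases "a = 0"; cases "a = 1") (simp_all add: Re')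
    from dir_deriv_reflect[OF smooth_on_dir_deriv_iterate[OF smooth_on_dir_deriv_iterate[OF S(1)]]
        E1 Suc.prems Suc.IH this]
    show ?case by simp
  qed
  have "fps_nth (fps_nth (taylor_series f) b) a
    = fps_nth (fps_nth (fps_real \<epsilon>\<^sub>2 * fps_scale_args \<epsilon>\<^sub>1 \<epsilon>\<^sub>2 (taylor_series S) + fps_real c * fps_l) b) a"
    for a b
    using ab[of 0 a b] S(2)
    by (cases "a = 1") (auto simp: taylor_series_def fps_scale_args_def fps_real_def fps_l_def add_divide_distrib)
  then show ?thesis by (simp add: fps_eq_iff f_def[abs_def])
qed

text \<open>Makes the transformation surjective between cosets: j is the shift of r T needed to hit
  a prescribed element of the coset of T.\<close>

lemma fps_reflect_involution:
  fixes T :: "real fps fps"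
  defines "r \<equiv> \<lambda>T. fps_real \<epsilon>\<^sub>2 * fps_scale_args \<epsilon>\<^sub>1 \<epsilon>\<^sub>2 T + fps_real ((1 - \<epsilon>\<^sub>1) / 2 * pi) * fps_l"
  shows "\<exists>j::int. r (r T + of_int j * fps_real (2 * pi) * fps_l) = T + of_int k * fps_real (2 * pi) * fps_l"
proof -
  have int: "of_int i = fps_const (fps_const (real_of_int i))" for i
    by (simp add: fps_of_int)
  \<comment> \<open>The solution of \<open>\<epsilon>\<^sub>1 * \<epsilon>\<^sub>2\<close> 2\<pi> j
    + (1 + \<open>\<epsilon>\<^sub>1 * \<epsilon>\<^sub>2\<close>) c = 2\<pi> k, where c is \<pi>
    for \<open>\<epsilon>\<^sub>1 = -1\<close> and 0 otherwise.\<close>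
  define j :: int where "j = (if \<epsilon>\<^sub>1 = \<epsilon>\<^sub>2 \<and> \<epsilon>\<^sub>1 = 1 then k else if \<epsilon>\<^sub>1 = \<epsilon>\<^sub>2 then k - 1 else - k)"
  have "fps_nth (fps_nth (r (r T + of_int j * fps_real (2 * pi) * fps_l)) b) a
      = fps_nth (fps_nth (T + of_int k * fps_real (2 * pi) * fps_l) b) a" for a b
  proof -
    have 1: "\<epsilon>\<^sub>1 ^ a * \<epsilon>\<^sub>1 ^ a = 1" "\<epsilon>\<^sub>2 ^ b * \<epsilon>\<^sub>2 ^ b = 1"
      by (simp_all flip: power_mult_distrib)
    show ?thesis
      using signs 1 unfolding int
      by (auto simp: r_def fps_scale_args_def fps_real_def fps_l_def j_def algebra_simps)
  qed
  then show ?thesis by (auto simp: fps_eq_iff intro!: exI[of _ j])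
qed

text \<open>The transformation descends to the quotient: a shift by 2\<pi> j l comes out multiplied
  by \<open>\<epsilon>\<^sub>1 * \<epsilon>\<^sub>2\<close>, again an integer multiple of 2\<pi>
  l.\<close>

lemma fps_reflect_shift:
  fixes T :: "real fps fps"
  defines "r \<equiv> \<lambda>T. fps_real \<epsilon>\<^sub>2 * fps_scale_args \<epsilon>\<^sub>1 \<epsilon>\<^sub>2 T + fps_real ((1 - \<epsilon>\<^sub>1) / 2 * pi) * fps_l"
  shows "\<exists>k::int. r (T + of_int j * fps_real (2 * pi) * fps_l) = r T + of_int k * fps_real (2 * pi) * fps_l"
proof -
  have int: "of_int i = fps_const (fps_const (real_of_int i))" for i
    by (simp add: fps_of_int)
  define k where "k = \<epsilon>\<^sub>1 * \<epsilon>\<^sub>2 * j"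
  have "\<exists>i::int. real_of_int i = k"
    using signs by (auto simp: k_def intro: exI[of _ j] exI[of _ "- j"])
  then obtain i :: int where i: "real_of_int i = k" by blast
  have "fps_nth (fps_nth (r (T + of_int j * fps_real (2 * pi) * fps_l)) b) a
      = fps_nth (fps_nth (r T + of_int i * fps_real (2 * pi) * fps_l) b) a" for a b
    using signs unfolding int i
    by (auto simp: r_def fps_scale_args_def fps_real_def fps_l_def k_def algebra_simps)
  then show ?thesis by (auto simp: fps_eq_iff intro!: exI[of _ i])
qed

end

section \<open>Symmetries of the focus-focus model\<close>

lemma R4_simps:
  "charts R4 = {(UNIV, id)}" "coord_rep (UNIV, id) h = h" "differential (UNIV, id) h p v = dir_deriv v h p"
  by (simp_all add: R4_def coord_rep_def differential_dir_deriv)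

lemma smooth_atlas_R4: "smooth_atlas (charts R4)"
  unfolding smooth_atlas_def R4_simps
  by (auto simp: R4_simps homeomorphism_def continuous_on_id id_def[symmetric]
      intro!: smooth_on_bounded_linear bounded_linear_ident[folded id_def])

text \<open>A linear map is its own derivative and the form of \<open>R4\<close> is constant, so
  invariance reduces to an identity between vectors.\<close>

lemma symplectomorphism_on_R4_linear:
  assumes "bounded_linear g" "bounded_linear h" "\<And>x. h (g x) = x" "\<And>x. g (h x) = x"
    and "\<And>c p q v w. form R4 c p (g v) (g w) = form R4 c q v w"
  shows "symplectomorphism_on R4 UNIV R4 UNIV g"
proof -
  have "inv_into UNIV g = h" using assms(3,4) by (intro inv_equality) auto
  moreover have "smooth_map (charts R4) UNIV (charts R4) L" if "bounded_linear L" for L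
    using that by (auto simp: smooth_map_def R4_simps linear_continuous_on intro: smooth_on_bounded_linear)
  moreover have "dir_deriv v g p = g v" for v p
    by (rule dir_deriv_eq[OF bounded_linear_imp_has_derivative[OF assms(1)]])
  moreover have "bij g" using assms(3,4) by (metis bijI')
  ultimately show ?thesis
    using assms by (auto simp: symplectomorphism_on_def R4_simps)
qed

lemma symplectomorphism_on_R4_id: "symplectomorphism_on R4 UNIV R4 UNIV id"
  by (rule symplectomorphism_on_R4_linear[of _ id]) (auto simp: id_def R4_def bounded_linear_ident)

lemma vector_4:
  "(vector [a, b, c, d] :: ('a::zero)^4) $ 1 = a" "(vector [a, b, c, d] :: ('a::zero)^4) $ 2 = b"
  "(vector [a, b, c, d] :: ('a::zero)^4) $ 3 = c" "(vector [a, b, c, d] :: ('a::zero)^4) $ 4 = d"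
  by (simp_all add: vector_def)

lemma ff_model_swap:
  "\<exists>g. symplectomorphism_on R4 UNIV R4 UNIV g \<and> g 0 = 0 \<and>
     (\<forall>x. ff_model (g x) = plane_reflection (-1) 1 (ff_model x))"
proof (intro exI conjI allI)
  define g :: "real^4 \<Rightarrow> real^4" where "g x = vector [x$2, x$1, x$4, x$3]" for x
  have bl: "bounded_linear g"
    unfolding linear_conv_bounded_linear[symmetric]
    by (rule linearI) (simp_all add: g_def vec_eq_iff forall_4 vector_4)
  show "symplectomorphism_on R4 UNIV R4 UNIV g"
    by (rule symplectomorphism_on_R4_linear[OF bl bl]) (simp_all add: g_def vec_eq_iff forall_4 vector_4 R4_def)
  show "g 0 = 0" by (simp add: g_def vec_eq_iff forall_4 vector_4)
  show "ff_model (g x) = plane_reflection (-1) 1 (ff_model x)" for x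
    by (simp add: g_def ff_model_def vector_4 plane_reflection_def algebra_simps)
qed

lemma ff_model_rotate:
  "\<exists>g. symplectomorphism_on R4 UNIV R4 UNIV g \<and> g 0 = 0 \<and>
     (\<forall>x. ff_model (g x) = plane_reflection 1 (-1) (ff_model x))"
proof (intro exI conjI allI)
  define g :: "real^4 \<Rightarrow> real^4" where "g x = vector [- x$3, - x$4, x$1, x$2]" for x
  \<comment> \<open>The square of g is -1, so unlike the exchange of indices g needs a separate
    inverse.\<close>
  define h :: "real^4 \<Rightarrow> real^4" where "h x = vector [x$3, x$4, - x$1, - x$2]" for x
  have bl: "bounded_linear g" "bounded_linear h"
    unfolding linear_conv_bounded_linear[symmetric]
    by (rule linearI; simp add: g_def h_def vec_eq_iff forall_4 vector_4)+
  show "symplectomorphism_on R4 UNIV R4 UNIV g"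
    by (rule symplectomorphism_on_R4_linear[OF bl]) (simp_all add: g_def h_def vec_eq_iff forall_4 vector_4 R4_def)
  show "g 0 = 0" by (simp add: g_def vec_eq_iff forall_4 vector_4)
  show "ff_model (g x) = plane_reflection 1 (-1) (ff_model x)" for x
    by (simp add: g_def ff_model_def vector_4 plane_reflection_def algebra_simps)
qed

text \<open>The signs are treated one at a time: E is the product of two single reflections, with
  the identity standing in for a sign +1.\<close>

lemma (in plane_signs) ff_model_symmetry:
  "\<exists>g. symplectomorphism_on R4 UNIV R4 UNIV g \<and> g 0 = 0 \<and> (\<forall>x. ff_model (g x) = E (ff_model x))"
proof -
  have id: "\<exists>g. symplectomorphism_on R4 UNIV R4 UNIV g \<and> g 0 = 0 \<and>
      (\<forall>x. ff_model (g x) = plane_reflection 1 1 (ff_model x))"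
    by (rule exI[of _ id]) (simp add: symplectomorphism_on_R4_id plane_reflection_def)
  obtain g where g: "symplectomorphism_on R4 UNIV R4 UNIV g" "g 0 = 0"
      "\<And>x. ff_model (g x) = plane_reflection \<epsilon>\<^sub>1 1 (ff_model x)"
    using ff_model_swap id signs(1) by (metis empty_iff insert_iff)
  obtain h where h: "symplectomorphism_on R4 UNIV R4 UNIV h" "h 0 = 0"
      "\<And>x. ff_model (h x) = plane_reflection 1 \<epsilon>\<^sub>2 (ff_model x)"
    using ff_model_rotate id signs(2) by (metis empty_iff insert_iff)
  show ?thesis
  proof (intro exI conjI allI)
    show "symplectomorphism_on R4 UNIV R4 UNIV (g \<circ> h)"
      by (rule symplectomorphism_on_compose[OF smooth_atlas_R4 smooth_atlas_R4 smooth_atlas_R4 h(1) g(1)])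
    show "(g \<circ> h) 0 = 0" using g h by simp
    show "ff_model ((g \<circ> h) x) = E (ff_model x)" for x
      by (simp add: g h complex_eq_iff)
  qed
qed

section \<open>Transport of the Taylor series invariant\<close>

lemma smooth_family_open: 
  assumes "smooth_atlas A" "smooth_family D A g"
  shows "open D"
proof -
  have "\<exists>c\<in>A. g x \<in> fst c" for x using atlas_cover[OF assms(1)] by metis
  then have "D = (\<Union>c\<in>A. D \<inter> g -` fst c)" by blast
  moreover have "open (D \<inter> g -` fst c)" if "c \<in> A" for c
    using assms(2) that by (auto simp: smooth_family_def intro: smooth_on_open)
  ultimately show ?thesis by (metis (no_types, lifting) open_UN)
qed

text \<open>Restriction to a fixed z supplies the continuity and the differentiability in charts
  that the lemmas on loop integrals ask for.\<close>

lemma smooth_family_slice: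
  assumes A: "smooth_atlas A" and g: "smooth_family (B \<times> UNIV) A (\<lambda>(z, t). \<gamma> z t)" and z: "z \<in> B"
  shows "continuous_on UNIV (\<gamma> z)"
    "c \<in> A \<Longrightarrow> \<gamma> z t \<in> fst c \<Longrightarrow> (snd c \<circ> \<gamma> z) differentiable (at t)"
proof -
  have "continuous_on UNIV ((\<lambda>(z, t). \<gamma> z t) \<circ> Pair z)"
    using g z by (intro continuous_on_compose)
      (auto simp: smooth_family_def intro!: continuous_intros intro: continuous_on_subset)
  then show "continuous_on UNIV (\<gamma> z)" by (simp add: o_def)
  assume c: "c \<in> A" "\<gamma> z t \<in> fst c"
  have "smooth_on ((B \<times> UNIV) \<inter> (\<lambda>(z, t). \<gamma> z t) -` fst c) (snd c \<circ> (\<lambda>(z, t). \<gamma> z t))"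
    using g c by (simp add: smooth_family_def)
  then have "(snd c \<circ> (\<lambda>(z, t). \<gamma> z t)) differentiable (at (z, t))"
    by (rule smooth_onD) (use z c in auto)
  moreover have "Pair z differentiable (at t)"
    by (rule differentiableI) (auto intro!: derivative_eq_intros)
  ultimately have "((snd c \<circ> (\<lambda>(z, t). \<gamma> z t)) \<circ> Pair z) differentiable (at t)"
    by (intro differentiable_chain_at)
  then show "(snd c \<circ> \<gamma> z) differentiable (at t)" by (simp add: o_def)
qed

lemma taylor_series_invariant_iff:
  "X \<in> taylor_series_invariant M m \<longleftrightarrow>
     (\<exists>T k. taylor_representative M m T \<and> X = T + of_int k * fps_real (2 * pi) * fps_l)"
  by (auto simp: taylor_series_invariant_def coset_2pi_l_def)

lemma open_Times_UNIV_iff: "open (B \<times> (UNIV :: 'b::topological_space set)) \<longleftrightarrow> open B"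
proof
  assume "open (B \<times> (UNIV :: 'b set))"
  then have "open ((\<lambda>z. (z, undefined)) -` (B \<times> (UNIV :: 'b set)))"
    by (rule open_vimage) (intro continuous_intros)
  then show "open B" by (simp add: vimage_def)
qed (simp add: open_Times)

text \<open>The setting is symmetric: by \<open>inverse_iso\<close> the inverse map satisfies it
  with the same signs, since each sign is its own inverse. The transport lemmas are thus available
  in both directions.\<close>

locale integrable_iso = plane_signs \<epsilon>\<^sub>1 \<epsilon>\<^sub>2 + symplectic_iso M M' \<Phi>
  for \<epsilon>\<^sub>1 \<epsilon>\<^sub>2 :: real
    and M :: "'a::{t2_space,second_countable_topology} integrable_data"
    and M' :: "'b::{t2_space,second_countable_topology} integrable_data"
    and \<Phi> :: "'a \<Rightarrow> 'b" +
  assumes smooth_momentum: "smooth_function (charts M) UNIV (momentum M)"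
      "smooth_function (charts M') UNIV (momentum M')"
    and ham_L: "\<And>p. ham_L M' (\<Phi> p) = \<epsilon>\<^sub>1 * ham_L M p"
    and ham_H: "\<And>p. ham_H M' (\<Phi> p) = \<epsilon>\<^sub>2 * ham_H M p"
begin

abbreviation \<Psi> :: "'b \<Rightarrow> 'a" where "\<Psi> \<equiv> inv_into UNIV \<Phi>"

lemma inverse [simp]: "\<Psi> (\<Phi> p) = p" "\<Phi> (\<Psi> q) = q"
  using bij by (simp_all add: bij_is_inj bij_is_surj surj_f_inv_f)

lemma image_eq: "\<Phi> ` X = \<Psi> -` X"
  by (force simp: image_iff)

lemma momentum_transport [simp]: "momentum M' (\<Phi> p) = E (momentum M p)"
  by (simp add: momentum_def plane_reflection_def ham_L ham_H)

lemma inverse_iso: "integrable_iso \<epsilon>\<^sub>1 \<epsilon>\<^sub>2 M' M \<Psi>"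
proof unfold_locales
  show "symplectomorphism_on M' UNIV M UNIV \<Psi>"
    by (rule symplectomorphism_on_inverse[OF A A' f])
  fix q
  show "ham_L M (\<Psi> q) = \<epsilon>\<^sub>1 * ham_L M' q" using ham_L[of "\<Psi> q"] by simp
  show "ham_H M (\<Psi> q) = \<epsilon>\<^sub>2 * ham_H M' q" using ham_H[of "\<Psi> q"] by simp
qed (use S S' smooth_momentum signs in auto)

lemma smooth_ham_L: "smooth_function (charts M) UNIV (ham_L M)" "smooth_function (charts M') UNIV (ham_L M')"
  using smooth_function_linear_compose[OF bounded_linear_Re smooth_momentum(1)]
    smooth_function_linear_compose[OF bounded_linear_Re smooth_momentum(2)]
  by (simp_all add: momentum_def o_def)

text \<open>The Jacobian J of \<Phi> is surjective and satisfies dF' J = E dF, so dF' vanishes with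
  dF. The two charts are those that \<open>rank_at\<close> selects.\<close>

lemma rank_zero_transport:
  assumes "rank_at M m = 0"
  shows "rank_at M' (\<Phi> m) = 0"
proof -
  define c where "c = (SOME c. c \<in> charts M \<and> m \<in> fst c)"
  define c' where "c' = (SOME c. c \<in> charts M' \<and> \<Phi> m \<in> fst c)"
  have c: "c \<in> charts M \<and> m \<in> fst c"
    unfolding c_def by (rule someI_ex) (metis atlas_cover[OF A])
  have c': "c' \<in> charts M' \<and> \<Phi> m \<in> fst c'"
    unfolding c'_def by (rule someI_ex) (metis atlas_cover[OF A'])
  have zero: "differential c (momentum M) m v = 0" for v
    using assms by (auto simp: rank_at_def simp flip: c_def)
  have "differential c' (momentum M') (\<Phi> m) v' = 0" for v'
  proof -
    obtain v where v: "v' = differential c (snd c' \<circ> \<Phi>) m v"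
      using jacobian_surj[of c c' m] c c' by (metis surjD)
    have "differential c' (momentum M') (\<Phi> m) v' = differential c (momentum M' \<circ> \<Phi>) m v"
      unfolding v using c c'
      by (intro differential_compose_iso[symmetric] smooth_function_differentiable[OF smooth_momentum(2)]) auto
    also have "momentum M' \<circ> \<Phi> = E \<circ> momentum M" by auto
    also have "differential c (E \<circ> momentum M) m v = E (differential c (momentum M) m v)"
      using c by (intro differential_linear_compose bounded_linear_plane_reflection
          smooth_function_differentiable[OF smooth_momentum(1)]) auto
    finally show ?thesis by (simp add: zero)
  qed
  then show ?thesis by (auto simp: rank_at_def simp flip: c'_def)
qed

section \<open>Transport of normal forms, fibers and admissible charts\<close>

lemma momentum_image: "momentum M' ` \<Phi> ` U = E ` momentum M ` U"
  by (simp add: image_image)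

lemma conjugate_image: "(E \<circ> \<rho> \<circ> E) ` momentum M' ` \<Phi> ` U = E ` \<rho> ` momentum M ` U"
  by (simp add: image_image)

text \<open>At corresponding points E \<rho> E F' = E \<rho> F = E G \<phi> = G g \<phi>: the inner
  E undoes the signs of F', and the outer one is absorbed by the symmetry g of the model.\<close>

lemma ff_normal_form_transport:
  assumes ff: "ff_normal_form M m U \<phi> \<rho>"
    and g: "symplectomorphism_on R4 UNIV R4 UNIV g" "g 0 = 0" "\<And>x. ff_model (g x) = E (ff_model x)"
  shows "ff_normal_form M' (\<Phi> m) (\<Phi> ` U) (g \<circ> (\<phi> \<circ> \<Psi>)) (E \<circ> \<rho> \<circ> E)"
proof -
  have \<phi>: "symplectomorphism_on M U R4 (\<phi> ` U) \<phi>" using ff by (simp add: ff_normal_form_def)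
  have U: "open U" "open (\<phi> ` U)" using symplectomorphism_onD[OF \<phi>] by auto
  interpret inv: integrable_iso \<epsilon>\<^sub>1 \<epsilon>\<^sub>2 M' M \<Psi> by (rule inverse_iso)
  have "open (\<Phi> ` U)" unfolding image_eq by (rule open_vimage[OF U(1) inv.continuous])
  then have "symplectomorphism_on M' (\<Phi> ` U) M (\<Psi> ` \<Phi> ` U) \<Psi>"
    by (rule symplectomorphism_on_subset[OF A' A inv.f]) simp
  then have "symplectomorphism_on M' (\<Phi> ` U) M U \<Psi>" by (simp add: image_image)
  then have "symplectomorphism_on M' (\<Phi> ` U) R4 (\<phi> ` U) (\<phi> \<circ> \<Psi>)"
    by (rule symplectomorphism_on_compose[OF A' A smooth_atlas_R4 _ \<phi>])
  moreover have "symplectomorphism_on R4 (\<phi> ` U) R4 (g ` \<phi> ` U) g"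
    by (rule symplectomorphism_on_subset[OF smooth_atlas_R4 smooth_atlas_R4 g(1) U(2)]) simp
  ultimately have "symplectomorphism_on M' (\<Phi> ` U) R4 (g ` \<phi> ` U) (g \<circ> (\<phi> \<circ> \<Psi>))"
    by (rule symplectomorphism_on_compose[OF A' smooth_atlas_R4 smooth_atlas_R4])
  moreover have "g ` \<phi> ` U = (g \<circ> (\<phi> \<circ> \<Psi>)) ` \<Phi> ` U" by (simp add: image_image)
  moreover obtain D where D: "momentum M ` U \<subseteq> D" "diffeo_on D \<rho>" using ff by (auto simp: ff_normal_form_def)
  then have "momentum M' ` \<Phi> ` U \<subseteq> E ` D \<and> diffeo_on (E ` D) (E \<circ> \<rho> \<circ> E)"
    using diffeo_on_conjugate by (auto simp: momentum_image)
  ultimately show ?thesis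
    using ff g unfolding ff_normal_form_def by auto
qed

lemma focus_focus_point_transport:
  assumes "focus_focus_point M m"
  shows "focus_focus_point M' (\<Phi> m)"
proof -
  obtain U \<phi> \<rho> where ff: "ff_normal_form M m U \<phi> \<rho>" and "rank_at M m = 0"
    using assms by (auto simp: focus_focus_point_def)
  obtain g where g: "symplectomorphism_on R4 UNIV R4 UNIV g" "g 0 = 0" "\<And>x. ff_model (g x) = E (ff_model x)"
    using ff_model_symmetry by blast
  show ?thesis
    using ff_normal_form_transport[OF ff g] rank_zero_transport[OF \<open>rank_at M m = 0\<close>]
    unfolding focus_focus_point_def by blast
qed

lemma saturation_iff: "q \<in> saturation M' (\<Phi> ` U) \<longleftrightarrow> \<Psi> q \<in> saturation M U"
  using momentum_transport[of "\<Psi> q"] by (auto simp: saturation_def momentum_image image_iff)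

lemma saturation_transport: "saturation M' (\<Phi> ` U) = \<Psi> -` saturation M U"
  by (auto simp: saturation_iff)

lemma fiber_transport: "fiber M' (\<Phi> ` U) (E \<circ> \<rho> \<circ> E) z = \<Phi> ` fiber M U \<rho> (E z)"
proof -
  have "q \<in> fiber M' (\<Phi> ` U) (E \<circ> \<rho> \<circ> E) z \<longleftrightarrow> \<Psi> q \<in> fiber M U \<rho> (E z)" for q
  proof -
    have "E (\<rho> (E (momentum M' q))) = z \<longleftrightarrow> \<rho> (momentum M (\<Psi> q)) = E z"
      using momentum_transport[of "\<Psi> q"] by (metis E_E inverse(2))
    then show ?thesis unfolding fiber_def mem_Collect_eq saturation_iff o_apply by simp
  qed
  then show ?thesis unfolding image_eq[of "fiber M U \<rho> (E z)"] by blast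
qed

text \<open>Transfers to the image fibers both the torus condition and the bases of the first
  homology.\<close>

lemma homeomorphic_map_restrict:
  "homeomorphic_map (top_of_set X) (top_of_set (\<Phi> ` X)) \<Phi>"
proof -
  interpret inv: integrable_iso \<epsilon>\<^sub>1 \<epsilon>\<^sub>2 M' M \<Psi> by (rule inverse_iso)
  have "homeomorphic_maps (top_of_set X) (top_of_set (\<Phi> ` X)) \<Phi> \<Psi>"
    unfolding homeomorphic_maps_def
    using continuous inv.continuous by (auto simp: continuous_map_subtopology_eu)
  then show ?thesis by (rule homeomorphic_maps_imp_map)
qed

lemma admissible_chart_transport:
  assumes ch: "admissible_chart M m U \<phi> \<rho>"
    and g: "symplectomorphism_on R4 UNIV R4 UNIV g" "g 0 = 0" "\<And>x. ff_model (g x) = E (ff_model x)"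
  shows "admissible_chart M' (\<Phi> m) (\<Phi> ` U) (g \<circ> (\<phi> \<circ> \<Psi>)) (E \<circ> \<rho> \<circ> E)"
  unfolding admissible_chart_def
proof (intro conjI ballI)
  have ff: "ff_normal_form M m U \<phi> \<rho>" using ch by (simp add: admissible_chart_def)
  show "ff_normal_form M' (\<Phi> m) (\<Phi> ` U) (g \<circ> (\<phi> \<circ> \<Psi>)) (E \<circ> \<rho> \<circ> E)"
    by (rule ff_normal_form_transport[OF ff g])
  fix w assume "w \<in> momentum M' ` \<Phi> ` U"
  then obtain w0 where w0: "w0 \<in> momentum M ` U" "w = E w0" by (auto simp: momentum_image)
  have cond: "Re (\<rho> w0) = Re w0 - ham_L M m" "Im (dir_deriv \<i> \<rho> w0) > 0"
    using ch w0 by (auto simp: admissible_chart_def)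
  show "Re ((E \<circ> \<rho> \<circ> E) w) = Re w - ham_L M' (\<Phi> m)"
    by (simp add: w0(2) cond(1) ham_L right_diff_distrib)
  obtain D where "momentum M ` U \<subseteq> D" "diffeo_on D \<rho>" using ff by (auto simp: ff_normal_form_def)
  then have "\<rho> differentiable (at w0)" using w0 by (auto simp: diffeo_on_def intro: smooth_onD)
  then show "Im (dir_deriv \<i> (E \<circ> \<rho> \<circ> E) w) > 0"
    using dir_deriv_conjugate cond w0 by simp
next
  fix z assume "z \<in> (E \<circ> \<rho> \<circ> E) ` momentum M' ` \<Phi> ` U - {0}"
  then have "E z \<in> \<rho> ` momentum M ` U - {0}" unfolding conjugate_image by (auto simp: image_E)
  then have "top_of_set (fiber M U \<rho> (E z)) homeomorphic_space
      top_of_set (sphere (0::complex) 1 \<times> sphere (0::complex) 1)"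
    using ch unfolding admissible_chart_def by blast
  moreover have "top_of_set (fiber M U \<rho> (E z)) homeomorphic_space top_of_set (\<Phi> ` fiber M U \<rho> (E z))"
    using homeomorphic_map_restrict homeomorphic_map_imp_homeomorphic_space by blast
  ultimately show "top_of_set (fiber M' (\<Phi> ` U) (E \<circ> \<rho> \<circ> E) z) homeomorphic_space
      top_of_set (sphere (0::complex) 1 \<times> sphere (0::complex) 1)"
    unfolding fiber_transport using homeomorphic_space_sym homeomorphic_space_trans by blast
qed

text \<open>Reversal is written as multiplication of the time by \<open>\<epsilon>\<^sub>2\<close>,
  so that both signs are covered by one linear reparametrization of (z, t).\<close>

definition transport_cycles :: "(complex \<Rightarrow> real \<Rightarrow> 'a) \<Rightarrow> complex \<Rightarrow> real \<Rightarrow> 'b" where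
  "transport_cycles \<gamma> z t = \<Phi> (\<gamma> (E z) (\<epsilon>\<^sub>2 * t))"

lemma transport_cycles_smooth:
  assumes "smooth_family (B \<times> UNIV) (charts M) (\<lambda>(z, t). \<gamma> z t)"
  shows "smooth_family ((E ` B) \<times> UNIV) (charts M') (\<lambda>(z, t). transport_cycles \<gamma> z t)"
proof -
  let ?L = "\<lambda>x. (E (fst x), \<epsilon>\<^sub>2 * snd x)"
  have "bounded_linear ?L"
    by (intro bounded_linear_Pair bounded_linear_compose[OF bounded_linear_plane_reflection bounded_linear_fst]
        bounded_linear_compose[OF bounded_linear_mult_right bounded_linear_snd])
  from smooth_family_linear_reparam[OF assms this]
  have "smooth_family ((E ` B) \<times> UNIV) (charts M) ((\<lambda>(z, t). \<gamma> z t) \<circ> ?L)"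
  proof -
    have "?L -` (B \<times> UNIV) = (E ` B) \<times> UNIV" by (auto simp: image_E)
    then show ?thesis using \<open>smooth_family (?L -` (B \<times> UNIV)) _ _\<close> by simp
  qed
  from smooth_family_compose[OF A smooth_family_open[OF A this] A' this smooth]
  show ?thesis by (simp add: o_def case_prod_unfold transport_cycles_def)
qed

text \<open>Pulling back along \<open>\<Psi>\<close> cancels \<Phi> and leaves the integral over the
  cycle at E(z) with reparametrized time; a reversal contributes the sign.\<close>

lemma action_transport:
  assumes \<alpha>: "primitive_on M W \<alpha>" and z: "E z \<in> B"
    and sm: "smooth_family (B \<times> UNIV) (charts M) (\<lambda>(z, t). \<gamma> z t)"
    and \<gamma>: "\<And>z t. z \<in> B \<Longrightarrow> \<gamma> z t \<in> W" "\<And>z t. z \<in> B \<Longrightarrow> \<gamma> z (t + 1) = \<gamma> z t"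
  shows "action M' (pullback_form M \<Psi> \<alpha>) (transport_cycles \<gamma>) z = \<epsilon>\<^sub>2 * action M \<alpha> \<gamma> (E z)"
proof -
  interpret inv: integrable_iso \<epsilon>\<^sub>1 \<epsilon>\<^sub>2 M' M \<Psi> by (rule inverse_iso)
  have z': "z \<in> E ` B" using z by (simp add: image_E)
  have "loop_integral M' (pullback_form M \<Psi> \<alpha>) (transport_cycles \<gamma> z)
      = loop_integral M \<alpha> (\<Psi> \<circ> transport_cycles \<gamma> z)"
    by (rule inv.loop_integral_pullback[OF \<alpha> smooth_family_slice(1)[OF A' transport_cycles_smooth[OF sm] z'] _
          smooth_family_slice(2)[OF A' transport_cycles_smooth[OF sm] z']])
       (use z \<gamma>(1) in \<open>simp_all add: transport_cycles_def\<close>)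
  also have "\<Psi> \<circ> transport_cycles \<gamma> z = (\<lambda>t. \<gamma> (E z) (\<epsilon>\<^sub>2 * t))"
    by (simp add: transport_cycles_def o_def)
  also have "loop_integral M \<alpha> (\<lambda>t. \<gamma> (E z) (\<epsilon>\<^sub>2 * t)) = \<epsilon>\<^sub>2 * loop_integral M \<alpha> (\<gamma> (E z))"
  proof -
    have "loop_integral M \<alpha> (\<lambda>t. \<gamma> (E z) (- t)) = - loop_integral M \<alpha> (\<gamma> (E z))"
      by (rule loop_integral_reverse[where \<gamma> = "\<gamma> (E z)" and \<alpha> = \<alpha> and S = M, OF primitive_onD(2)[OF \<alpha> _ \<gamma>(1)[OF z]] A
            smooth_family_slice(2)[OF A sm z] \<gamma>(2)[OF z]])
    then show ?thesis using signs(2) by auto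
  qed
  finally show ?thesis by (simp add: action_def)
qed

lemma admissible_cycles_transport:
  assumes cyc: "admissible_cycles M U \<rho> B \<alpha> \<gamma>" and \<alpha>: "primitive_on M (saturation M U) \<alpha>"
  shows "admissible_cycles M' (\<Phi> ` U) (E \<circ> \<rho> \<circ> E) (E ` B) (pullback_form M \<Psi> \<alpha>) (transport_cycles \<gamma>)"
  unfolding admissible_cycles_def
proof (intro conjI ballI allI)
  have sm: "smooth_family (B \<times> UNIV) (charts M) (\<lambda>(z, t). \<gamma> z t)"
    and fib: "\<And>z t. z \<in> B \<Longrightarrow> \<gamma> z t \<in> fiber M U \<rho> z"
    and per: "\<And>z t. z \<in> B \<Longrightarrow> \<gamma> z (t + 1) = \<gamma> z t"
    using cyc by (auto simp: admissible_cycles_def)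
  have sat: "\<And>z t. z \<in> B \<Longrightarrow> \<gamma> z t \<in> saturation M U" using fib by (auto simp: fiber_def)
  have B: "open B" using smooth_family_open[OF A sm] by (simp add: open_Times_UNIV_iff)
  show "smooth_family ((E ` B) \<times> UNIV) (charts M') (\<lambda>(z, t). transport_cycles \<gamma> z t)"
    by (rule transport_cycles_smooth[OF sm])
  fix z assume "z \<in> E ` B"
  then have z: "E z \<in> B" by auto
  show "transport_cycles \<gamma> z t \<in> fiber M' (\<Phi> ` U) (E \<circ> \<rho> \<circ> E) z" for t
    unfolding fiber_transport transport_cycles_def using fib[OF z] by blast
  \<comment> \<open>For \<open>\<epsilon>\<^sub>2 = -1\<close> periodicity is needed at -t - 1,
    where it compares the times -t and -t - 1.\<close>
  show "transport_cycles \<gamma> z (t + 1) = transport_cycles \<gamma> z t" for t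
    using per[OF z, of t] per[OF z, of "- t - 1"] signs(2) by (auto simp: transport_cycles_def)
  show "\<exists>\<gamma>\<^sub>L. integral_curve M' (ham_L M') \<gamma>\<^sub>L \<and> (\<forall>t. \<gamma>\<^sub>L (t + 2 * pi) = \<gamma>\<^sub>L t) \<and>
        range \<gamma>\<^sub>L \<subseteq> fiber M' (\<Phi> ` U) (E \<circ> \<rho> \<circ> E) z \<and>
        homology_basis (top_of_set (fiber M' (\<Phi> ` U) (E \<circ> \<rho> \<circ> E) z))
          (loop_class (top_of_set (fiber M' (\<Phi> ` U) (E \<circ> \<rho> \<circ> E) z)) (\<lambda>t. \<gamma>\<^sub>L (2 * pi * t)))
          (loop_class (top_of_set (fiber M' (\<Phi> ` U) (E \<circ> \<rho> \<circ> E) z)) (transport_cycles \<gamma> z))"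
  proof -
    let ?F = "fiber M U \<rho> (E z)"
    obtain \<gamma>\<^sub>L where L: "integral_curve M (ham_L M) \<gamma>\<^sub>L" "\<And>t. \<gamma>\<^sub>L (t + 2 * pi) = \<gamma>\<^sub>L t" "range \<gamma>\<^sub>L \<subseteq> ?F"
      "homology_basis (top_of_set ?F) (loop_class (top_of_set ?F) (\<lambda>t. \<gamma>\<^sub>L (2 * pi * t)))
          (loop_class (top_of_set ?F) (\<gamma> (E z)))"
      using cyc z unfolding admissible_cycles_def by blast
    \<comment> \<open>Applied to the orbit of L with the sign \<open>\<epsilon>\<^sub>1\<close> and
      to the second cycle with the sign \<open>\<epsilon>\<^sub>2\<close>.\<close>
    have reparam: "loop_class (top_of_set ?F) (\<lambda>t. \<delta> (\<epsilon> * t)) = loop_class (top_of_set ?F) \<delta> \<or>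
        loop_class (top_of_set ?F) (\<lambda>t. \<delta> (\<epsilon> * t))
          = inv\<^bsub>homology_group 1 (top_of_set ?F)\<^esub> (loop_class (top_of_set ?F) \<delta>)"
      "continuous_map euclideanreal (top_of_set ?F) (\<lambda>t. \<delta> (\<epsilon> * t))"
      "\<delta> (\<epsilon> * 1) = \<delta> (\<epsilon> * 0)"
      if "continuous_map euclideanreal (top_of_set ?F) \<delta>" "\<And>t. \<delta> (t + 1) = \<delta> t" "\<epsilon> \<in> {-1, 1}"
      for \<delta> :: "real \<Rightarrow> 'a" and \<epsilon> :: real
    proof -
      show "loop_class (top_of_set ?F) (\<lambda>t. \<delta> (\<epsilon> * t)) = loop_class (top_of_set ?F) \<delta> \<or>
        loop_class (top_of_set ?F) (\<lambda>t. \<delta> (\<epsilon> * t))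
          = inv\<^bsub>homology_group 1 (top_of_set ?F)\<^esub> (loop_class (top_of_set ?F) \<delta>)"
      proof (cases "\<epsilon> = 1")
        case False
        then have "(\<lambda>t. \<delta> (\<epsilon> * t)) = (\<lambda>t. \<delta> (- t))" using that(3) by auto
        then show ?thesis using loop_class_reverse[OF that(1,2)] by (intro disjI2) (simp only:)
      qed simp
      show "continuous_map euclideanreal (top_of_set ?F) (\<lambda>t. \<delta> (\<epsilon> * t))"
        using continuous_map_compose[OF _ that(1), of euclideanreal "\<lambda>t. \<epsilon> * t"]
        by (auto simp: o_def intro!: continuous_intros)
      show "\<delta> (\<epsilon> * 1) = \<delta> (\<epsilon> * 0)"
        using that(2)[of 0] that(2)[of "-1"] that(3) by auto
    qed
    define \<delta> where "\<delta> t = \<gamma>\<^sub>L (2 * pi * t)" for t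
    have "continuous_on UNIV \<gamma>\<^sub>L" using L(1) by (simp add: integral_curve_def)
    then have "continuous_on UNIV \<delta>"
      unfolding \<delta>_def by (rule continuous_on_compose2) (auto intro!: continuous_intros)
    then have \<delta>: "continuous_map euclideanreal (top_of_set ?F) \<delta>"
      using L(3) by (auto simp: continuous_map_in_subtopology \<delta>_def)
    have \<delta>_per: "\<delta> (t + 1) = \<delta> t" for t
      using L(2)[of "2 * pi * t"] by (simp add: \<delta>_def algebra_simps)
    have \<gamma>z: "continuous_map euclideanreal (top_of_set ?F) (\<gamma> (E z))"
      using smooth_family_slice(1)[OF A sm z] fib[OF z] by (auto simp: continuous_map_in_subtopology)
    note \<delta>' = reparam[OF \<delta> \<delta>_per signs(1)] and \<gamma>' = reparam[OF \<gamma>z per[OF z] signs(2)]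
    have "homology_basis (top_of_set ?F) (loop_class (top_of_set ?F) \<delta>) (loop_class (top_of_set ?F) (\<gamma> (E z)))"
      using L(4) by (simp add: \<delta>_def[abs_def])
    then have "homology_basis (top_of_set ?F) (loop_class (top_of_set ?F) (\<lambda>t. \<delta> (\<epsilon>\<^sub>1 * t)))
        (loop_class (top_of_set ?F) (\<lambda>t. \<gamma> (E z) (\<epsilon>\<^sub>2 * t)))"
      by (rule homology_basis_inv[OF _ loop_class_carrier[OF \<delta>] loop_class_carrier[OF \<gamma>z] \<delta>'(1) \<gamma>'(1)])
         (use \<delta>_per[of 0] per[OF z, of 0] in simp_all)
    from homology_basis_homeomorphic_image[OF homeomorphic_map_restrict this \<delta>'(2,3) \<gamma>'(2,3)]
    have "homology_basis (top_of_set (\<Phi> ` ?F)) (loop_class (top_of_set (\<Phi> ` ?F)) (\<lambda>t. \<Phi> (\<gamma>\<^sub>L (\<epsilon>\<^sub>1 * (2 * pi * t)))))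
        (loop_class (top_of_set (\<Phi> ` ?F)) (transport_cycles \<gamma> z))"
      by (simp add: o_def \<delta>_def transport_cycles_def[abs_def] mult.left_commute)
    \<comment> \<open>The time is multiplied by \<open>\<epsilon>\<^sub>1\<close> because \<Phi>
      carries the Hamiltonian field of L to \<open>\<epsilon>\<^sub>1\<close> times that of
      L'.\<close>
    moreover have "integral_curve M' (ham_L M') (\<lambda>t. \<Phi> (\<gamma>\<^sub>L (\<epsilon>\<^sub>1 * t)))"
      by (rule integral_curve_transport[OF L(1) smooth_ham_L ham_L])
    moreover have "\<Phi> (\<gamma>\<^sub>L (\<epsilon>\<^sub>1 * (t + 2 * pi))) = \<Phi> (\<gamma>\<^sub>L (\<epsilon>\<^sub>1 * t))" for t
      using L(2)[of t] L(2)[of "- t - 2 * pi"] signs(1) by auto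
    moreover have "range (\<lambda>t. \<Phi> (\<gamma>\<^sub>L (\<epsilon>\<^sub>1 * t))) \<subseteq> \<Phi> ` ?F" using L(3) by auto
    ultimately show ?thesis unfolding fiber_transport by (intro exI[of _ "\<lambda>t. \<Phi> (\<gamma>\<^sub>L (\<epsilon>\<^sub>1 * t))"]) simp
  qed
  show "\<exists>d>0. ((\<lambda>s. action M' (pullback_form M \<Psi> \<alpha>) (transport_cycles \<gamma>) (z + of_real s * \<i>))
      has_real_derivative d) (at 0)"
  proof -
    obtain d where d: "d > 0" "((\<lambda>s. action M \<alpha> \<gamma> (E z + of_real s * \<i>)) has_real_derivative d) (at 0)"
      using cyc z unfolding admissible_cycles_def by blast
    have "((\<lambda>s. \<epsilon>\<^sub>2 * s) has_real_derivative \<epsilon>\<^sub>2) (at 0)" by (auto intro!: derivative_eq_intros)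
    then have "((\<lambda>s. \<epsilon>\<^sub>2 * action M \<alpha> \<gamma> (E z + of_real (\<epsilon>\<^sub>2 * s) * \<i>)) has_real_derivative \<epsilon>\<^sub>2 * (d * \<epsilon>\<^sub>2)) (at 0)"
      using DERIV_chain2[of "\<lambda>s. action M \<alpha> \<gamma> (E z + of_real s * \<i>)" d "\<lambda>s. \<epsilon>\<^sub>2 * s" 0] d(2)
      by (intro DERIV_cmult) auto
    \<comment> \<open>The sign enters twice, from the action and from the inner derivative, so the
      derivative in j is d itself and stays positive.\<close>
    moreover have "\<epsilon>\<^sub>2 * (d * \<epsilon>\<^sub>2) = d" by (simp add: mult.commute[of d])
    ultimately have der: "((\<lambda>s. \<epsilon>\<^sub>2 * action M \<alpha> \<gamma> (E z + of_real (\<epsilon>\<^sub>2 * s) * \<i>)) has_real_derivative d) (at 0)"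
      by (simp only:)
    \<comment> \<open>The relation between the actions is known where E maps into B; openness of B
      makes it available for all small s.\<close>
    have op: "open ((\<lambda>s. z + of_real s * \<i>) -` (E -` B))"
      by (intro open_vimage open_vimage_E B) (auto intro!: continuous_intros)
    have "((\<lambda>s. action M' (pullback_form M \<Psi> \<alpha>) (transport_cycles \<gamma>) (z + of_real s * \<i>))
        has_real_derivative d) (at 0)"
    proof (rule has_field_derivative_transform_within_open[OF der op])
      fix s assume "s \<in> (\<lambda>s. z + of_real s * \<i>) -` (E -` B)"
      then have "action M' (pullback_form M \<Psi> \<alpha>) (transport_cycles \<gamma>) (z + of_real s * \<i>)
          = \<epsilon>\<^sub>2 * action M \<alpha> \<gamma> (E (z + of_real s * \<i>))"
        by (intro action_transport[OF \<alpha> _ sm sat per]) auto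
      moreover have "E (z + of_real s * \<i>) = E z + of_real (\<epsilon>\<^sub>2 * s) * \<i>"
        by (simp add: complex_eq_iff algebra_simps)
      ultimately show "\<epsilon>\<^sub>2 * action M \<alpha> \<gamma> (E z + of_real (\<epsilon>\<^sub>2 * s) * \<i>)
          = action M' (pullback_form M \<Psi> \<alpha>) (transport_cycles \<gamma>) (z + of_real s * \<i>)" by simp
    qed (use z in simp)
    then show ?thesis using d by blast
  qed
qed

text \<open>Within the image of B, E tends to 0 in B while avoiding 0, so the limit within B can be
  composed with E.\<close>

lemma action_tendsto_transport:
  assumes lim: "(action M \<alpha> \<gamma> \<longlongrightarrow> I\<^sub>0) (at 0 within B)"
    and eq: "\<And>z. E z \<in> B \<Longrightarrow> action' z = \<epsilon>\<^sub>2 * action M \<alpha> \<gamma> (E z)"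
  shows "(action' \<longlongrightarrow> \<epsilon>\<^sub>2 * I\<^sub>0) (at 0 within E ` B)"
proof -
  have "isCont E 0" using continuous_on_E continuous_on_eq_continuous_at open_UNIV by blast
  then have "(E \<longlongrightarrow> 0) (at 0 within E ` B)"
    by (metis isCont_def plane_reflection_simps(3) tendsto_within_subset top_greatest)
  moreover have "eventually (\<lambda>z. E z \<in> B \<and> E z \<noteq> 0) (at 0 within E ` B)"
    by (auto simp: eventually_at_filter image_E)
  ultimately have "filterlim E (at 0 within B) (at 0 within E ` B)"
    by (auto simp: filterlim_at eventually_mono)
  from tendsto_mult_left[OF filterlim_compose[OF lim this], of \<epsilon>\<^sub>2]
  show ?thesis
    by (rule Lim_transform_eventually) (auto simp: eventually_at_filter image_E eq)
qed

lemma taylor_representative_transport: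
  assumes "taylor_representative M m T"
  shows "taylor_representative M' (\<Phi> m)
    (fps_real \<epsilon>\<^sub>2 * fps_scale_args \<epsilon>\<^sub>1 \<epsilon>\<^sub>2 T + fps_real ((1 - \<epsilon>\<^sub>1) / 2 * pi) * fps_l)"
proof -
  interpret inv: integrable_iso \<epsilon>\<^sub>1 \<epsilon>\<^sub>2 M' M \<Psi> by (rule inverse_iso)
  obtain U \<phi> \<rho> \<alpha> \<sigma> lg \<gamma> I\<^sub>0 S V B where
    B: "B = \<rho> ` momentum M ` U - vertical_ray \<sigma>" and
    ch: "admissible_chart M m U \<phi> \<rho>" and \<alpha>: "primitive_on M (saturation M U) \<alpha>" and
    \<sigma>: "\<sigma> \<in> {-1, 1}" and lg: "log_determination (vertical_ray \<sigma>) lg" and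
    cyc: "admissible_cycles M U \<rho> B \<alpha> \<gamma>" and lim: "(action M \<alpha> \<gamma> \<longlongrightarrow> I\<^sub>0) (at 0 within B)" and
    V: "0 \<in> V" "V \<subseteq> \<rho> ` momentum M ` U" and S: "smooth_on V S" and
    Seq: "\<And>z. z \<in> V - vertical_ray \<sigma> \<Longrightarrow>
           S z = 2 * pi * action M \<alpha> \<gamma> z - 2 * pi * I\<^sub>0 + Im (z * lg z - z)" and
    T: "T = taylor_series S"
    using assms unfolding taylor_representative_def Let_def by blast
  obtain g where g: "symplectomorphism_on R4 UNIV R4 UNIV g" "g 0 = 0" "\<And>x. ff_model (g x) = E (ff_model x)"
    using ff_model_symmetry by blast
  obtain lg' where lg': "log_determination (vertical_ray (\<epsilon>\<^sub>2 * \<sigma>)) lg'"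
    "\<And>z. Im (z * lg' z - z) = \<epsilon>\<^sub>2 * Im (E z * lg (E z) - E z) + (1 - \<epsilon>\<^sub>1) / 2 * pi * Re z"
    using log_determination_reflect[OF lg] by blast
  define \<alpha>' where "\<alpha>' = pullback_form M \<Psi> \<alpha>"
  \<comment> \<open>Found by inserting \<open>\<epsilon>\<^sub>2\<close> I(E(z)) for the action and
    the formula for \<open>lg'\<close> into the defining expression of the new series.\<close>
  define S' where "S' z = \<epsilon>\<^sub>2 * S (E z) + (1 - \<epsilon>\<^sub>1) / 2 * pi * Re z" for z
  let ?\<rho> = "E \<circ> \<rho> \<circ> E" and ?\<gamma> = "transport_cycles \<gamma>"
  have B': "E ` B = ?\<rho> ` momentum M' ` \<Phi> ` U - vertical_ray (\<epsilon>\<^sub>2 * \<sigma>)"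
  proof -
    have "inj E" by (rule injI) simp
    moreover have "E ` vertical_ray \<sigma> = vertical_ray (\<epsilon>\<^sub>2 * \<sigma>)" by (auto simp: image_E vertical_ray_E)
    ultimately show ?thesis unfolding conjugate_image B by (simp add: image_set_diff)
  qed
  have act: "action M' \<alpha>' ?\<gamma> z = \<epsilon>\<^sub>2 * action M \<alpha> \<gamma> (E z)" if "E z \<in> B" for z
    unfolding \<alpha>'_def using cyc
    by (intro action_transport[OF \<alpha> that]) (auto simp: admissible_cycles_def fiber_def)
  have "smooth_on (E -` V) S'"
    unfolding S'_def
    using smooth_on_linear_compose[OF bounded_linear_mult_right smooth_on_compose_E[OF S], of \<epsilon>\<^sub>2]
      smooth_on_bounded_linear[OF bounded_linear_compose[OF bounded_linear_mult_right bounded_linear_Re]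
        open_vimage_E[OF smooth_on_open[OF S]], of "(1 - \<epsilon>\<^sub>1) / 2 * pi"]
    by (intro smooth_on_add) (simp_all add: o_def)
  moreover have "S' z = 2 * pi * action M' \<alpha>' ?\<gamma> z - 2 * pi * (\<epsilon>\<^sub>2 * I\<^sub>0) + Im (z * lg' z - z)"
    if "z \<in> E -` V - vertical_ray (\<epsilon>\<^sub>2 * \<sigma>)" for z
  proof -
    have z: "E z \<in> V - vertical_ray \<sigma>" "E z \<in> B" using that V B by (auto simp: vertical_ray_E)
    show ?thesis unfolding S'_def Seq[OF z(1)] lg'(2) act[OF z(2)] by (simp add: algebra_simps)
  qed
  moreover have "primitive_on M' (saturation M' (\<Phi> ` U)) \<alpha>'"
    using inv.primitive_on_pullback[OF \<alpha>] by (simp add: saturation_transport \<alpha>'_def)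
  moreover have "\<epsilon>\<^sub>2 * \<sigma> \<in> {-1, 1}" using \<sigma> signs by auto
  moreover have "0 \<in> E -` V" "E -` V \<subseteq> ?\<rho> ` momentum M' ` \<Phi> ` U"
    unfolding conjugate_image using V by (auto simp: image_E)
  moreover have "fps_real \<epsilon>\<^sub>2 * fps_scale_args \<epsilon>\<^sub>1 \<epsilon>\<^sub>2 T + fps_real ((1 - \<epsilon>\<^sub>1) / 2 * pi) * fps_l = taylor_series S'"
    unfolding T S'_def by (rule taylor_series_reflect[OF S V(1), symmetric])
  moreover have "admissible_cycles M' (\<Phi> ` U) ?\<rho> (E ` B) \<alpha>' ?\<gamma>"
    unfolding \<alpha>'_def by (rule admissible_cycles_transport[OF cyc \<alpha>])
  moreover have "(action M' \<alpha>' ?\<gamma> \<longlongrightarrow> \<epsilon>\<^sub>2 * I\<^sub>0) (at 0 within E ` B)"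
    by (rule action_tendsto_transport[OF lim act])
  ultimately show ?thesis
    using admissible_chart_transport[OF ch g] lg'(1) unfolding taylor_representative_def Let_def B'
    by blast
qed

end

theorem proposition1p5:
  fixes M :: "'a::{t2_space,second_countable_topology} integrable_data"
    and M' :: "'b::{t2_space,second_countable_topology} integrable_data"
    and m :: 'a and \<Phi> :: "'a \<Rightarrow> 'b" and \<epsilon>\<^sub>1 \<epsilon>\<^sub>2 :: real
  assumes "semitoric_system M" and "semitoric_system M'"
    and "focus_focus_point M m"
    and "\<And>p. momentum M p = momentum M m \<Longrightarrow> singular_point M p \<Longrightarrow> p = m"
    and "symplectomorphism_on M UNIV M' UNIV \<Phi>"
    and "\<epsilon>\<^sub>1 \<in> {-1, 1}" and "\<epsilon>\<^sub>2 \<in> {-1, 1}"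
    and "\<And>p. ham_L M' (\<Phi> p) = \<epsilon>\<^sub>1 * ham_L M p"
    and "\<And>p. ham_H M' (\<Phi> p) = \<epsilon>\<^sub>2 * ham_H M p"
  shows "focus_focus_point M' (\<Phi> m) \<and>
    taylor_series_invariant M m =
      (\<lambda>T'. fps_real \<epsilon>\<^sub>2 * fps_scale_args \<epsilon>\<^sub>1 \<epsilon>\<^sub>2 T' + fps_real ((1 - \<epsilon>\<^sub>1) / 2 * pi) * fps_l)
        ` taylor_series_invariant M' (\<Phi> m)"
proof
  interpret integrable_iso \<epsilon>\<^sub>1 \<epsilon>\<^sub>2 M M' \<Phi>
    using assms(1,2,5-9) by unfold_locales (auto simp: semitoric_system_def integrable_system_def)
  interpret inv: integrable_iso \<epsilon>\<^sub>1 \<epsilon>\<^sub>2 M' M \<Psi> by (rule inverse_iso)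
  show "focus_focus_point M' (\<Phi> m)" by (rule focus_focus_point_transport[OF assms(3)])
  let ?r = "\<lambda>T'. fps_real \<epsilon>\<^sub>2 * fps_scale_args \<epsilon>\<^sub>1 \<epsilon>\<^sub>2 T' + fps_real ((1 - \<epsilon>\<^sub>1) / 2 * pi) * fps_l"
  let ?p = "\<lambda>k::int. of_int k * fps_real (2 * pi) * fps_l"
  have rep: "taylor_representative M' (\<Phi> m) (?r T)" if "taylor_representative M m T" for T
    using taylor_representative_transport[OF that] .
  \<comment> \<open>The inverse isomorphism has the same signs, hence the same
    transformation.\<close>
  have rep': "taylor_representative M m (?r T)" if "taylor_representative M' (\<Phi> m) T" for T
    using inv.taylor_representative_transport[OF that] by simp
  show "taylor_series_invariant M m = ?r ` taylor_series_invariant M' (\<Phi> m)"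
  proof (intro equalityI subsetI)
    fix X assume "X \<in> taylor_series_invariant M m"
    then obtain T k where T: "taylor_representative M m T" "X = T + ?p k" using taylor_series_invariant_iff by blast
    \<comment> \<open>The preimage of X is \<open>?r T\<close>, corrected by a multiple of 2\<pi> l
      because the transformation is an involution only modulo such multiples.\<close>
    obtain j where j: "?r (?r T + ?p j) = T + ?p k" using fps_reflect_involution by blast
    have "?r T + ?p j \<in> taylor_series_invariant M' (\<Phi> m)" using taylor_series_invariant_iff rep[OF T(1)] by blast
    then have "?r (?r T + ?p j) \<in> ?r ` taylor_series_invariant M' (\<Phi> m)" by (rule imageI)
    then show "X \<in> ?r ` taylor_series_invariant M' (\<Phi> m)" unfolding j T(2) .
  next
    fix X assume "X \<in> ?r ` taylor_series_invariant M' (\<Phi> m)"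
    then obtain Y where Y: "Y \<in> taylor_series_invariant M' (\<Phi> m)" "X = ?r Y" by (rule imageE)
    then obtain T k where T: "taylor_representative M' (\<Phi> m) T" "X = ?r (T + ?p k)"
      using taylor_series_invariant_iff[of Y M' "\<Phi> m"] by metis
    obtain j where "?r (T + ?p k) = ?r T + ?p j" using fps_reflect_shift by blast
    then show "X \<in> taylor_series_invariant M m" using taylor_series_invariant_iff T rep'[OF T(1)] by blast
  qed
qed

end
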